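(* Let $P$ be a closed sum-free $\pi$-calculus process, i.e. $\mathrm{fn}(P)=\emptyset$. If $P\to Q$, then there exists a $C_\pi$ process $R$ such that $[\![P]\!]\xrightarrow{\tau}^{*}R$ and $R\sim[\![Q]\!]$.
   Context: Source language: the sum-free monadic $\pi$-calculus with prefixes $\pi::=\overline{a}\langle b\rangle\mid a(x)\mid[a=b]\pi$ and processes $P::=0\mid\pi.P\mid P|P\mid(\nu a)P\mid\,!P$, identified up to $\alpha$-conversion. Structural congruence $\equiv$ is the standard one: the least congruence containing $\alpha$-conversion, $[a=a]\pi.P\equiv\pi.P$, the associativity, commutativity and unit laws for $|$ and $0$, $(\nu k)(\nu l)P\equiv(\nu l)(\nu k)P$, $(\nu k)0\equiv0$, $P|(\nu k)Q\equiv(\nu k)(P|Q)$ if $k\notin\mathrm{fn}(P)$, and $!P\equiv P|!P$. Reduction $\to$ is the least relation such that $\overline{a}\langle b\rangle.P|a(x).Q\to P|Q\{b/x\}$, closed under $|$, $(\nu k)$ and $\equiv$. Target language: polyadic $C_\pi$, with the same constructs except that outputs $\overline{a}\langle k_1,\dots,k_n\rangle$ carry tuples of channels (never input-bound variables) and inputs $a(x_1,\dots,x_n)$ bind tuples of variables. It has the standard early labelled transition system adapted to polyadic communication. $\xrightarrow{\tau}^{*}$ denotes the transitive closure of $\xrightarrow{\tau}$. Strong bisimilarity $\sim$ is the largest symmetric relation such that whenever $P\sim Q$ and $P\xrightarrow{\alpha}P'$ with $\mathrm{bn}(\alpha)\cap\mathrm{fn}(Q)=\emptyset$, there exists $Q'$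 with $Q\xrightarrow{\alpha}Q'$ and $P'\sim Q'$. Renaming policy $\varphi$: it maps every source name $a$ to a triple $(a,n_a,m_a)$. The names $n_a,m_a$ do not occur in any source term, and different source names receive pairwise distinct extra names. Additional names used by the translation ($e_1,e_2,t,x',x_1,x_2,y$) are taken from a reserved set, disjoint from all source names and from all names introduced by $\varphi$. Write $(\nu a,b,c)$ for $(\nu a)(\nu b)(\nu c)$. Handler of a name $k$: $$H_k= !n_k(x).\overline{x}\langle k\rangle.0\;|\;!m_k(x_1,x_2).x_1(y).(\nu t)\overline{y}\langle k,n_k,m_k,t\rangle.\overline{x_2}\langle t\rangle.0.$$ Translation $[\![\cdot]\!]$, where $[\tilde c=\tilde d]$ abbreviates a possibly empty sequence of matches: - $[\![(\nu k)P]\!]=(\nu k,n_k,m_k)([\![P]\!]\;|\;H_k)$. - $[\![[\tilde c=\tilde d]\overline{a}\langle b\rangle.P]\!]=(\nu e_1,e_2)[\tilde c=\tilde d]\overline{n_a}\langle e_1\rangle.\overline{m_b}\langle e_1,e_2\rangle.e_2(y).\overline{y}\langle e_1\rangle.[\![P]\!]$. - $[\![[\tilde c=\tilde d]a(x).P]\!]=[\tilde c=\tilde d]a(x,n_x,m_x,x').x'(y).[\![P]\!]$. - $[\![P_1|P_2]\!]=[\![P_1]\!]|[\![P_2]\!]$, $[\![!P]\!]=![\![P]\!]$, and $[\![0]\!]=0$. Here the reserved names are never free in $[\![P]\!]$. *)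

theory Defs
  imports Main
begin

datatype spref = SOut nat nat | SIn nat nat | SMatch nat nat spref
datatype sproc = SNil | SPre spref sproc | SPar sproc sproc | SRes nat sproc | SBang sproc

fun spnames :: "spref \<Rightarrow> nat set" where
  "spnames (SOut a b) = {a, b}"
| "spnames (SIn a x) = {a, x}"
| "spnames (SMatch a b p) = {a, b} \<union> spnames p"

fun spfn :: "spref \<Rightarrow> nat set" where
  "spfn (SOut a b) = {a, b}"
| "spfn (SIn a x) = {a}"
| "spfn (SMatch a b p) = {a, b} \<union> spfn p"

fun spbind :: "spref \<Rightarrow> nat set" where
  "spbind (SOut a b) = {}"
| "spbind (SIn a x) = {x}"
| "spbind (SMatch a b p) = spbind p"

fun snames :: "sproc \<Rightarrow> nat set" where
  "snames SNil = {}"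
| "snames (SPre p P) = spnames p \<union> snames P"
| "snames (SPar P Q) = snames P \<union> snames Q"
| "snames (SRes k P) = insert k (snames P)"
| "snames (SBang P) = snames P"

fun sfn :: "sproc \<Rightarrow> nat set" where
  "sfn SNil = {}"
| "sfn (SPre p P) = spfn p \<union> (sfn P - spbind p)"
| "sfn (SPar P Q) = sfn P \<union> sfn Q"
| "sfn (SRes k P) = sfn P - {k}"
| "sfn (SBang P) = sfn P"

fun sbn :: "sproc \<Rightarrow> nat set" where
  "sbn SNil = {}"
| "sbn (SPre p P) = spbind p \<union> sbn P"
| "sbn (SPar P Q) = sbn P \<union> sbn Q"
| "sbn (SRes k P) = insert k (sbn P)"
| "sbn (SBang P) = sbn P"

text \<open>naive (shadowing-respecting) renaming; capture is excluded by side conditions where used\<close>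
fun spsub :: "(nat \<Rightarrow> nat) \<Rightarrow> spref \<Rightarrow> spref" where
  "spsub s (SOut a b) = SOut (s a) (s b)"
| "spsub s (SIn a x) = SIn (s a) x"
| "spsub s (SMatch a b p) = SMatch (s a) (s b) (spsub s p)"

fun ssubst :: "(nat \<Rightarrow> nat) \<Rightarrow> sproc \<Rightarrow> sproc" where
  "ssubst s SNil = SNil"
| "ssubst s (SPre p P) = SPre (spsub s p) (ssubst (\<lambda>z. if z \<in> spbind p then z else s z) P)"
| "ssubst s (SPar P Q) = SPar (ssubst s P) (ssubst s Q)"
| "ssubst s (SRes k P) = SRes k (ssubst (s(k := k)) P)"
| "ssubst s (SBang P) = SBang (ssubst s P)"

fun sprebind :: "spref \<Rightarrow> nat \<Rightarrow> spref" where
  "sprebind (SOut a b) y = SOut a b"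
| "sprebind (SIn a x) y = SIn a y"
| "sprebind (SMatch a b p) y = SMatch a b (sprebind p y)"

inductive salpha :: "sproc \<Rightarrow> sproc \<Rightarrow> bool" where
  ren_res: "y \<notin> snames P \<Longrightarrow> salpha (SRes k P) (SRes y (ssubst (id(k := y)) P))"
| ren_in: "spbind p = {x} \<Longrightarrow> y \<notin> snames P \<Longrightarrow>
           salpha (SPre p P) (SPre (sprebind p y) (ssubst (id(x := y)) P))"

inductive scong :: "sproc \<Rightarrow> sproc \<Rightarrow> bool" where
  alpha: "salpha P Q \<Longrightarrow> scong P Q"
| refl: "scong P P"
| sym: "scong P Q \<Longrightarrow> scong Q P"
| trans: "scong P Q \<Longrightarrow> scong Q R \<Longrightarrow> scong P R"
| pre: "scong P Q \<Longrightarrow> scong (SPre p P) (SPre p Q)"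
| par: "scong P P' \<Longrightarrow> scong Q Q' \<Longrightarrow> scong (SPar P Q) (SPar P' Q')"
| res: "scong P Q \<Longrightarrow> scong (SRes k P) (SRes k Q)"
| bang: "scong P Q \<Longrightarrow> scong (SBang P) (SBang Q)"
| match: "scong (SPre (SMatch a a p) P) (SPre p P)"
| par_assoc: "scong (SPar (SPar P Q) R) (SPar P (SPar Q R))"
| par_comm: "scong (SPar P Q) (SPar Q P)"
| par_unit: "scong (SPar P SNil) P"
| res_comm: "scong (SRes k (SRes l P)) (SRes l (SRes k P))"
| res_nil: "scong (SRes k SNil) SNil"
| extr: "k \<notin> sfn P \<Longrightarrow> scong (SPar P (SRes k Q)) (SRes k (SPar P Q))"
| bang_unf: "scong (SBang P) (SPar P (SBang P))"

inductive sred :: "sproc \<Rightarrow> sproc \<Rightarrow> bool" where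
  comm: "b \<notin> sbn Q \<Longrightarrow>
         sred (SPar (SPre (SOut a b) P) (SPre (SIn a x) Q)) (SPar P (ssubst (id(x := b)) Q))"
| par: "sred P P' \<Longrightarrow> sred (SPar P Q) (SPar P' Q)"
| res: "sred P P' \<Longrightarrow> sred (SRes k P) (SRes k P')"
| cong: "scong P P' \<Longrightarrow> sred P' Q' \<Longrightarrow> scong Q' Q \<Longrightarrow> sred P Q"

text \<open>Target names: Nm a is the source name a, Nn a = n_a, Mm a = m_a, Rv i reserved names.\<close>
datatype tname = Nm nat | Nn nat | Mm nat | Rv nat

datatype tpref = TOut tname "tname list" | TIn tname "tname list" | TMatch tname tname tpref
datatype tproc = TNil | TPre tpref tproc | TPar tproc tproc | TRes tname tproc | TBang tproc

fun tpnames :: "tpref \<Rightarrow> tname set" where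
  "tpnames (TOut a ks) = insert a (set ks)"
| "tpnames (TIn a xs) = insert a (set xs)"
| "tpnames (TMatch a b p) = {a, b} \<union> tpnames p"

fun tpfn :: "tpref \<Rightarrow> tname set" where
  "tpfn (TOut a ks) = insert a (set ks)"
| "tpfn (TIn a xs) = {a}"
| "tpfn (TMatch a b p) = {a, b} \<union> tpfn p"

fun tpbl :: "tpref \<Rightarrow> tname list" where
  "tpbl (TOut a ks) = []"
| "tpbl (TIn a xs) = xs"
| "tpbl (TMatch a b p) = tpbl p"

fun tnames :: "tproc \<Rightarrow> tname set" where
  "tnames TNil = {}"
| "tnames (TPre p P) = tpnames p \<union> tnames P"
| "tnames (TPar P Q) = tnames P \<union> tnames Q"
| "tnames (TRes k P) = insert k (tnames P)"
| "tnames (TBang P) = tnames P"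

fun tfn :: "tproc \<Rightarrow> tname set" where
  "tfn TNil = {}"
| "tfn (TPre p P) = tpfn p \<union> (tfn P - set (tpbl p))"
| "tfn (TPar P Q) = tfn P \<union> tfn Q"
| "tfn (TRes k P) = tfn P - {k}"
| "tfn (TBang P) = tfn P"

fun tbn :: "tproc \<Rightarrow> tname set" where
  "tbn TNil = {}"
| "tbn (TPre p P) = set (tpbl p) \<union> tbn P"
| "tbn (TPar P Q) = tbn P \<union> tbn Q"
| "tbn (TRes k P) = insert k (tbn P)"
| "tbn (TBang P) = tbn P"

fun tpsub :: "(tname \<Rightarrow> tname) \<Rightarrow> tpref \<Rightarrow> tpref" where
  "tpsub s (TOut a ks) = TOut (s a) (map s ks)"
| "tpsub s (TIn a xs) = TIn (s a) xs"
| "tpsub s (TMatch a b p) = TMatch (s a) (s b) (tpsub s p)"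

fun tsubst :: "(tname \<Rightarrow> tname) \<Rightarrow> tproc \<Rightarrow> tproc" where
  "tsubst s TNil = TNil"
| "tsubst s (TPre p P) = TPre (tpsub s p) (tsubst (\<lambda>z. if z \<in> set (tpbl p) then z else s z) P)"
| "tsubst s (TPar P Q) = TPar (tsubst s P) (tsubst s Q)"
| "tsubst s (TRes k P) = TRes k (tsubst (s(k := k)) P)"
| "tsubst s (TBang P) = TBang (tsubst s P)"

text \<open>simultaneous update xs |-> ks (later entries win)\<close>
definition upds :: "(tname \<Rightarrow> tname) \<Rightarrow> tname list \<Rightarrow> tname list \<Rightarrow> (tname \<Rightarrow> tname)" where
  "upds s xs ks = fold (\<lambda>(x, k) f. f(x := k)) (zip xs ks) s"

fun tprebind :: "tpref \<Rightarrow> tname list \<Rightarrow> tpref" where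
  "tprebind (TOut a ks) ys = TOut a ks"
| "tprebind (TIn a xs) ys = TIn a ys"
| "tprebind (TMatch a b p) ys = TMatch a b (tprebind p ys)"

inductive talpha :: "tproc \<Rightarrow> tproc \<Rightarrow> bool" where
  refl: "talpha P P"
| sym: "talpha P Q \<Longrightarrow> talpha Q P"
| trans: "talpha P Q \<Longrightarrow> talpha Q R \<Longrightarrow> talpha P R"
| pre: "talpha P Q \<Longrightarrow> talpha (TPre p P) (TPre p Q)"
| par: "talpha P P' \<Longrightarrow> talpha Q Q' \<Longrightarrow> talpha (TPar P Q) (TPar P' Q')"
| res: "talpha P Q \<Longrightarrow> talpha (TRes k P) (TRes k Q)"
| bang: "talpha P Q \<Longrightarrow> talpha (TBang P) (TBang Q)"
| ren_res: "y \<notin> tnames P \<Longrightarrow> talpha (TRes k P) (TRes y (tsubst (id(k := y)) P))"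
| ren_in: "tpbl p = xs \<Longrightarrow> length ys = length xs \<Longrightarrow> distinct ys \<Longrightarrow> set ys \<inter> tnames P = {} \<Longrightarrow>
           talpha (TPre p P) (TPre (tprebind p ys) (tsubst (upds id xs ys) P))"

text \<open>Actions: tau, early input a<ks>, (possibly bound) output (nu bs) a<ks>\<close>
datatype act = Tau | Inp tname "tname list" | Outp tname "tname list" "tname set"

fun abn :: "act \<Rightarrow> tname set" where
  "abn Tau = {}"
| "abn (Inp a ks) = {}"
| "abn (Outp a ks bs) = bs"

fun anames :: "act \<Rightarrow> tname set" where
  "anames Tau = {}"
| "anames (Inp a ks) = insert a (set ks)"
| "anames (Outp a ks bs) = insert a (set ks) \<union> bs"

definition resl :: "tname list \<Rightarrow> tproc \<Rightarrow> tproc" where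
  "resl bl P = foldr TRes bl P"

inductive tstep :: "tproc \<Rightarrow> act \<Rightarrow> tproc \<Rightarrow> bool" where
  out: "tstep (TPre (TOut a ks) P) (Outp a ks {}) P"
| inp: "length ks = length xs \<Longrightarrow> set ks \<inter> tbn P = {} \<Longrightarrow>
        tstep (TPre (TIn a xs) P) (Inp a ks) (tsubst (upds id xs ks) P)"
| match: "tstep (TPre p P) \<alpha> P' \<Longrightarrow> tstep (TPre (TMatch a a p) P) \<alpha> P'"
| parl: "tstep P \<alpha> P' \<Longrightarrow> abn \<alpha> \<inter> tfn Q = {} \<Longrightarrow> tstep (TPar P Q) \<alpha> (TPar P' Q)"
| parr: "tstep Q \<alpha> Q' \<Longrightarrow> abn \<alpha> \<inter> tfn P = {} \<Longrightarrow> tstep (TPar P Q) \<alpha> (TPar P Q')"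
| comml: "tstep P (Outp a ks bs) P' \<Longrightarrow> tstep Q (Inp a ks) Q' \<Longrightarrow> bs \<inter> tfn Q = {} \<Longrightarrow>
          distinct bl \<Longrightarrow> set bl = bs \<Longrightarrow> tstep (TPar P Q) Tau (resl bl (TPar P' Q'))"
| commr: "tstep P (Inp a ks) P' \<Longrightarrow> tstep Q (Outp a ks bs) Q' \<Longrightarrow> bs \<inter> tfn P = {} \<Longrightarrow>
          distinct bl \<Longrightarrow> set bl = bs \<Longrightarrow> tstep (TPar P Q) Tau (resl bl (TPar P' Q'))"
| res: "tstep P \<alpha> P' \<Longrightarrow> z \<notin> anames \<alpha> \<Longrightarrow> tstep (TRes z P) \<alpha> (TRes z P')"
| opn: "tstep P (Outp a ks bs) P' \<Longrightarrow> z \<in> set ks \<Longrightarrow> z \<noteq> a \<Longrightarrow> z \<notin> bs \<Longrightarrow>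
        tstep (TRes z P) (Outp a ks (insert z bs)) P'"
| rep: "tstep (TPar P (TBang P)) \<alpha> P' \<Longrightarrow> tstep (TBang P) \<alpha> P'"
| alpha: "talpha P P' \<Longrightarrow> tstep P' \<alpha> Q \<Longrightarrow> tstep P \<alpha> Q"

definition tau_plus :: "tproc \<Rightarrow> tproc \<Rightarrow> bool" where
  "tau_plus = (\<lambda>P Q. tstep P Tau Q)\<^sup>+\<^sup>+"

definition strong_bisimulation :: "(tproc \<Rightarrow> tproc \<Rightarrow> bool) \<Rightarrow> bool" where
  "strong_bisimulation Rel \<longleftrightarrow> (\<forall>P Q. Rel P Q \<longrightarrow> Rel Q P) \<and>
     (\<forall>P Q \<alpha> P'. Rel P Q \<longrightarrow> tstep P \<alpha> P' \<longrightarrow> abn \<alpha> \<inter> tfn Q = {} \<longrightarrow>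
        (\<exists>Q'. tstep Q \<alpha> Q' \<and> Rel P' Q'))"

definition bisim :: "tproc \<Rightarrow> tproc \<Rightarrow> bool" where
  "bisim P Q \<longleftrightarrow> (\<exists>Rel. strong_bisimulation Rel \<and> Rel P Q)"

abbreviation "e1 \<equiv> Rv 0"
abbreviation "e2 \<equiv> Rv 1"
abbreviation "tt \<equiv> Rv 2"
abbreviation "xp \<equiv> Rv 3"
abbreviation "x1 \<equiv> Rv 4"
abbreviation "x2 \<equiv> Rv 5"
abbreviation "yy \<equiv> Rv 6"
abbreviation "xx \<equiv> Rv 7"

definition handler :: "nat \<Rightarrow> tproc" where
  "handler k = TPar
     (TBang (TPre (TIn (Nn k) [xx]) (TPre (TOut xx [Nm k]) TNil)))
     (TBang (TPre (TIn (Mm k) [x1, x2]) (TPre (TIn x1 [yy])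
        (TRes tt (TPre (TOut yy [Nm k, Nn k, Mm k, tt]) (TPre (TOut x2 [tt]) TNil))))))"

fun mwrap :: "spref \<Rightarrow> tpref \<Rightarrow> tpref" where
  "mwrap (SMatch c d p) q = TMatch (Nm c) (Nm d) (mwrap p q)"
| "mwrap (SOut a b) q = q"
| "mwrap (SIn a x) q = q"

fun pcore :: "spref \<Rightarrow> spref" where
  "pcore (SMatch c d p) = pcore p"
| "pcore p = p"

fun tr :: "sproc \<Rightarrow> tproc" where
  "tr SNil = TNil"
| "tr (SPre p P) = (case pcore p of
      SOut a b \<Rightarrow> TRes e1 (TRes e2 (TPre (mwrap p (TOut (Nn a) [e1]))
                    (TPre (TOut (Mm b) [e1, e2]) (TPre (TIn e2 [yy]) (TPre (TOut yy [e1]) (tr P))))))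
    | SIn a x \<Rightarrow> TPre (mwrap p (TIn (Nm a) [Nm x, Nn x, Mm x, xp])) (TPre (TIn xp [yy]) (tr P))
    | SMatch _ _ _ \<Rightarrow> undefined)"
| "tr (SPar P Q) = TPar (tr P) (tr Q)"
| "tr (SRes k P) = TRes (Nm k) (TRes (Nn k) (TRes (Mm k) (TPar (tr P) (handler k))))"
| "tr (SBang P) = TBang (tr P)"

end

theory Submission
  imports Defs "HOL-Library.Multiset"
begin

text \<open>
  Raw target terms are mapped by \<open>db\<close> to a locally nameless syntax, in which alpha-equivalent terms
  are equal, substitution is renaming, and the transition system has usable inversion principles.
  There we define a structural congruence \<open>dcong\<close> that is closed under arbitrary renaming (strong
  bisimilarity itself is not a congruence for input prefixes), contains the law that the handlers of
  an unused name vanish, and is shown to be a strong bisimulation.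

  The translation maps source congruence to \<open>dcong\<close>. A communication on \<open>a\<close> of the name \<open>b\<close> is
  simulated by six internal steps that use the handlers of \<open>a\<close> and \<open>b\<close>. Accordingly, the induction on
  reductions is carried out for \<open>tr P\<close> in parallel with handlers of unguarded names of \<open>P\<close>; a
  restriction supplies the handler of its name, and for a closed process no handlers are left over.
\<close>

section \<open>Processes up to alpha-conversion\<close>

text \<open>The shape of the translation comes from the rule that target outputs carry channels
  only: a sender may know \<open>b\<close> merely as a received variable, so it cannot transmit
  \<open>b\<close> itself. It transmits its private \<open>e1\<close> and \<open>e2\<close>, and the
  sending is done by the handler of \<open>b\<close>, in which \<open>b\<close> is a channel; the
  handler of \<open>a\<close> only reveals \<open>a\<close> to it over \<open>e1\<close>. The six
  steps therefore run on \<open>n_a\<close>, \<open>m_b\<close>, \<open>e1\<close>,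
  \<open>a\<close>, \<open>e2\<close> and \<open>t\<close>, and the last one unblocks both
  continuations together. By then the private names are out of use, and the replicated handlers are
  still there, so what remains is congruent to the expected result. Nearly every step needs a
  rearrangement first. This is why \<open>dcong\<close> has to be a bisimulation before the
  simulation can start: a rearrangement is then carried through all later transitions. The
  bisimulation property is checked rule by rule, for single steps whose targets are again related by
  \<open>dcong\<close>.\<close>

datatype dname = Fr tname | Bd nat

text \<open>An input stores only its arity \<open>n\<close>; its variables are the indices below
  \<open>n\<close> in the continuation, all bound at once.\<close>

datatype dpref = DOut dname "dname list" | DIn dname nat | DMatch dname dname dpref

datatype dproc = DNil | DPre dpref dproc | DPar dproc dproc | DRes dproc | DBang dproc

fun sh :: "nat \<Rightarrow> dname \<Rightarrow> dname" where
  "sh n (Fr a) = Fr a"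
| "sh n (Bd i) = Bd (i + n)"

text \<open>Renamings act on free names and indices alike. Hence weakening (\<open>sh\<close>),
  abstraction of names (\<open>cl\<close>), instantiation (\<open>opr\<close>) and substitution for
  free names (\<open>pm\<close>) are all instances of \<open>ren\<close> and share one composition
  law and one congruence law.\<close>

fun up :: "nat \<Rightarrow> (dname \<Rightarrow> dname) \<Rightarrow> dname \<Rightarrow> dname" where
  "up n r (Fr a) = sh n (r (Fr a))"
| "up n r (Bd i) = (if i < n then Bd i else sh n (r (Bd (i - n))))"

fun bnd :: "dpref \<Rightarrow> nat" where
  "bnd (DOut a ks) = 0"
| "bnd (DIn a n) = n"
| "bnd (DMatch a b p) = bnd p"

fun dpren :: "(dname \<Rightarrow> dname) \<Rightarrow> dpref \<Rightarrow> dpref" where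
  "dpren r (DOut a ks) = DOut (r a) (map r ks)"
| "dpren r (DIn a n) = DIn (r a) n"
| "dpren r (DMatch a b p) = DMatch (r a) (r b) (dpren r p)"

fun ren :: "(dname \<Rightarrow> dname) \<Rightarrow> dproc \<Rightarrow> dproc" where
  "ren r DNil = DNil"
| "ren r (DPre p P) = DPre (dpren r p) (ren (up (bnd p) r) P)"
| "ren r (DPar P Q) = DPar (ren r P) (ren r Q)"
| "ren r (DRes P) = DRes (ren (up 1 r) P)"
| "ren r (DBang P) = DBang (ren r P)"

fun dpfv :: "dpref \<Rightarrow> dname set" where
  "dpfv (DOut a ks) = insert a (set ks)"
| "dpfv (DIn a n) = {a}"
| "dpfv (DMatch a b p) = {a, b} \<union> dpfv p"

text \<open>Dangling indices count as free, so that \<open>ren_cong\<close> sees everything on which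
  a renaming can act.\<close>

fun fv :: "dproc \<Rightarrow> dname set" where
  "fv DNil = {}"
| "fv (DPre p P) = dpfv p \<union> {x. sh (bnd p) x \<in> fv P}"
| "fv (DPar P Q) = fv P \<union> fv Q"
| "fv (DRes P) = {x. sh 1 x \<in> fv P}"
| "fv (DBang P) = fv P"

definition fn :: "dproc \<Rightarrow> tname set" where
  "fn P = {a. Fr a \<in> fv P}"

lemma fn_simps [simp]:
  "fn DNil = {}"
  "fn (DPar P Q) = fn P \<union> fn Q"
  "fn (DRes P) = fn P"
  "fn (DBang P) = fn P"
  "fn (DPre p P) = {a. Fr a \<in> dpfv p} \<union> fn P"
  by (auto simp: fn_def)

lemma bnd_dpren [simp]: "bnd (dpren r p) = bnd p"
  by (induction p) auto

lemma sh_inj [simp]: "sh n x = sh n y \<longleftrightarrow> x = y"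
  by (cases x; cases y) auto

lemma up_sh [simp]: "up n r (sh n x) = sh n (r x)"
  by (cases x) auto

text \<open>The case split that replaces index arithmetic: a name below \<open>n\<close> binders
  either comes from outside or is one of the \<open>n\<close> new indices.\<close>

lemma sh_cases: obtains y where "x = sh n y" | i where "x = Bd i" "i < n"
proof (cases x)
  case (Fr a)
  then show ?thesis using that(1)[of "Fr a"] by simp
next
  case (Bd i)
  then show ?thesis using that(1)[of "Bd (i - n)"] that(2)[of i] by (cases "i < n") auto
qed

lemma up_comp: "up n r \<circ> up n s = up n (r \<circ> s)"
proof
  fix x show "(up n r \<circ> up n s) x = up n (r \<circ> s) x"
    by (rule sh_cases[of x n]) auto
qed

lemma up_id [simp]: "up n (\<lambda>x. x) = (\<lambda>x. x)"
proof
  fix x show "up n (\<lambda>x. x) x = x" by (rule sh_cases[of x n]) auto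
qed

lemma dpren_comp: "dpren r (dpren s p) = dpren (r \<circ> s) p"
  by (induction p) auto

lemma dpren_cong: "(\<And>x. x \<in> dpfv p \<Longrightarrow> r x = s x) \<Longrightarrow> dpren r p = dpren s p"
  by (induction p) auto

lemma dpfv_dpren: "dpfv (dpren r p) = r ` dpfv p"
  by (induction p) auto

lemma ren_comp: "ren r (ren s P) = ren (r \<circ> s) P"
  by (induction P arbitrary: r s) (auto simp: dpren_comp up_comp)

lemma up_cong:
  assumes "\<And>x. sh n x \<in> A \<Longrightarrow> r x = s x" "x \<in> A"
  shows "up n r x = up n s x"
  using assms by (cases rule: sh_cases[of x n]) auto

lemma ren_cong: "(\<And>x. x \<in> fv P \<Longrightarrow> r x = s x) \<Longrightarrow> ren r P = ren s P"
proof (induction P arbitrary: r s)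
  case (DPre p P)
  have "ren (up (bnd p) r) P = ren (up (bnd p) s) P"
    by (rule DPre.IH, rule up_cong[where A = "fv P"]) (auto intro: DPre.prems)
  then show ?case using DPre.prems by (simp cong: dpren_cong)
next
  case (DRes P)
  have "ren (up 1 r) P = ren (up 1 s) P"
    by (rule DRes.IH, rule up_cong[where A = "fv P"]) (auto intro: DRes.prems)
  then show ?case by simp
next
  case (DPar P Q)
  have "ren r P = ren s P" by (rule DPar.IH(1)) (simp add: DPar.prems)
  moreover have "ren r Q = ren s Q" by (rule DPar.IH(2)) (simp add: DPar.prems)
  ultimately show ?case by simp
next
  case (DBang P)
  have "ren r P = ren s P" by (rule DBang.IH) (simp add: DBang.prems)
  then show ?case by simp
qed simp

lemma dpren_id: "dpren (\<lambda>x. x) p = p"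
  by (induction p) auto

lemma ren_id: "ren (\<lambda>x. x) P = P"
  by (induction P) (auto simp: dpren_id)

lemma ren_ident: "(\<And>x. x \<in> fv P \<Longrightarrow> r x = x) \<Longrightarrow> ren r P = P"
  using ren_cong[of P r "\<lambda>x. x"] by (simp add: ren_id)

text \<open>The new indices are fixed by \<open>up n r\<close> and are not of the form
  \<open>sh n x\<close>, so only shifted elements of \<open>A\<close> contribute.\<close>

lemma up_image: "{x. sh n x \<in> up n r ` A} = r ` {x. sh n x \<in> A}"
proof (intro equalityI subsetI)
  fix x assume "x \<in> {x. sh n x \<in> up n r ` A}"
  then obtain y where y: "sh n x = up n r y" "y \<in> A" by auto
  show "x \<in> r ` {x. sh n x \<in> A}"
  proof (cases rule: sh_cases[of y n])
    case (1 z)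
    then show ?thesis using y by auto
  next
    case (2 i)
    then show ?thesis using y by (cases x) auto
  qed
next
  fix x assume "x \<in> r ` {x. sh n x \<in> A}"
  then obtain y where "x = r y" "sh n y \<in> A" by auto
  then have "sh n x = up n r (sh n y)" "sh n y \<in> A" by auto
  then show "x \<in> {x. sh n x \<in> up n r ` A}" by blast
qed

lemma fv_ren: "fv (ren r P) = r ` fv P"
  by (induction P arbitrary: r) (simp_all add: dpfv_dpren up_image[simplified] image_Un)

lemma finite_dpfv [simp]: "finite (dpfv p)"
  by (induction p) auto

lemma finite_fv [simp]: "finite (fv P)"
proof (induction P)
  case (DPre p P)
  have "finite {x. sh (bnd p) x \<in> fv P}"
    using finite_vimageI[OF DPre.IH, of "sh (bnd p)"] by (simp add: inj_def vimage_def)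
  then show ?case by simp
next
  case (DRes P)
  have "finite {x. sh 1 x \<in> fv P}"
    using finite_vimageI[OF DRes.IH, of "sh 1"] by (simp add: inj_def vimage_def)
  then show ?case by simp
qed auto

lemma finite_fn [simp]: "finite (fn P)"
  using finite_vimageI[OF finite_fv, of Fr P] by (simp add: inj_def vimage_def fn_def)

text \<open>With repeated names the last occurrence counts, as in \<open>upds\<close>.\<close>

fun lidx :: "tname list \<Rightarrow> tname \<Rightarrow> nat" where
  "lidx [] z = 0"
| "lidx (x # xs) z = (if z \<in> set xs then Suc (lidx xs z) else 0)"

fun cl :: "tname list \<Rightarrow> dname \<Rightarrow> dname" where
  "cl xs (Fr z) = (if z \<in> set xs then Bd (lidx xs z) else Fr z)"
| "cl xs (Bd i) = Bd (i + length xs)"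

fun opr :: "tname list \<Rightarrow> dname \<Rightarrow> dname" where
  "opr ks (Fr z) = Fr z"
| "opr ks (Bd i) = (if i < length ks then Fr (ks ! i) else Bd (i - length ks))"

fun pm :: "(tname \<Rightarrow> tname) \<Rightarrow> dname \<Rightarrow> dname" where
  "pm f (Fr z) = Fr (f z)"
| "pm f (Bd i) = Bd i"

text \<open>A restriction with a visible name inside the nameless syntax: scope rules can be written
  as in the raw calculus, while different admissible choices of the name give equal terms.\<close>

definition NRes :: "tname \<Rightarrow> dproc \<Rightarrow> dproc" where
  "NRes z P = DRes (ren (cl [z]) P)"

definition NRess :: "tname list \<Rightarrow> dproc \<Rightarrow> dproc" where
  "NRess zs P = foldr NRes zs P"

lemma NRess_simps [simp]: "NRess [] P = P" "NRess (z # zs) P = NRes z (NRess zs P)"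
  by (simp_all add: NRess_def)

lemma NRess_append: "NRess (xs @ ys) P = NRess xs (NRess ys P)"
  by (simp add: NRess_def)

lemma lidx_less: "z \<in> set xs \<Longrightarrow> lidx xs z < length xs"
  by (induction xs) auto

lemma lidx_nth: "z \<in> set xs \<Longrightarrow> xs ! lidx xs z = z"
  by (induction xs) auto

lemma upds_Nil [simp]: "upds s [] ks = s" "upds s xs [] = s"
  by (simp_all add: upds_def)

lemma upds_Cons [simp]: "upds s (x # xs) (k # ks) = upds (s(x := k)) xs ks"
  by (simp add: upds_def)

lemma upds_nth:
  "length xs = length ks \<Longrightarrow>
   upds s xs ks z = (if z \<in> set xs then ks ! lidx xs z else s z)"
  by (induction xs ks arbitrary: s rule: list_induct2) auto

text \<open>Links the nameless input rule, which opens, to the raw one, which substitutes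
  \<open>upds id xs ks\<close>; both let the last of repeated names win.\<close>

lemma opr_cl: "length xs = length ks \<Longrightarrow> opr ks (cl xs x) = pm (upds id xs ks) x"
  by (cases x) (auto simp: upds_nth dest: lidx_less)

lemma cl_opr: "x \<noteq> Fr z \<Longrightarrow> cl [z] (opr [z] x) = x"
  by (cases x) auto

lemma fn_ren_pm: "fn (ren (pm f) P) = f ` fn P"
  by (auto simp: fn_def fv_ren image_iff) (metis pm.elims dname.inject(1) dname.distinct(1))+

lemma fn_NRes [simp]: "fn (NRes z P) = fn P - {z}"
proof -
  have "Fr a \<in> cl [z] ` A \<longleftrightarrow> Fr a \<in> A \<and> a \<noteq> z" for a A
  proof
    assume "Fr a \<in> cl [z] ` A"
    then obtain x where "x \<in> A" "Fr a = cl [z] x" by auto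
    then show "Fr a \<in> A \<and> a \<noteq> z" by (cases x) (auto split: if_splits)
  qed (force simp: image_iff)
  then show ?thesis by (auto simp: NRes_def fn_def fv_ren)
qed

lemma fn_NRess [simp]: "fn (NRess zs P) = fn P - set zs"
  by (induction zs) auto

lemma ren_opr_cl: "ren (opr [z]) (ren (cl [z]) P) = P"
  by (simp add: ren_comp) (rule ren_ident, simp add: opr_cl, case_tac x, auto)

lemma NRes_inj [simp]: "NRes z P = NRes z Q \<longleftrightarrow> P = Q"
  unfolding NRes_def by (metis dproc.inject(3) ren_opr_cl)

lemma DRes_NRes: "z \<notin> fn P \<Longrightarrow> DRes P = NRes z (ren (opr [z]) P)"
  unfolding NRes_def by (auto simp: ren_comp fn_def intro!: ren_ident[symmetric] cl_opr)

text \<open>Tells which names can serve as the binder of a given restriction and what its body then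
  is; transitions of restrictions are inverted with it.\<close>

lemma NRes_eq_DRes: "NRes z P = DRes Q \<longleftrightarrow> z \<notin> fn Q \<and> P = ren (opr [z]) Q"
proof
  assume "NRes z P = DRes Q"
  then have Q: "Q = ren (cl [z]) P" by (simp add: NRes_def)
  have "z \<notin> fn (NRes z P)" by simp
  then have "z \<notin> fn Q" unfolding Q NRes_def by simp
  then show "z \<notin> fn Q \<and> P = ren (opr [z]) Q" by (simp add: Q ren_opr_cl)
qed (use DRes_NRes in auto)

lemma ren_pm_NRes: "inj f \<Longrightarrow> ren (pm f) (NRes z P) = NRes (f z) (ren (pm f) P)"
  unfolding NRes_def
proof (simp add: ren_comp, rule ren_cong)
  fix x assume "inj f"
  then show "(up (Suc 0) (pm f) \<circ> cl [z]) x = (cl [f z] \<circ> pm f) x"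
    by (cases x) (auto simp: inj_def)
qed

lemma ren_pm_NRess: "inj f \<Longrightarrow> ren (pm f) (NRess zs P) = NRess (map f zs) (ren (pm f) P)"
  by (induction zs) (auto simp: ren_pm_NRes)

lemma ren_pm_ident: "(\<And>a. a \<in> fn P \<Longrightarrow> f a = a) \<Longrightarrow> ren (pm f) P = P"
proof (rule ren_ident)
  fix x assume "\<And>a. a \<in> fn P \<Longrightarrow> f a = a" "x \<in> fv P"
  then show "pm f x = x" by (cases x) (auto simp: fn_def)
qed

text \<open>Alpha-conversion of a block of restrictions as an equation: the left side is the image
  of the right one under \<open>f\<close>, and \<open>f\<close> fixes the free names of the
  latter.\<close>

lemma NRess_rename:
  assumes "inj f" "\<And>a. a \<in> fn P - set zs \<Longrightarrow> f a = a"
  shows "NRess (map f zs) (ren (pm f) P) = NRess zs P"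
  using ren_pm_ident[of "NRess zs P" f] assms by (simp add: ren_pm_NRess)

lemma NRes_rename:
  assumes "inj f" "\<And>a. a \<in> fn P - {z} \<Longrightarrow> f a = a"
  shows "NRes (f z) (ren (pm f) P) = NRes z P"
  using NRess_rename[of f P "[z]"] assms by simp

section \<open>Fresh names and fresh permutations\<close>

lemma infinite_tname: "infinite (UNIV :: tname set)"
proof -
  have "infinite (range Nm)"
  proof
    assume "finite (range Nm)"
    then have "finite (UNIV :: nat set)" by (rule finite_imageD) (simp add: inj_def)
    then show False by simp
  qed
  then show ?thesis using finite_subset[OF subset_UNIV] by metis
qed

lemma fresh_tname: "finite (X :: tname set) \<Longrightarrow> \<exists>z. z \<notin> X"
  using infinite_tname by (metis UNIV_eq_I)

lemma fresh_tnames: "finite (X :: tname set) \<Longrightarrow> \<exists>zs. length zs = n \<and> distinct zs \<and> set zs \<inter> X = {}"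
proof (induction n)
  case (Suc n)
  then obtain zs where "length zs = n" "distinct zs" "set zs \<inter> X = {}" by auto
  moreover obtain z where "z \<notin> X \<union> set zs" using Suc.prems fresh_tname[of "X \<union> set zs"] by auto
  ultimately show ?case by (intro exI[of _ "z # zs"]) auto
qed simp

text \<open>Exchanging the names of \<open>B\<close> with fresh partners gives a renaming that acts
  on transitions, being injective, and that can be undone by applying it again.\<close>

lemma fresh_perm:
  assumes "finite (B :: tname set)" "finite X"
  obtains f where "bij f" "f ` B \<inter> X = {}" "\<And>x. x \<notin> B \<Longrightarrow> x \<notin> f ` B \<Longrightarrow> f x = x"
    "\<And>x. f (f x) = x"
proof -
  obtain bl where bl: "set bl = B" "distinct bl" using finite_distinct_list[OF assms(1)] by auto
  have "\<exists>f. (\<forall>x. f (f x) = x) \<and> f ` set bl \<inter> X' = {} \<and>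
        (\<forall>x. x \<notin> set bl \<longrightarrow> x \<notin> f ` set bl \<longrightarrow> f x = x)"
    if "distinct bl" "finite X'" "set bl \<subseteq> X'" for bl and X' :: "tname set"
    using that
  proof (induction bl arbitrary: X')
    case Nil
    then show ?case by (intro exI[of _ id]) auto
  next
    case (Cons b bl)
    have "\<exists>f. (\<forall>x. f (f x) = x) \<and> f ` set bl \<inter> X' = {} \<and>
        (\<forall>x. x \<notin> set bl \<longrightarrow> x \<notin> f ` set bl \<longrightarrow> f x = x)"
      by (rule Cons.IH) (use Cons.prems in auto)
    then obtain f where f: "\<forall>x. f (f x) = x" "f ` set bl \<inter> X' = {}"
      "\<forall>x. x \<notin> set bl \<longrightarrow> x \<notin> f ` set bl \<longrightarrow> f x = x" by blast
    obtain c where c: "c \<notin> X' \<union> f ` set bl" using fresh_tname[of "X' \<union> f ` set bl"] Cons by auto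
    have "b \<notin> f ` set bl" using f(2) Cons.prems(3) by fastforce
    then have fb: "f b = b" using f(3) Cons.prems(1) by simp
    have fc: "f c = c" using f(3) c Cons.prems by auto
    have bc: "b \<noteq> c" using c Cons.prems by auto
    have inj: "f x = f y \<longleftrightarrow> x = y" for x y using f(1) by metis
    \<comment> \<open>Both \<open>b\<close> and \<open>c\<close> are fixed by \<open>f\<close>:
      \<open>b\<close> belongs to \<open>X'\<close>, which the partners chosen so far avoid, and
      \<open>c\<close> is new. So the added exchange is disjoint from the previous ones and the
      result is again an involution.\<close>
    let ?g = "f(b := c, c := b)"
    have "\<forall>x. ?g (?g x) = x" using f(1) fb fc bc inj by (auto; metis)
    moreover have im: "?g ` set (b # bl) = insert c (f ` set bl)"
      using c Cons.prems bc by auto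
    moreover have "?g ` set (b # bl) \<inter> X' = {}" unfolding im using f(2) c by auto
    moreover have "\<forall>x. x \<notin> set (b # bl) \<longrightarrow> x \<notin> ?g ` set (b # bl) \<longrightarrow> ?g x = x"
      unfolding im using f(3) by auto
    ultimately show ?case by blast
  qed
  from this[OF bl(2), of "X \<union> B"] have "\<exists>f. (\<forall>x. f (f x) = x) \<and> f ` B \<inter> (X \<union> B) = {} \<and>
    (\<forall>x. x \<notin> B \<longrightarrow> x \<notin> f ` B \<longrightarrow> f x = x)" using assms bl by simp
  then obtain f where f: "\<forall>x. f (f x) = x" "f ` B \<inter> (X \<union> B) = {}"
    "\<forall>x. x \<notin> B \<longrightarrow> x \<notin> f ` B \<longrightarrow> f x = x" by blast
  then have "bij f" by (metis involuntory_imp_bij)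
  then show thesis using that f by blast
qed

section \<open>From raw terms to nameless terms\<close>

fun dbp :: "tpref \<Rightarrow> dpref" where
  "dbp (TOut a ks) = DOut (Fr a) (map Fr ks)"
| "dbp (TIn a xs) = DIn (Fr a) (length xs)"
| "dbp (TMatch a b p) = DMatch (Fr a) (Fr b) (dbp p)"

fun db :: "tproc \<Rightarrow> dproc" where
  "db TNil = DNil"
| "db (TPre p P) = DPre (dbp p) (ren (cl (tpbl p)) (db P))"
| "db (TPar P Q) = DPar (db P) (db Q)"
| "db (TRes k P) = NRes k (db P)"
| "db (TBang P) = DBang (db P)"

lemma bnd_dbp [simp]: "bnd (dbp p) = length (tpbl p)"
  by (induction p) auto

lemma dpfv_dbp: "dpfv (dbp p) = Fr ` tpfn p"
  by (induction p) auto

lemma dpren_dbp: "dpren (pm s) (dbp p) = dbp (tpsub s p)"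
  by (induction p) auto

lemma tpbl_tpsub [simp]: "tpbl (tpsub s p) = tpbl p"
  by (induction p) auto

lemma tfn_tnames: "tfn P \<subseteq> tnames P"
proof (induction P)
  case (TPre p P)
  have "tpfn p \<subseteq> tpnames p" by (induction p) auto
  then show ?case using TPre by auto
qed auto

lemma tbn_tnames: "tbn P \<subseteq> tnames P"
proof (induction P)
  case (TPre p P)
  have "set (tpbl p) \<subseteq> tpnames p" by (induction p) auto
  then show ?case using TPre by auto
qed auto

lemma finite_tnames [simp]: "finite (tnames P)"
proof (induction P)
  case (TPre p P)
  have "finite (tpnames p)" by (induction p) auto
  then show ?case using TPre by auto
qed auto

lemma fv_close: "{x. sh (length xs) x \<in> cl xs ` Fr ` A} = Fr ` (A - set xs)"
proof -
  have "sh (length xs) x \<in> cl xs ` Fr ` A \<longleftrightarrow> x \<in> Fr ` (A - set xs)" for x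
  proof (cases x)
    case (Fr a)
    then show ?thesis by (auto simp: image_iff split: if_splits)
  next
    case (Bd i)
    have "i + length xs \<noteq> lidx xs z" if "z \<in> set xs" for z
      using lidx_less[OF that] by simp
    then show ?thesis using Bd by (auto simp: image_iff split: if_splits)
  qed
  then show ?thesis by auto
qed

lemma fv_db: "fv (db P) = Fr ` tfn P"
proof (induction P)
  case (TRes k P)
  then show ?case using fv_close[of "[k]" "tfn P"] by (simp add: NRes_def fv_ren)
qed (simp_all add: dpfv_dbp fv_ren fv_close image_Un)

lemma fn_db [simp]: "fn (db P) = tfn P"
  by (auto simp: fn_def fv_db)

lemma ren_db_cong: "(\<And>z. z \<in> tfn P \<Longrightarrow> r (Fr z) = s (Fr z)) \<Longrightarrow> ren r (db P) = ren s (db P)"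
  by (rule ren_cong) (auto simp: fv_db)

text \<open>The raw substitution is naive. The hypothesis excludes capture, since a name that is
  moved never lands on a binder, and without capture the substitution is a renaming.\<close>

lemma db_tsubst:
  assumes "\<And>x. x \<in> tnames P \<Longrightarrow> s x = x \<or> s x \<notin> tbn P"
  shows "db (tsubst s P) = ren (pm s) (db P)"
  using assms
proof (induction P arbitrary: s)
  case (TPre p P)
  let ?s = "\<lambda>z. if z \<in> set (tpbl p) then z else s z"
  have "db (tsubst ?s P) = ren (pm ?s) (db P)"
    by (rule TPre.IH) (use TPre.prems in auto)
  moreover have "ren (cl (tpbl p)) (ren (pm ?s) (db P)) =
      ren (up (length (tpbl p)) (pm s)) (ren (cl (tpbl p)) (db P))"
    unfolding ren_comp
  proof (rule ren_db_cong)
    fix z assume "z \<in> tfn P"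
    then have "s z = z \<or> s z \<notin> set (tpbl p)" using TPre.prems[of z] tfn_tnames[of P] by auto
    then show "(cl (tpbl p) \<circ> pm ?s) (Fr z) = (up (length (tpbl p)) (pm s) \<circ> cl (tpbl p)) (Fr z)"
      using lidx_less[of z "tpbl p"] by auto
  qed
  ultimately show ?case by (simp add: dpren_dbp)
next
  case (TRes k P)
  let ?s = "s(k := k)"
  have "db (tsubst ?s P) = ren (pm ?s) (db P)"
    by (rule TRes.IH) (use TRes.prems in auto)
  moreover have "ren (cl [k]) (ren (pm ?s) (db P)) = ren (up 1 (pm s)) (ren (cl [k]) (db P))"
    unfolding ren_comp
  proof (rule ren_db_cong)
    fix z assume "z \<in> tfn P"
    then have "s z = z \<or> s z \<noteq> k" using TRes.prems[of z] tfn_tnames[of P] by auto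
    then show "(cl [k] \<circ> pm ?s) (Fr z) = (up 1 (pm s) \<circ> cl [k]) (Fr z)" by auto
  qed
  ultimately show ?case by (simp add: NRes_def)
next
  case (TPar P Q)
  have "db (tsubst s P) = ren (pm s) (db P)" by (rule TPar.IH(1)) (use TPar.prems in auto)
  moreover have "db (tsubst s Q) = ren (pm s) (db Q)" by (rule TPar.IH(2)) (use TPar.prems in auto)
  ultimately show ?case by simp
next
  case (TBang P)
  have "db (tsubst s P) = ren (pm s) (db P)" by (rule TBang.IH) (use TBang.prems in auto)
  then show ?case by simp
qed simp

lemma tpbl_tprebind: "length ys = length (tpbl p) \<Longrightarrow> tpbl (tprebind p ys) = ys"
  by (induction p) auto

lemma dbp_tprebind: "length ys = length (tpbl p) \<Longrightarrow> dbp (tprebind p ys) = dbp p"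
  by (induction p) auto

lemma lidx_distinct: "distinct ys \<Longrightarrow> i < length ys \<Longrightarrow> lidx ys (ys ! i) = i"
  by (simp add: lidx_less lidx_nth nth_eq_iff_index_eq[symmetric])

lemma db_tsubst_fresh:
  assumes "length ys = length xs" "set ys \<inter> tnames P = {}"
  shows "db (tsubst (upds id xs ys) P) = ren (pm (upds id xs ys)) (db P)"
proof (rule db_tsubst)
  fix x assume "x \<in> tnames P"
  have "ys ! lidx xs x \<in> set ys" if "x \<in> set xs" using lidx_less[OF that] assms by simp
  then show "upds id xs ys x = x \<or> upds id xs ys x \<notin> tbn P"
    using assms tbn_tnames[of P] by (auto simp: upds_nth)
qed

lemma ren_cl_upds:
  assumes "length ys = length xs" "distinct ys" "set ys \<inter> tfn P = {}"
  shows "ren (cl ys) (ren (pm (upds id xs ys)) (db P)) = ren (cl xs) (db P)"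
  unfolding ren_comp
proof (rule ren_db_cong)
  fix z assume "z \<in> tfn P"
  then have "z \<notin> set ys" using assms(3) by auto
  then show "(cl ys \<circ> pm (upds id xs ys)) (Fr z) = cl xs (Fr z)"
    using assms(1,2) lidx_less[of z xs] lidx_distinct[of ys "lidx xs z"]
    by (auto simp: upds_nth)
qed

lemma db_ren_in:
  assumes "length ys = length xs" "distinct ys" "set ys \<inter> tnames P = {}"
  shows "ren (cl ys) (db (tsubst (upds id xs ys) P)) = ren (cl xs) (db P)"
proof -
  have "set ys \<inter> tfn P = {}" using assms(3) tfn_tnames[of P] by blast
  then show ?thesis using assms by (simp add: db_tsubst_fresh ren_cl_upds)
qed

lemma db_ren_res:
  assumes "y \<notin> tnames P"
  shows "NRes y (db (tsubst (id(k := y)) P)) = NRes k (db P)"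
  using db_ren_in[of "[y]" "[k]" P] assms by (simp add: NRes_def)

lemma talpha_db: "talpha P Q \<Longrightarrow> db P = db Q"
proof (induction rule: talpha.induct)
  case (ren_res y P k)
  then show ?case by (simp add: db_ren_res)
next
  case (ren_in p xs ys P)
  then show ?case by (simp add: tpbl_tprebind dbp_tprebind db_ren_in)
qed auto

fun dsz :: "dproc \<Rightarrow> nat" where
  "dsz DNil = 0"
| "dsz (DPre p P) = Suc (dsz P)"
| "dsz (DPar P Q) = Suc (dsz P + dsz Q)"
| "dsz (DRes P) = Suc (dsz P)"
| "dsz (DBang P) = Suc (dsz P)"

lemma dsz_ren [simp]: "dsz (ren r P) = dsz P"
  by (induction P arbitrary: r) auto

lemma dsz_NRes [simp]: "dsz (NRes z P) = Suc (dsz P)"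
  by (simp add: NRes_def)

lemma tprebind_dbp: "dbp p = dbp q \<Longrightarrow> tprebind p ys = tprebind q ys"
proof (induction p arbitrary: q)
  case (TOut a ks)
  have "inj Fr" by (simp add: inj_def)
  then show ?case using TOut by (cases q) (auto dest: map_injective)
next
  case (TIn a xs)
  then show ?case by (cases q) auto
next
  case (TMatch a b p)
  then obtain q' where "q = TMatch a b q'" "dbp p = dbp q'" by (cases q) simp_all
  then show ?case using TMatch.IH by simp
qed

lemma db_inverts:
  "db P = DPre p D \<longleftrightarrow> (\<exists>q Q. P = TPre q Q \<and> dbp q = p \<and> ren (cl (tpbl q)) (db Q) = D)"
  "db P = DPar D E \<longleftrightarrow> (\<exists>Q R. P = TPar Q R \<and> db Q = D \<and> db R = E)"
  "db P = DBang D \<longleftrightarrow> (\<exists>Q. P = TBang Q \<and> db Q = D)"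
  by (cases P; auto simp: NRes_def)+

lemma ren_opr_pm:
  assumes "length ys = length xs"
  shows "ren (opr ys) (ren (cl xs) (db P)) = ren (pm (upds id xs ys)) (db P)"
  using assms by (simp add: ren_comp opr_cl o_def)

text \<open>At a binder both sides are first renamed to common fresh names, after which the bodies
  have equal images. The renamed bodies are not subterms, so the induction is on the size, which
  renaming preserves.\<close>

lemma db_talpha: "db P = db Q \<Longrightarrow> talpha P Q"
proof (induction "dsz (db P)" arbitrary: P Q rule: less_induct)
  case less
  show ?case
  proof (cases P)
    case TNil
    then show ?thesis using less.prems by (cases Q) (auto simp: NRes_def intro: talpha.refl)
  next
    case (TPar P1 P2)
    then obtain Q1 Q2 where Q: "Q = TPar Q1 Q2" "db P1 = db Q1" "db P2 = db Q2"
      using less.prems by (cases Q) (auto simp: NRes_def)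
    have "talpha P1 Q1" "talpha P2 Q2" by (rule less.hyps; use TPar Q in simp)+
    then show ?thesis using TPar Q by (auto intro: talpha.par)
  next
    case (TBang P1)
    then obtain Q1 where Q: "Q = TBang Q1" "db P1 = db Q1"
      using less.prems by (cases Q) (auto simp: NRes_def)
    have "talpha P1 Q1" by (rule less.hyps) (use TBang Q in simp_all)
    then show ?thesis using TBang Q by (auto intro: talpha.bang)
  next
    case (TRes k P1)
    then obtain l Q1 where Q: "Q = TRes l Q1" "NRes k (db P1) = NRes l (db Q1)"
      using less.prems by (cases Q) (auto simp: NRes_def)
    obtain y where y: "y \<notin> tnames P1 \<union> tnames Q1"
      using fresh_tname[of "tnames P1 \<union> tnames Q1"] by auto
    let ?P = "tsubst (id(k := y)) P1" and ?Q = "tsubst (id(l := y)) Q1"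
    have e: "NRes y (db ?P) = NRes k (db P1)" "NRes y (db ?Q) = NRes l (db Q1)"
      using y by (simp_all add: db_ren_res)
    then have "db ?P = db ?Q" using Q(2) by (metis NRes_inj)
    moreover have "dsz (NRes y (db ?P)) = dsz (NRes k (db P1))" using e by simp
    ultimately have "talpha ?P ?Q" using less.hyps[of ?P ?Q] TRes by simp
    then have "talpha (TRes y ?P) (TRes y ?Q)" by (rule talpha.res)
    moreover have "talpha (TRes k P1) (TRes y ?P)" "talpha (TRes l Q1) (TRes y ?Q)"
      using y by (auto intro: talpha.ren_res)
    ultimately show ?thesis using TRes Q(1) by (metis talpha.sym talpha.trans)
  next
    case (TPre p P1)
    then obtain q Q1 where Q: "Q = TPre q Q1" "dbp p = dbp q"
      "ren (cl (tpbl p)) (db P1) = ren (cl (tpbl q)) (db Q1)"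
      using less.prems by (cases Q) (auto simp: NRes_def)
    have len: "length (tpbl p) = length (tpbl q)" using Q(2) by (metis bnd_dbp)
    obtain ys where ys: "length ys = length (tpbl p)" "distinct ys"
      "set ys \<inter> (tnames P1 \<union> tnames Q1) = {}"
      using fresh_tnames[of "tnames P1 \<union> tnames Q1"] by auto
    let ?P = "tsubst (upds id (tpbl p) ys) P1" and ?Q = "tsubst (upds id (tpbl q) ys) Q1"
    have e: "db ?P = ren (opr ys) (ren (cl (tpbl p)) (db P1))"
        "db ?Q = ren (opr ys) (ren (cl (tpbl q)) (db Q1))"
      using ys len by (simp_all add: ren_opr_pm db_tsubst_fresh Int_Un_distrib)
    then have "db ?P = db ?Q" using Q(3) by simp
    moreover have "dsz (db ?P) < dsz (db P)" using e TPre by simp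
    ultimately have "talpha ?P ?Q" using less.hyps[of ?P ?Q] by simp
    then have "talpha (TPre (tprebind p ys) ?P) (TPre (tprebind p ys) ?Q)" by (rule talpha.pre)
    moreover have "talpha (TPre p P1) (TPre (tprebind p ys) ?P)"
      using ys by (intro talpha.ren_in) auto
    moreover have "talpha (TPre q Q1) (TPre (tprebind q ys) ?Q)"
      using ys len by (intro talpha.ren_in) auto
    ultimately show ?thesis using TPre Q(1) tprebind_dbp[OF Q(2)] by (metis talpha.sym talpha.trans)
  qed
qed

lemma cl_opr_list:
  assumes "distinct zs" "\<And>z. x = Fr z \<Longrightarrow> z \<notin> set zs"
  shows "cl zs (opr zs x) = x"
  using assms by (cases x) (auto simp: lidx_distinct)

lemma dbp_surj:
  "dpfv p \<subseteq> range Fr \<Longrightarrow> length zs = bnd p \<Longrightarrow> \<exists>q. dbp q = p \<and> tpbl q = zs"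
proof (induction p)
  case (DOut a ks)
  then have "\<forall>k \<in> set ks. \<exists>j. k = Fr j" "a \<in> range Fr" by auto
  then obtain b js where "a = Fr b" "ks = map Fr js" by (metis ex_map_conv imageE)
  then show ?case using DOut by (intro exI[of _ "TOut b js"]) auto
next
  case (DIn a n)
  then obtain b where "a = Fr b" by auto
  then show ?case using DIn by (intro exI[of _ "TIn b zs"]) auto
next
  case (DMatch a b p)
  then obtain q where "dbp q = p \<and> tpbl q = zs" by auto
  moreover obtain c d where "a = Fr c" "b = Fr d" using DMatch by auto
  ultimately show ?case by (intro exI[of _ "TMatch c d q"]) auto
qed

text \<open>The condition \<open>fv D \<subseteq> range Fr\<close> says that \<open>D\<close> has no dangling indices.\<close>

lemma db_surj:
  "fv D \<subseteq> range Fr \<Longrightarrow> finite X \<Longrightarrow> \<exists>P. db P = D \<and> tbn P \<inter> X = {}"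
proof (induction "dsz D" arbitrary: D rule: less_induct)
  case less
  show ?case
  proof (cases D)
    case DNil
    then show ?thesis by (intro exI[of _ TNil]) simp
  next
    case (DPar D1 D2)
    then obtain P1 P2 where "db P1 = D1" "tbn P1 \<inter> X = {}" "db P2 = D2" "tbn P2 \<inter> X = {}"
      using less.hyps[of D1] less.hyps[of D2] less.prems by auto
    then show ?thesis using DPar by (intro exI[of _ "TPar P1 P2"]) auto
  next
    case (DBang D1)
    then obtain P1 where "db P1 = D1" "tbn P1 \<inter> X = {}"
      using less.hyps[of D1] less.prems by auto
    then show ?thesis using DBang by (intro exI[of _ "TBang P1"]) auto
  next
    case (DRes D1)
    obtain z where z: "z \<notin> X \<union> fn D1" using fresh_tname[of "X \<union> fn D1"] less.prems by auto
    have "fv (ren (opr [z]) D1) \<subseteq> range Fr"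
    proof -
      have "opr [z] x \<in> range Fr" if "x \<in> fv D1" for x
      proof (cases x)
        case (Bd i)
        then show ?thesis using less.prems(1) DRes that by (cases i) (auto simp: subset_iff)
      qed simp
      then show ?thesis by (auto simp: fv_ren)
    qed
    then obtain P1 where "db P1 = ren (opr [z]) D1" "tbn P1 \<inter> X = {}"
      using less.hyps[of "ren (opr [z]) D1"] DRes less.prems by auto
    then show ?thesis using DRes z DRes_NRes[of z D1] by (intro exI[of _ "TRes z P1"]) auto
  next
    case (DPre p D1)
    obtain zs where zs: "length zs = bnd p" "distinct zs" "set zs \<inter> (X \<union> fn D1) = {}"
      using fresh_tnames[of "X \<union> fn D1" "bnd p"] less.prems by auto
    have "fv (ren (opr zs) D1) \<subseteq> range Fr"
    proof -
      have "opr zs x \<in> range Fr" if "x \<in> fv D1" for x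
      proof (cases x)
        case (Bd i)
        have "i < length zs"
        proof (cases rule: sh_cases[of x "bnd p"])
          case (1 y)
          then have "y \<in> fv D" using that DPre by simp
          then show ?thesis using less.prems(1) 1 Bd by auto
        next
          case (2 j)
          then show ?thesis using Bd zs(1) by simp
        qed
        then show ?thesis using Bd by simp
      qed simp
      then show ?thesis by (auto simp: fv_ren)
    qed
    then obtain P1 where P1: "db P1 = ren (opr zs) D1" "tbn P1 \<inter> X = {}"
      using less.hyps[of "ren (opr zs) D1"] DPre less.prems by auto
    obtain q where q: "dbp q = p" "tpbl q = zs"
      using dbp_surj[of p zs] zs less.prems DPre by auto
    have "ren (cl zs) (ren (opr zs) D1) = D1"
      unfolding ren_comp by (rule ren_ident) (use zs in \<open>auto simp: fn_def intro!: cl_opr_list\<close>)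
    then show ?thesis using DPre P1 q zs by (intro exI[of _ "TPre q P1"]) auto
  qed
qed

section \<open>The transition system up to alpha-conversion\<close>

text \<open>The rules of \<open>tstep\<close> except the one for alpha-conversion: the choice of a
  restricted name is hidden in \<open>NRes\<close>, and opening an input cannot capture.\<close>

inductive dstep :: "dproc \<Rightarrow> act \<Rightarrow> dproc \<Rightarrow> bool" where
  out: "dstep (DPre (DOut (Fr a) (map Fr ks)) P) (Outp a ks {}) P"
| inp: "length ks = n \<Longrightarrow> dstep (DPre (DIn (Fr a) n) P) (Inp a ks) (ren (opr ks) P)"
| match: "dstep (DPre p P) \<alpha> P' \<Longrightarrow> dstep (DPre (DMatch x x p) P) \<alpha> P'"
| parl: "dstep P \<alpha> P' \<Longrightarrow> abn \<alpha> \<inter> fn Q = {} \<Longrightarrow> dstep (DPar P Q) \<alpha> (DPar P' Q)"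
| parr: "dstep Q \<alpha> Q' \<Longrightarrow> abn \<alpha> \<inter> fn P = {} \<Longrightarrow> dstep (DPar P Q) \<alpha> (DPar P Q')"
| comml: "dstep P (Outp a ks (set bl)) P' \<Longrightarrow> dstep Q (Inp a ks) Q' \<Longrightarrow> set bl \<inter> fn Q = {} \<Longrightarrow>
          distinct bl \<Longrightarrow> dstep (DPar P Q) Tau (NRess bl (DPar P' Q'))"
| commr: "dstep P (Inp a ks) P' \<Longrightarrow> dstep Q (Outp a ks (set bl)) Q' \<Longrightarrow> set bl \<inter> fn P = {} \<Longrightarrow>
          distinct bl \<Longrightarrow> dstep (DPar P Q) Tau (NRess bl (DPar P' Q'))"
| res: "dstep P \<alpha> P' \<Longrightarrow> z \<notin> anames \<alpha> \<Longrightarrow> dstep (NRes z P) \<alpha> (NRes z P')"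
| opn: "dstep P (Outp a ks bs) P' \<Longrightarrow> z \<in> set ks \<Longrightarrow> z \<noteq> a \<Longrightarrow> z \<notin> bs \<Longrightarrow>
        dstep (NRes z P) (Outp a ks (insert z bs)) P'"
| rep: "dstep (DPar P (DBang P)) \<alpha> P' \<Longrightarrow> dstep (DBang P) \<alpha> P'"

lemma db_resl: "db (resl bl P) = NRess bl (db P)"
  by (induction bl) (auto simp: resl_def)

lemma tstep_dstep: "tstep P \<alpha> P' \<Longrightarrow> dstep (db P) \<alpha> (db P')"
proof (induction rule: tstep.induct)
  case (out a ks P)
  have "cl [] = (\<lambda>x. x)"
  proof
    fix x show "cl [] x = x" by (cases x) auto
  qed
  then show ?case using dstep.out[of a ks "db P"] by (simp add: ren_id)
next
  case (inp ks xs P a)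
  have "db (tsubst (upds id xs ks) P) = ren (pm (upds id xs ks)) (db P)"
  proof (rule db_tsubst)
    fix x assume "x \<in> tnames P"
    have "ks ! lidx xs x \<in> set ks" if "x \<in> set xs" using lidx_less[OF that] inp by simp
    then show "upds id xs ks x = x \<or> upds id xs ks x \<notin> tbn P"
      using inp by (auto simp: upds_nth)
  qed
  then show ?case using dstep.inp[of ks "length xs" a "ren (cl xs) (db P)"] inp
    by (simp add: ren_opr_pm)
next
  case (comml P a ks bs P' Q Q' bl)
  then show ?case using dstep.comml[of "db P" a ks bl "db P'" "db Q" "db Q'"] by (auto simp: db_resl)
next
  case (commr P a ks P' Q bs Q' bl)
  then show ?case using dstep.commr[of "db P" a ks "db P'" "db Q" bl "db Q'"] by (auto simp: db_resl)
next
  case (alpha P P' \<alpha> Q)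
  then show ?case by (simp add: talpha_db)
next
  case (parl P \<alpha> P' Q)
  then show ?case using dstep.parl[of "db P" \<alpha> "db P'" "db Q"] by simp
next
  case (parr Q \<alpha> Q' P)
  then show ?case using dstep.parr[of "db Q" \<alpha> "db Q'" "db P"] by simp
qed (auto intro: dstep.intros)

lemma fv_NRes_closed: "fv (NRes z P) \<subseteq> range Fr \<Longrightarrow> fv P \<subseteq> range Fr"
proof
  fix x assume a: "fv (NRes z P) \<subseteq> range Fr" "x \<in> fv P"
  show "x \<in> range Fr"
  proof (cases x)
    case (Bd i)
    then have "cl [z] x = sh 1 x" by simp
    then have "sh 1 x \<in> cl [z] ` fv P" using a(2) by (metis imageI)
    then have "x \<in> fv (NRes z P)" by (simp add: NRes_def fv_ren)
    then show ?thesis using a(1) by auto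
  qed simp
qed

text \<open>A nameless transition may open the restriction with any admissible \<open>z\<close>,
  while the raw \<open>Q\<close> carries a fixed binder. An alpha-variant with binder
  \<open>z\<close> exists because \<open>db\<close> reaches every term without dangling indices and
  terms with equal images are alpha-equivalent.\<close>

lemma db_NRes_obtain:
  assumes "db Q = NRes z P"
  obtains Q1 where "db Q1 = P" "talpha Q (TRes z Q1)"
proof -
  have "fv P \<subseteq> range Fr" by (rule fv_NRes_closed[of z]) (auto simp: assms[symmetric] fv_db)
  then obtain Q1 where "db Q1 = P" using db_surj[of P "{}"] by auto
  moreover have "talpha Q (TRes z Q1)" by (rule db_talpha) (simp add: assms calculation)
  ultimately show thesis using that by blast
qed

lemma dstep_tstep: "dstep D \<alpha> D' \<Longrightarrow> db Q = D \<Longrightarrow> \<exists>Q'. tstep Q \<alpha> Q' \<and> db Q' = D'"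
proof (induction arbitrary: Q rule: dstep.induct)
  case (out a ks P)
  then obtain q Q1 where Q: "Q = TPre q Q1" "dbp q = DOut (Fr a) (map Fr ks)"
    "ren (cl (tpbl q)) (db Q1) = P" by (auto simp: db_inverts)
  have "inj Fr" by (simp add: inj_def)
  then have q: "q = TOut a ks" using Q(2) by (cases q) (auto dest: map_injective)
  have "cl [] = (\<lambda>x. x)"
  proof
    fix x show "cl [] x = x" by (cases x) auto
  qed
  then show ?case using Q q by (intro exI[of _ Q1]) (auto intro: tstep.out simp: ren_id)
next
  case (inp ks n a P)
  then obtain q Q1 where Q: "Q = TPre q Q1" "dbp q = DIn (Fr a) n"
    "ren (cl (tpbl q)) (db Q1) = P" by (auto simp: db_inverts)
  then obtain xs where q: "q = TIn a xs" "length xs = n" by (cases q) auto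
  \<comment> \<open>An alpha-variant whose binders avoid the received names meets the side condition
    of the raw input rule.\<close>
  obtain Q2 where Q2: "db Q2 = db Q1" "tbn Q2 \<inter> set ks = {}"
    using db_surj[of "db Q1" "set ks"] by (auto simp: fv_db)
  have "talpha Q (TPre q Q2)" by (rule db_talpha) (simp add: Q Q2)
  moreover have st: "tstep (TPre q Q2) (Inp a ks) (tsubst (upds id xs ks) Q2)"
    unfolding q using Q2 inp q by (intro tstep.inp) auto
  ultimately have "tstep Q (Inp a ks) (tsubst (upds id xs ks) Q2)" by (rule tstep.alpha)
  \<comment> \<open>For given \<open>ks\<close> the target of an input is determined, so mapping the
    raw step back identifies its target with the prescribed one.\<close>
  moreover have "dstep (db (TPre q Q2)) (Inp a ks) (db (tsubst (upds id xs ks) Q2))"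
    using st by (rule tstep_dstep)
  then have "db (tsubst (upds id xs ks) Q2) = ren (opr ks) P"
    using Q Q2 q by (auto elim: dstep.cases simp: NRes_def)
  ultimately show ?case by blast
next
  case (match p P \<alpha> P' x)
  then obtain q Q1 where Q: "Q = TPre q Q1" "dbp q = DMatch x x p"
    "ren (cl (tpbl q)) (db Q1) = P" by (auto simp: db_inverts)
  then obtain c q' where q: "q = TMatch c c q'" "dbp q' = p" by (cases q) auto
  then obtain Q' where "tstep (TPre q' Q1) \<alpha> Q'" "db Q' = P'"
    using match.IH[of "TPre q' Q1"] Q by auto
  then show ?case using Q q by (auto intro: tstep.match)
next
  case (parl P \<alpha> P' R)
  then obtain Q1 Q2 where Q: "Q = TPar Q1 Q2" "db Q1 = P" "db Q2 = R" by (auto simp: db_inverts)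
  then obtain Q' where "tstep Q1 \<alpha> Q'" "db Q' = P'" using parl.IH by auto
  then show ?case using Q parl.hyps by (intro exI[of _ "TPar Q' Q2"]) (auto intro: tstep.parl)
next
  case (parr P \<alpha> P' R)
  then obtain Q1 Q2 where Q: "Q = TPar Q1 Q2" "db Q1 = R" "db Q2 = P" by (auto simp: db_inverts)
  then obtain Q' where "tstep Q2 \<alpha> Q'" "db Q' = P'" using parr.IH by auto
  then show ?case using Q parr.hyps by (intro exI[of _ "TPar Q1 Q'"]) (auto intro: tstep.parr)
next
  case (comml P a ks bl P' R R')
  then obtain Q1 Q2 where Q: "Q = TPar Q1 Q2" "db Q1 = P" "db Q2 = R" by (auto simp: db_inverts)
  obtain Q1' where "tstep Q1 (Outp a ks (set bl)) Q1'" "db Q1' = P'" using comml.IH(1) Q by auto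
  moreover obtain Q2' where "tstep Q2 (Inp a ks) Q2'" "db Q2' = R'" using comml.IH(2) Q by auto
  ultimately show ?case using Q comml.hyps
    by (intro exI[of _ "resl bl (TPar Q1' Q2')"]) (auto simp: db_resl intro: tstep.comml)
next
  case (commr P a ks P' R bl R')
  then obtain Q1 Q2 where Q: "Q = TPar Q1 Q2" "db Q1 = P" "db Q2 = R" by (auto simp: db_inverts)
  obtain Q1' where "tstep Q1 (Inp a ks) Q1'" "db Q1' = P'" using commr.IH(1) Q by auto
  moreover obtain Q2' where "tstep Q2 (Outp a ks (set bl)) Q2'" "db Q2' = R'" using commr.IH(2) Q by auto
  ultimately show ?case using Q commr.hyps
    by (intro exI[of _ "resl bl (TPar Q1' Q2')"]) (auto simp: db_resl intro: tstep.commr)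
next
  case (res P \<alpha> P' z)
  obtain Q1 where Q1: "db Q1 = P" "talpha Q (TRes z Q1)" using db_NRes_obtain[OF res.prems] .
  then obtain Q' where "tstep Q1 \<alpha> Q'" "db Q' = P'" using res.IH by auto
  then show ?case using Q1 res.hyps
    by (intro exI[of _ "TRes z Q'"]) (auto intro: tstep.alpha tstep.res)
next
  case (opn P a ks bs P' z)
  obtain Q1 where Q1: "db Q1 = P" "talpha Q (TRes z Q1)" using db_NRes_obtain[OF opn.prems] .
  then obtain Q' where "tstep Q1 (Outp a ks bs) Q'" "db Q' = P'" using opn.IH by auto
  then show ?case using Q1 opn.hyps
    by (intro exI[of _ Q']) (auto intro: tstep.alpha tstep.opn)
next
  case (rep P \<alpha> P')
  then obtain Q1 where Q: "Q = TBang Q1" "db Q1 = P" by (auto simp: db_inverts)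
  then obtain Q' where "tstep (TPar Q1 (TBang Q1)) \<alpha> Q'" "db Q' = P'"
    using rep.IH[of "TPar Q1 (TBang Q1)"] by auto
  then show ?case using Q by (auto intro: tstep.rep)
qed

section \<open>Structural congruence of target processes\<close>

fun sw :: "dname \<Rightarrow> dname" where
  "sw (Fr a) = Fr a"
| "sw (Bd i) = (if i = 0 then Bd 1 else if i = 1 then Bd 0 else Bd i)"

text \<open>The scope laws carry no freshness conditions: in \<open>extr\<close> the shift makes
  \<open>P\<close> independent of the binder, and in \<open>res_comm\<close> the two innermost
  indices are exchanged by \<open>sw\<close>. This makes the rules stable under arbitrary renamings.
  The rule \<open>gc\<close> is forced by the source law \<open>res_nil\<close>, whose translation
  leaves the handlers of \<open>k\<close> alone under their restrictions.\<close>

inductive dcong :: "dproc \<Rightarrow> dproc \<Rightarrow> bool" where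
  refl: "dcong P P"
| sym: "dcong P Q \<Longrightarrow> dcong Q P"
| trans: "dcong P Q \<Longrightarrow> dcong Q R \<Longrightarrow> dcong P R"
| pre: "dcong P Q \<Longrightarrow> dcong (DPre p P) (DPre p Q)"
| par: "dcong P P' \<Longrightarrow> dcong Q Q' \<Longrightarrow> dcong (DPar P Q) (DPar P' Q')"
| res: "dcong P Q \<Longrightarrow> dcong (DRes P) (DRes Q)"
| bang: "dcong P Q \<Longrightarrow> dcong (DBang P) (DBang Q)"
| match: "dcong (DPre (DMatch x x p) P) (DPre p P)"
| par_assoc: "dcong (DPar (DPar P Q) R) (DPar P (DPar Q R))"
| par_comm: "dcong (DPar P Q) (DPar Q P)"
| par_unit: "dcong (DPar P DNil) P"
| res_comm: "dcong (DRes (DRes P)) (DRes (DRes (ren sw P)))"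
| res_nil: "dcong (DRes DNil) DNil"
| extr: "dcong (DPar P (DRes Q)) (DRes (DPar (ren (sh 1) P) Q))"
| bang_unf: "dcong (DBang P) (DPar P (DBang P))"
| gc: "dcong (NRes (Nm k) (NRes (Nn k) (NRes (Mm k) (db (handler k))))) DNil"

declare dcong.trans [trans]

lemma tfn_handler [simp]: "tfn (handler k) = {Nm k, Nn k, Mm k}"
  by (auto simp: handler_def)

lemma up_up_sw: "up 1 (up 1 r) \<circ> sw = sw \<circ> up 1 (up 1 r)"
proof
  fix x
  show "(up 1 (up 1 r) \<circ> sw) x = (sw \<circ> up 1 (up 1 r)) x"
  proof (cases rule: sh_cases[of x 2])
    case (1 y)
    have 2: "sw (sh 2 z) = sh 2 z" for z by (cases z) auto
    have "up 1 (up 1 r) (sh 2 z) = sh 2 (r z)" for z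
    proof -
      have s: "sh 2 v = sh 1 (sh 1 v)" for v by (cases v) auto
      show ?thesis unfolding s up_sh ..
    qed
    then show ?thesis using 1 2 by simp
  next
    case (2 i)
    then show ?thesis by (auto simp: less_2_cases_iff)
  qed
qed

lemma ren_gc:
  "ren r (NRes (Nm k) (NRes (Nn k) (NRes (Mm k) (db (handler k))))) =
   NRes (Nm k) (NRes (Nn k) (NRes (Mm k) (db (handler k))))"
proof -
  have "fv (db (TRes (Nm k) (TRes (Nn k) (TRes (Mm k) (handler k))))) = {}"
    unfolding fv_db by auto
  then show ?thesis by (intro ren_ident) simp
qed

text \<open>Used whenever a binder is opened: an input instantiates its variables and a restriction
  is opened with a name, and both are renamings.\<close>

lemma dcong_ren: "dcong P Q \<Longrightarrow> dcong (ren r P) (ren r Q)"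
proof (induction arbitrary: r rule: dcong.induct)
  case (res_comm P)
  show ?case using dcong.res_comm[of "ren (up 1 (up 1 r)) P"]
    by (simp add: ren_comp up_up_sw[simplified])
next
  case (extr P Q)
  have "up 1 r \<circ> sh 1 = sh 1 \<circ> r" by auto
  then show ?case using dcong.extr[of "ren r P" "ren (up 1 r) Q"] by (simp add: ren_comp)
next
  case (gc k)
  then show ?case by (simp add: ren_gc dcong.gc)
qed (auto intro: dcong.intros)

lemma dcong_NRes: "dcong P Q \<Longrightarrow> dcong (NRes z P) (NRes z Q)"
  unfolding NRes_def by (intro dcong.res dcong_ren)

lemma dcong_NRess: "dcong P Q \<Longrightarrow> dcong (NRess zs P) (NRess zs Q)"
  by (induction zs) (auto intro: dcong_NRes)

lemma dcong_NRes_comm: "dcong (NRes z (NRes w P)) (NRes w (NRes z P))"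
proof (cases "z = w")
  case True
  then show ?thesis by (simp add: dcong.refl)
next
  case False
  have "(sw \<circ> (up 1 (cl [z]) \<circ> cl [w])) x = (up 1 (cl [w]) \<circ> cl [z]) x" for x
    using False by (cases x) auto
  then have "sw \<circ> (up 1 (cl [z]) \<circ> cl [w]) = up 1 (cl [w]) \<circ> cl [z]" by (rule ext)
  then show ?thesis
    using dcong.res_comm[of "ren (up 1 (cl [z]) \<circ> cl [w]) P"] by (simp add: NRes_def ren_comp)
qed

lemma dcong_extr:
  assumes "z \<notin> fn P"
  shows "dcong (DPar P (NRes z Q)) (NRes z (DPar P Q))"
proof -
  have "ren (cl [z]) P = ren (sh 1) P"
  proof (rule ren_cong)
    fix x assume "x \<in> fv P"
    then show "cl [z] x = sh 1 x" using assms by (cases x) (auto simp: fn_def)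
  qed
  then show ?thesis using dcong.extr[of P "ren (cl [z]) Q"] by (simp add: NRes_def)
qed

lemma dcong_extr': "z \<notin> fn Q \<Longrightarrow> dcong (DPar (NRes z P) Q) (NRes z (DPar P Q))"
  by (meson dcong.par_comm dcong.trans dcong_NRes dcong_extr)

lemma dcong_extrs: "set zs \<inter> fn P = {} \<Longrightarrow> dcong (DPar P (NRess zs Q)) (NRess zs (DPar P Q))"
  by (induction zs) (auto intro: dcong.refl dcong.trans dcong_NRes dcong_extr)

lemma dcong_extrs': "set zs \<inter> fn Q = {} \<Longrightarrow> dcong (DPar (NRess zs P) Q) (NRess zs (DPar P Q))"
  by (meson dcong.par_comm dcong.trans dcong_NRess dcong_extrs)

lemma dcong_NRess_NRes: "dcong (NRess zs (NRes z P)) (NRes z (NRess zs P))"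
  by (induction zs) (auto intro: dcong.refl dcong.trans dcong_NRes dcong_NRes_comm)

lemma dcong_NRess_remove: "z \<in> set zs \<Longrightarrow> dcong (NRess zs P) (NRes z (NRess (remove1 z zs) P))"
  by (induction zs) (auto intro: dcong.refl dcong.trans dcong_NRes dcong_NRes_comm)

lemma dcong_NRess_mset: "mset ys = mset zs \<Longrightarrow> dcong (NRess ys P) (NRess zs P)"
proof (induction ys arbitrary: zs)
  case (Cons y ys)
  then have y: "y \<in> set zs" by (metis list.set_intros(1) set_mset_mset)
  have "mset ys = mset (remove1 y zs)" using Cons.prems by (metis add_mset_remove_trivial mset.simps(2) mset_remove1)
  then have "dcong (NRess ys P) (NRess (remove1 y zs) P)" by (rule Cons.IH)
  then have "dcong (NRess (y # ys) P) (NRes y (NRess (remove1 y zs) P))" by (simp add: dcong_NRes)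
  then show ?case using dcong_NRess_remove[OF y] by (meson dcong.sym dcong.trans)
qed (simp add: dcong.refl)

text \<open>A vacuous restriction can be narrowed to an added \<open>DNil\<close>, where
  \<open>res_nil\<close> removes it.\<close>

lemma dcong_NRes_gc:
  assumes "z \<notin> fn P"
  shows "dcong (NRes z P) P"
proof -
  have "NRes z DNil = DRes DNil" by (simp add: NRes_def)
  then have "dcong (DPar P (NRes z DNil)) P"
    by (metis dcong.par dcong.par_unit dcong.refl dcong.res_nil dcong.trans)
  moreover have "dcong (NRes z P) (NRes z (DPar P DNil))"
    by (intro dcong_NRes dcong.sym[OF dcong.par_unit])
  ultimately show ?thesis using dcong_extr[OF assms, of DNil] by (meson dcong.sym dcong.trans)
qed

lemma dcong_left_comm: "dcong (DPar P (DPar Q R)) (DPar Q (DPar P R))"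
  by (meson dcong.par dcong.par_assoc dcong.par_comm dcong.refl dcong.sym dcong.trans)

section \<open>Equivariance and names of transitions\<close>

fun amap :: "(tname \<Rightarrow> tname) \<Rightarrow> act \<Rightarrow> act" where
  "amap f Tau = Tau"
| "amap f (Inp a ks) = Inp (f a) (map f ks)"
| "amap f (Outp a ks bs) = Outp (f a) (map f ks) (f ` bs)"

lemma abn_amap [simp]: "abn (amap f \<alpha>) = f ` abn \<alpha>"
  by (cases \<alpha>) auto

lemma anames_amap [simp]: "anames (amap f \<alpha>) = f ` anames \<alpha>"
  by (cases \<alpha>) auto

lemma abn_anames: "abn \<alpha> \<subseteq> anames \<alpha>"
  by (cases \<alpha>) auto

lemma amap_comp: "amap f (amap g \<alpha>) = amap (f \<circ> g) \<alpha>"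
  by (cases \<alpha>) auto

lemma amap_ident: "(\<And>x. x \<in> anames \<alpha> \<Longrightarrow> f x = x) \<Longrightarrow> amap f \<alpha> = \<alpha>"
  by (cases \<alpha>) (auto simp: map_idI)

lemma ren_pm_involution: "(\<And>x. f (f x) = x) \<Longrightarrow> ren (pm f) (ren (pm f) P) = P"
  by (simp add: ren_comp) (rule ren_ident, case_tac x, auto)

text \<open>Injectivity preserves the freshness conditions on restricted and extruded names, which a
  general renaming could violate by identifying names.\<close>

lemma dstep_equiv:
  "dstep P \<alpha> P' \<Longrightarrow> inj f \<Longrightarrow> dstep (ren (pm f) P) (amap f \<alpha>) (ren (pm f) P')"
proof (induction rule: dstep.induct)
  case (out a ks P)
  have u: "up 0 (pm f) = pm f"
  proof
    fix x show "up 0 (pm f) x = pm f x" by (cases x) auto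
  qed
  show ?case using dstep.out[of "f a" "map f ks" "ren (pm f) P"] by (simp add: o_def u)
next
  case (inp ks n a P)
  have "pm f (opr ks x) = opr (map f ks) (up n (pm f) x)" for x
    by (cases x) (use inp in auto)
  then have "ren (pm f) (ren (opr ks) P) = ren (opr (map f ks)) (ren (up n (pm f)) P)"
    by (simp add: ren_comp o_def)
  then show ?case using dstep.inp[of "map f ks" n "f a" "ren (up n (pm f)) P"] inp by simp
next
  case (parl P \<alpha> P' Q)
  have "abn (amap f \<alpha>) \<inter> fn (ren (pm f) Q) = {}"
    using parl by (simp add: fn_ren_pm image_Int[symmetric])
  then show ?case using parl by (simp del: abn_amap add: dstep.parl)
next
  case (parr P \<alpha> P' Q)
  have "abn (amap f \<alpha>) \<inter> fn (ren (pm f) Q) = {}"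
    using parr by (simp add: fn_ren_pm image_Int[symmetric])
  then show ?case using parr by (simp del: abn_amap add: dstep.parr)
next
  case (comml P a ks bl P' Q Q')
  have "set (map f bl) \<inter> fn (ren (pm f) Q) = {}"
    using comml by (simp add: fn_ren_pm image_Int[symmetric])
  moreover have "distinct (map f bl)" using comml by (simp add: distinct_map inj_on_def inj_def)
  ultimately show ?case
    using comml dstep.comml[of "ren (pm f) P" "f a" "map f ks" "map f bl"]
    by (simp add: ren_pm_NRess)
next
  case (commr P a ks P' Q bl Q')
  have "set (map f bl) \<inter> fn (ren (pm f) P) = {}"
    using commr by (simp add: fn_ren_pm image_Int[symmetric])
  moreover have "distinct (map f bl)" using commr by (simp add: distinct_map inj_on_def inj_def)
  ultimately show ?case
    using commr dstep.commr[of "ren (pm f) P" "f a" "map f ks" _ _ "map f bl"]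
    by (simp add: ren_pm_NRess)
next
  case (res P \<alpha> P' z)
  have "f z \<notin> anames (amap f \<alpha>)" using res by (auto simp: inj_def)
  then show ?case using res by (auto simp: ren_pm_NRes intro: dstep.res)
next
  case (opn P a ks bs P' z)
  have "f z \<notin> f ` bs" "f z \<noteq> f a" using opn by (auto simp: inj_def)
  then show ?case using opn by (auto simp: ren_pm_NRes intro: dstep.opn)
qed (auto intro: dstep.intros)

lemma fn_ren_opr: "fn (ren (opr ks) P) \<subseteq> fn P \<union> set ks"
proof
  fix a assume "a \<in> fn (ren (opr ks) P)"
  then obtain x where "x \<in> fv P" "Fr a = opr ks x" by (auto simp: fn_def fv_ren)
  then show "a \<in> fn P \<union> set ks" by (cases x) (auto simp: fn_def split: if_splits)
qed

lemma fn_ren_opr_superset: "fn P \<subseteq> fn (ren (opr ks) P)"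
  by (force simp: fn_def fv_ren image_iff)

lemma NRes_neq [simp]:
  "NRes z P \<noteq> DNil" "NRes z P \<noteq> DPre p Q" "NRes z P \<noteq> DPar Q R" "NRes z P \<noteq> DBang Q"
  "DNil \<noteq> NRes z P" "DPre p Q \<noteq> NRes z P" "DPar Q R \<noteq> NRes z P" "DBang Q \<noteq> NRes z P"
  by (simp_all add: NRes_def)

lemma dstep_DPre_abn: "dstep R \<alpha> D \<Longrightarrow> R = DPre p P \<Longrightarrow> abn \<alpha> = {}"
  by (induction arbitrary: p rule: dstep.induct) auto

text \<open>For an output the three inclusions say that \<open>bs\<close> is \<open>set ks\<close>
  without the free names of \<open>P\<close>. Everything is proved in one induction, since the
  communication rules bound the names of the receiver's target through those of the sender.\<close>

lemma dstep_names:
  "dstep P \<alpha> P' \<Longrightarrow> fn P' \<subseteq> fn P \<union> anames \<alpha> \<and>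
    (\<forall>a ks bs. \<alpha> = Outp a ks bs \<longrightarrow> a \<in> fn P \<and> bs \<subseteq> set ks \<and> set ks \<subseteq> fn P \<union> bs \<and> bs \<inter> fn P = {}) \<and>
    (\<forall>a ks. \<alpha> = Inp a ks \<longrightarrow> a \<in> fn P)"
proof (induction rule: dstep.induct)
  case (inp ks n a P)
  show ?case using fn_ren_opr[of ks P] by auto
next
  case (comml P a ks bl P' Q Q')
  then show ?case by auto
next
  case (commr P a ks P' Q bl Q')
  then show ?case by auto
next
  case (match p P \<alpha> P' x)
  then show ?case using dstep_DPre_abn[OF match.hyps] by auto
qed auto

lemma dstep_fn: "dstep P \<alpha> P' \<Longrightarrow> fn P' \<subseteq> fn P \<union> anames \<alpha>"
  using dstep_names by blast

lemma dstep_Outp: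
  assumes "dstep P (Outp a ks bs) P'"
  shows "a \<in> fn P" "bs \<subseteq> set ks" "set ks \<subseteq> fn P \<union> bs" "bs \<inter> fn P = {}" "finite bs" "a \<notin> bs"
  using dstep_names[OF assms] finite_subset[of bs "set ks"] by auto

lemma dstep_Inp: "dstep P (Inp a ks) P' \<Longrightarrow> a \<in> fn P"
  using dstep_names by blast

lemma finite_anames: "dstep P \<alpha> P' \<Longrightarrow> finite (anames \<alpha>)"
  using dstep_Outp(5) by (cases \<alpha>) auto

section \<open>Inversion of transitions\<close>

inductive_cases dstep_DResE: "dstep (DRes Q) \<alpha> D"
inductive_cases dstep_DNilE: "dstep DNil \<alpha> D"
inductive_cases dstep_DParE: "dstep (DPar P Q) \<alpha> D"
inductive_cases dstep_DBangE: "dstep (DBang P) \<alpha> D"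
inductive_cases dstep_DOutE: "dstep (DPre (DOut a ks) P) \<alpha> D"
inductive_cases dstep_DInE: "dstep (DPre (DIn a n) P) \<alpha> D"
inductive_cases dstep_DMatchE: "dstep (DPre (DMatch a b p) P) \<alpha> D"

text \<open>The restricted name can be chosen arbitrarily fresh unless it is extruded.\<close>

lemma dstep_DRes_cases [consumes 1, case_names res opn]:
  assumes "dstep (DRes Q) \<alpha> D"
  obtains "\<And>z. z \<notin> fn Q \<Longrightarrow> z \<notin> anames \<alpha> \<Longrightarrow> \<exists>P'. dstep (ren (opr [z]) Q) \<alpha> P' \<and> D = NRes z P'"
  | w a ks bs where "\<alpha> = Outp a ks (insert w bs)" "w \<notin> bs" "w \<in> set ks" "w \<noteq> a" "w \<notin> fn Q"
      "dstep (ren (opr [w]) Q) (Outp a ks bs) D"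
proof (rule dstep_DResE[OF assms])
  fix P P' w
  assume a: "DRes Q = NRes w P" "D = NRes w P'" "dstep P \<alpha> P'" "w \<notin> anames \<alpha>"
  have w: "w \<notin> fn Q" "P = ren (opr [w]) Q" using NRes_eq_DRes a(1) by metis+
  have "\<exists>P''. dstep (ren (opr [z]) Q) \<alpha> P'' \<and> D = NRes z P''" if z: "z \<notin> fn Q" "z \<notin> anames \<alpha>" for z
  proof -
    \<comment> \<open>Neither \<open>w\<close> nor \<open>z\<close> occurs in the action, so the
      exchange leaves it alone, and it turns opening with \<open>w\<close> into opening with
      \<open>z\<close>.\<close>
    let ?f = "id(w := z, z := w)"
    have inj: "inj ?f" by (auto simp: inj_def)
    have "amap ?f \<alpha> = \<alpha>" by (rule amap_ident) (use a z in auto)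
    then have "dstep (ren (pm ?f) P) \<alpha> (ren (pm ?f) P')" using dstep_equiv[OF a(3) inj] by simp
    moreover have "(pm ?f \<circ> opr [w]) x = opr [z] x" if "x \<in> fv Q" for x
      using that w z by (cases x) (auto simp: fn_def)
    then have "ren (pm ?f) P = ren (opr [z]) Q" unfolding w(2) ren_comp by (rule ren_cong)
    moreover have "fn P' \<subseteq> fn Q \<union> {w} \<union> anames \<alpha>"
      using dstep_fn[OF a(3)] fn_ren_opr[of "[w]" Q] w by auto
    then have "NRes (?f w) (ren (pm ?f) P') = NRes w P'"
      by (intro NRes_rename inj) (use z in auto)
    moreover have "?f w = z" by simp
    ultimately show ?thesis using a(2) by metis
  qed
  then show thesis by (rule that(1))
next
  fix P a ks bs z
  assume "DRes Q = NRes z P" "\<alpha> = Outp a ks (insert z bs)" "dstep P (Outp a ks bs) D"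
    "z \<in> set ks" "z \<noteq> a" "z \<notin> bs"
  then show thesis using that(2)[of a ks z bs] NRes_eq_DRes[of z P Q] by metis
qed

lemma NRess_alpha:
  assumes "finite X" "distinct (bl :: tname list)"
  obtains f where "inj f" "distinct (map f bl)" "set (map f bl) \<inter> X = {}"
    "\<And>x. x \<notin> set bl \<Longrightarrow> x \<notin> f ` set bl \<Longrightarrow> f x = x" "\<And>x. f (f x) = x"
proof -
  obtain f where f: "bij f" "f ` set bl \<inter> X = {}"
    "\<And>x. x \<notin> set bl \<Longrightarrow> x \<notin> f ` set bl \<Longrightarrow> f x = x" "\<And>x. f (f x) = x"
    using fresh_perm[of "set bl" X] assms by auto
  then have "inj f" by (simp add: bij_def)
  moreover have "distinct (map f bl)"
    using assms(2) inj_on_subset[OF \<open>inj f\<close> subset_UNIV] by (simp add: distinct_map)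
  ultimately show thesis using that[of f] f by (metis set_map)
qed

text \<open>Extruded names are bound again in the result of a communication, so they can be moved
  away from \<open>X\<close> if both premises are renamed together. The two final equations serve
  the two orders of sender and receiver.\<close>

lemma comm_fresh:
  assumes "dstep P (Outp a ks (set bl)) P'" "dstep Q (Inp a ks) Q'" "set bl \<inter> fn Q = {}"
    "distinct bl" "finite X"
  shows "\<exists>js cl P'' Q''. dstep P (Outp a js (set cl)) P'' \<and> dstep Q (Inp a js) Q'' \<and>
    set cl \<inter> fn Q = {} \<and> distinct cl \<and> set cl \<inter> X = {} \<and>
    NRess bl (DPar P' Q') = NRess cl (DPar P'' Q'') \<and> NRess bl (DPar Q' P') = NRess cl (DPar Q'' P'')"
proof -
  let ?X = "X \<union> fn P \<union> fn Q \<union> fn P' \<union> fn Q' \<union> set ks \<union> {a}"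
  obtain f where f: "inj f" "distinct (map f bl)" "set (map f bl) \<inter> ?X = {}"
    "\<And>x. x \<notin> set bl \<Longrightarrow> x \<notin> f ` set bl \<Longrightarrow> f x = x"
    by (rule NRess_alpha[of ?X bl]) (use assms in auto)
  have P: "set bl \<inter> fn P = {}" "a \<notin> set bl" using dstep_Outp[OF assms(1)] by auto
  have fX: "f x = x" if "x \<in> ?X" "x \<notin> set bl" for x
  proof (rule f(4))
    show "x \<notin> f ` set bl" using f(3) that(1) unfolding set_map by blast
  qed (use that in simp)
  have "ren (pm f) P = P" "ren (pm f) Q = Q"
    by (rule ren_pm_ident, rule fX; use P assms(3) in auto)+
  moreover have "f a = a" by (rule fX) (use P in auto)
  ultimately have "dstep P (Outp a (map f ks) (set (map f bl))) (ren (pm f) P')"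
    "dstep Q (Inp a (map f ks)) (ren (pm f) Q')"
    using dstep_equiv[OF assms(1) f(1)] dstep_equiv[OF assms(2) f(1)] by auto
  moreover have "NRess (map f bl) (ren (pm f) (DPar P' Q')) = NRess bl (DPar P' Q')"
    by (rule NRess_rename[OF f(1)], rule fX) auto
  moreover have "NRess (map f bl) (ren (pm f) (DPar Q' P')) = NRess bl (DPar Q' P')"
    by (rule NRess_rename[OF f(1)], rule fX) auto
  moreover have "set (map f bl) \<inter> fn Q = {}" "set (map f bl) \<inter> X = {}" using f(3) by auto
  ultimately show ?thesis using f(2) by (metis ren.simps(3))
qed

lemma dstep_DPar_cases [consumes 2, case_names parl parr comml commr]:
  assumes "dstep (DPar P Q) \<alpha> D" "finite X"
  obtains P' where "D = DPar P' Q" "dstep P \<alpha> P'" "abn \<alpha> \<inter> fn Q = {}"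
  | Q' where "D = DPar P Q'" "dstep Q \<alpha> Q'" "abn \<alpha> \<inter> fn P = {}"
  | a ks bl P' Q' where "\<alpha> = Tau" "D = NRess bl (DPar P' Q')" "dstep P (Outp a ks (set bl)) P'"
     "dstep Q (Inp a ks) Q'" "set bl \<inter> fn Q = {}" "distinct bl" "set bl \<inter> X = {}"
  | a ks bl P' Q' where "\<alpha> = Tau" "D = NRess bl (DPar P' Q')" "dstep P (Inp a ks) P'"
     "dstep Q (Outp a ks (set bl)) Q'" "set bl \<inter> fn P = {}" "distinct bl" "set bl \<inter> X = {}"
proof (rule dstep_DParE[OF assms(1)])
  fix a ks bl P' Q'
  assume a: "\<alpha> = Tau" "D = NRess bl (DPar P' Q')" "dstep P (Outp a ks (set bl)) P'"
     "dstep Q (Inp a ks) Q'" "set bl \<inter> fn Q = {}" "distinct bl"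
  from comm_fresh[OF a(3-6) assms(2)] show thesis using that(3) a(1,2) by metis
next
  fix a ks P' bl Q'
  assume a: "\<alpha> = Tau" "D = NRess bl (DPar P' Q')" "dstep P (Inp a ks) P'"
     "dstep Q (Outp a ks (set bl)) Q'" "set bl \<inter> fn P = {}" "distinct bl"
  from comm_fresh[OF a(4,3,5,6) assms(2)] show thesis using that(4) a(1,2) by metis
qed (use that in auto)

section \<open>Harmony\<close>

text \<open>One step, with targets related by \<open>dcong\<close> and not by \<open>sim\<close>
  again. Establishing this in both directions for each rule of \<open>dcong\<close> makes
  \<open>dcong\<close> itself a bisimulation.\<close>

definition sim :: "dproc \<Rightarrow> dproc \<Rightarrow> bool" where
  "sim P Q \<longleftrightarrow> (\<forall>\<alpha> P'. dstep P \<alpha> P' \<longrightarrow> abn \<alpha> \<inter> fn Q = {} \<longrightarrow> (\<exists>Q'. dstep Q \<alpha> Q' \<and> dcong P' Q'))"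

lemma simI: "(\<And>\<alpha> P'. dstep P \<alpha> P' \<Longrightarrow> abn \<alpha> \<inter> fn Q = {} \<Longrightarrow> \<exists>Q'. dstep Q \<alpha> Q' \<and> dcong P' Q') \<Longrightarrow> sim P Q"
  by (simp add: sim_def)

lemma simE:
  assumes "sim P Q" "dstep P \<alpha> P'" "abn \<alpha> \<inter> fn Q = {}"
  obtains Q' where "dstep Q \<alpha> Q'" "dcong P' Q'"
  using assms unfolding sim_def by blast

lemma sim_refl: "sim P P"
  by (auto intro: simI dcong.refl)

text \<open>Structural congruence does not preserve free names (a trivial match may introduce some), so
  the extruded names have to be moved away from the names of the intermediate process.\<close>

lemma sim_trans:
  assumes "sim P Q" "sim Q R"
  shows "sim P R"
proof (rule simI)
  fix \<alpha> P' assume st: "dstep P \<alpha> P'" and fr: "abn \<alpha> \<inter> fn R = {}"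
  have fin: "finite (anames \<alpha>)" using finite_anames st .
  then have "finite (abn \<alpha>)" using abn_anames finite_subset by blast
  then obtain f where f: "bij f" "f ` abn \<alpha> \<inter> (fn P \<union> fn Q \<union> fn R) = {}"
    "\<And>x. x \<notin> abn \<alpha> \<Longrightarrow> x \<notin> f ` abn \<alpha> \<Longrightarrow> f x = x" "\<And>x. f (f x) = x"
    using fresh_perm[of "abn \<alpha>" "fn P \<union> fn Q \<union> fn R"] by auto
  have inj: "inj f" using f(1) by (simp add: bij_def)
  have "abn \<alpha> \<inter> fn P = {}" using dstep_Outp(4)[of P] st by (cases \<alpha>) auto
  then have "ren (pm f) P = P" using f(2,3) by (intro ren_pm_ident) blast
  then have "dstep P (amap f \<alpha>) (ren (pm f) P')" using dstep_equiv[OF st inj] by simp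
  then obtain Q' where Q': "dstep Q (amap f \<alpha>) Q'" "dcong (ren (pm f) P') Q'"
    by (rule simE[OF assms(1)]) (use f(2) in auto)
  obtain R' where R': "dstep R (amap f \<alpha>) R'" "dcong Q' R'"
    by (rule simE[OF assms(2) Q'(1)]) (use f(2) in auto)
  have "ren (pm f) R = R" using f(2,3) fr by (intro ren_pm_ident) blast
  moreover have "amap f (amap f \<alpha>) = \<alpha>" unfolding amap_comp by (rule amap_ident) (simp add: f(4))
  ultimately have "dstep R \<alpha> (ren (pm f) R')" using dstep_equiv[OF R'(1) inj] by simp
  moreover have "dcong (ren (pm f) (ren (pm f) P')) (ren (pm f) R')"
    by (intro dcong_ren dcong.trans[OF Q'(2) R'(2)])
  then have "dcong P' (ren (pm f) R')" using f(4) by (simp add: ren_pm_involution)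
  ultimately show "\<exists>R'. dstep R \<alpha> R' \<and> dcong P' R'" by blast
qed

lemma sim_match1: "sim (DPre (DMatch x x p) P) (DPre p P)"
  by (rule simI) (auto elim: dstep_DMatchE intro: dcong.refl)

lemma sim_match2: "sim (DPre p P) (DPre (DMatch x x p) P)"
  by (rule simI) (auto intro: dstep.match dcong.refl)

text \<open>Closure under renaming is essential here: an input instantiates the two congruent
  continuations with arbitrary names.\<close>

lemma sim_pre:
  assumes "dcong P Q"
  shows "sim (DPre p P) (DPre p Q)"
proof (induction p)
  case (DOut a ks)
  then show ?case using assms by (auto intro!: simI elim!: dstep_DOutE intro: dstep.out)
next
  case (DIn a n)
  then show ?case using assms by (auto intro!: simI elim!: dstep_DInE intro: dstep.inp dcong_ren)
next
  case (DMatch a b p)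
  show ?case
  proof (rule simI)
    fix \<alpha> P' assume "dstep (DPre (DMatch a b p) P) \<alpha> P'" "abn \<alpha> \<inter> fn (DPre (DMatch a b p) Q) = {}"
    then have "b = a" "dstep (DPre p P) \<alpha> P'" "abn \<alpha> \<inter> fn (DPre p Q) = {}"
      by (auto elim!: dstep_DMatchE)
    then show "\<exists>Q'. dstep (DPre (DMatch a b p) Q) \<alpha> Q' \<and> dcong P' Q'"
      using simE[OF DMatch.IH] by (metis dstep.match)
  qed
qed

lemma sim_par:
  assumes "sim P P2" "sim Q Q2" "dcong P P2" "dcong Q Q2"
  shows "sim (DPar P Q) (DPar P2 Q2)"
proof (rule simI)
  fix \<alpha> D assume st: "dstep (DPar P Q) \<alpha> D" and "abn \<alpha> \<inter> fn (DPar P2 Q2) = {}"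
  then have fr: "abn \<alpha> \<inter> fn P2 = {}" "abn \<alpha> \<inter> fn Q2 = {}" by auto
  \<comment> \<open>Extruded names must be fresh for \<open>P2\<close> and \<open>Q2\<close>, which
    may have more free names than \<open>P\<close> and \<open>Q\<close>.\<close>
  have "finite (fn P2 \<union> fn Q2)" by simp
  with st show "\<exists>D'. dstep (DPar P2 Q2) \<alpha> D' \<and> dcong D D'"
  proof (cases rule: dstep_DPar_cases)
    case (parl P')
    obtain P2' where "dstep P2 \<alpha> P2'" "dcong P' P2'" using simE[OF assms(1) parl(2) fr(1)] .
    then show ?thesis using parl fr assms by (blast intro: dstep.parl dcong.par)
  next
    case (parr Q')
    obtain Q2' where "dstep Q2 \<alpha> Q2'" "dcong Q' Q2'" using simE[OF assms(2) parr(2) fr(2)] .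
    then show ?thesis using parr fr assms by (blast intro: dstep.parr dcong.par)
  next
    case (comml a ks bl P' Q')
    obtain P2' where "dstep P2 (Outp a ks (set bl)) P2'" "dcong P' P2'"
      by (rule simE[OF assms(1) comml(3)]) (use comml in auto)
    moreover obtain Q2' where "dstep Q2 (Inp a ks) Q2'" "dcong Q' Q2'"
      by (rule simE[OF assms(2) comml(4)]) (use comml in auto)
    moreover have "set bl \<inter> fn Q2 = {}" using comml by auto
    ultimately show ?thesis using comml by (blast intro: dstep.comml dcong.par dcong_NRess)
  next
    case (commr a ks bl P' Q')
    obtain P2' where "dstep P2 (Inp a ks) P2'" "dcong P' P2'"
      by (rule simE[OF assms(1) commr(3)]) (use commr in auto)
    moreover obtain Q2' where "dstep Q2 (Outp a ks (set bl)) Q2'" "dcong Q' Q2'"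
      by (rule simE[OF assms(2) commr(4)]) (use commr in auto)
    moreover have "set bl \<inter> fn P2 = {}" using commr by auto
    ultimately show ?thesis using commr by (blast intro: dstep.commr dcong.par dcong_NRess)
  qed
qed

lemma sim_par_comm: "sim (DPar P Q) (DPar Q P)"
proof (rule simI)
  fix \<alpha> D assume "dstep (DPar P Q) \<alpha> D"
  then show "\<exists>D'. dstep (DPar Q P) \<alpha> D' \<and> dcong D D'"
    by (cases rule: dstep_DParE)
      (auto intro: dstep.parl dstep.parr dstep.comml dstep.commr dcong.par_comm dcong_NRess; blast
        intro: dstep.parl dstep.parr dstep.comml dstep.commr dcong.par_comm dcong_NRess)+
qed

lemma sim_unit1: "sim (DPar P DNil) P"
  by (rule simI) (auto elim!: dstep_DParE dstep_DNilE intro: dcong.par_unit)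

lemma sim_unit2: "sim P (DPar P DNil)"
proof (rule simI)
  fix \<alpha> P' assume "dstep P \<alpha> P'"
  then have "dstep (DPar P DNil) \<alpha> (DPar P' DNil)" by (rule dstep.parl) simp
  then show "\<exists>Q'. dstep (DPar P DNil) \<alpha> Q' \<and> dcong P' Q'" by (blast intro: dcong.sym dcong.par_unit)
qed

lemma sim_assoc1: "sim (DPar (DPar P Q) R) (DPar P (DPar Q R))"
proof (rule simI)
  fix \<alpha> D
  assume st: "dstep (DPar (DPar P Q) R) \<alpha> D" and "abn \<alpha> \<inter> fn (DPar P (DPar Q R)) = {}"
  then have fr: "abn \<alpha> \<inter> fn P = {}" "abn \<alpha> \<inter> fn Q = {}" "abn \<alpha> \<inter> fn R = {}" by auto
  \<comment> \<open>Extruded names that avoid all three components allow their scope to be moved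
    over the component that does not take part.\<close>
  let ?X = "fn P \<union> fn Q \<union> fn R" and ?G = "DPar P (DPar Q R)"
  have X: "finite ?X" by simp
  from st X show "\<exists>D'. dstep ?G \<alpha> D' \<and> dcong D D'"
  proof (cases rule: dstep_DPar_cases)
    case (parl S)
    from parl(2) X show ?thesis
    proof (cases rule: dstep_DPar_cases)
      case 2: (parl P')
      then have "dstep ?G \<alpha> (DPar P' (DPar Q R))" using fr by (intro dstep.parl) auto
      then show ?thesis using parl(1) 2(1) by (blast intro: dcong.par_assoc)
    next
      case 2: (parr Q')
      then have "dstep ?G \<alpha> (DPar P (DPar Q' R))" using fr by (intro dstep.parr dstep.parl) auto
      then show ?thesis using parl(1) 2(1) by (blast intro: dcong.par_assoc)
    next
      case 2: (comml a ks bl P' Q')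
      have "dstep (DPar Q R) (Inp a ks) (DPar Q' R)" using 2 by (intro dstep.parl) auto
      then have "dstep ?G \<alpha> (NRess bl (DPar P' (DPar Q' R)))"
        unfolding 2(1) using 2 by (intro dstep.comml) auto
      moreover have "dcong D (NRess bl (DPar (DPar P' Q') R))"
        using parl(1) 2 by (auto intro: dcong_extrs')
      ultimately show ?thesis by (blast intro: dcong.trans dcong_NRess dcong.par_assoc)
    next
      case 2: (commr a ks bl P' Q')
      have "dstep (DPar Q R) (Outp a ks (set bl)) (DPar Q' R)" using 2 by (intro dstep.parl) auto
      then have "dstep ?G \<alpha> (NRess bl (DPar P' (DPar Q' R)))"
        unfolding 2(1) using 2 by (intro dstep.commr) auto
      moreover have "dcong D (NRess bl (DPar (DPar P' Q') R))"
        using parl(1) 2 by (auto intro: dcong_extrs')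
      ultimately show ?thesis by (blast intro: dcong.trans dcong_NRess dcong.par_assoc)
    qed
  next
    case (parr R')
    then have "dstep ?G \<alpha> (DPar P (DPar Q R'))" using fr by (intro dstep.parr) auto
    then show ?thesis using parr(1) by (blast intro: dcong.par_assoc)
  next
    case (comml a ks bl S R')
    \<comment> \<open>The action inverted here is an output, so no internal communication arises and
      any set can be given as the names to avoid.\<close>
    have "finite {}" by simp
    with comml(3) show ?thesis
    proof (cases rule: dstep_DPar_cases)
      case 2: (parl P')
      have "dstep (DPar Q R) (Inp a ks) (DPar Q R')" using comml by (intro dstep.parr) auto
      then have "dstep ?G \<alpha> (NRess bl (DPar P' (DPar Q R')))"
        unfolding comml(1) using 2 comml by (intro dstep.comml) auto
      then show ?thesis using comml(2) 2(1) by (blast intro: dcong_NRess dcong.par_assoc)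
    next
      case 2: (parr Q')
      have "dstep (DPar Q R) Tau (NRess bl (DPar Q' R'))"
        using comml 2 by (intro dstep.comml) auto
      then have "dstep ?G \<alpha> (DPar P (NRess bl (DPar Q' R')))"
        unfolding comml(1) by (intro dstep.parr) auto
      moreover have "dcong (DPar P (NRess bl (DPar Q' R'))) (NRess bl (DPar P (DPar Q' R')))"
        using 2(3) by (intro dcong_extrs) auto
      ultimately show ?thesis using comml(2) 2(1)
        by (blast intro: dcong.trans dcong.sym dcong_NRess dcong.par_assoc)
    qed simp_all
  next
    case (commr a ks bl S R')
    have "finite {}" by simp
    with commr(3) show ?thesis
    proof (cases rule: dstep_DPar_cases)
      case 2: (parl P')
      have "dstep (DPar Q R) (Outp a ks (set bl)) (DPar Q R')" using commr by (intro dstep.parr) auto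
      then have "dstep ?G \<alpha> (NRess bl (DPar P' (DPar Q R')))"
        unfolding commr(1) using 2 commr by (intro dstep.commr) auto
      then show ?thesis using commr(2) 2(1) by (blast intro: dcong_NRess dcong.par_assoc)
    next
      case 2: (parr Q')
      have "dstep (DPar Q R) Tau (NRess bl (DPar Q' R'))"
        using commr 2 by (intro dstep.commr) auto
      then have "dstep ?G \<alpha> (DPar P (NRess bl (DPar Q' R')))"
        unfolding commr(1) by (intro dstep.parr) auto
      moreover have "dcong (DPar P (NRess bl (DPar Q' R'))) (NRess bl (DPar P (DPar Q' R')))"
        using commr by (intro dcong_extrs) auto
      ultimately show ?thesis using commr(2) 2(1)
        by (blast intro: dcong.trans dcong.sym dcong_NRess dcong.par_assoc)
    qed simp_all
  qed
qed

text \<open>Reversing the order of the components turns one direction of associativity into the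
  other.\<close>

lemma sim_par_swap: "sim (DPar P (DPar Q R)) (DPar (DPar R Q) P)"
proof -
  have "sim (DPar P (DPar Q R)) (DPar P (DPar R Q))"
    by (intro sim_par sim_refl sim_par_comm dcong.refl dcong.par_comm)
  then show ?thesis using sim_par_comm sim_trans by blast
qed

lemma sim_assoc2: "sim (DPar P (DPar Q R)) (DPar (DPar P Q) R)"
  using sim_trans[OF sim_trans[OF sim_par_swap sim_assoc1] sim_par_swap] .

lemma dstep_NRes_opr:
  assumes "dstep (ren (opr [z]) Q) \<alpha> P'" "z \<notin> fn Q" "z \<notin> anames \<alpha>"
  shows "dstep (DRes Q) \<alpha> (NRes z P')"
  using dstep.res[OF assms(1,3)] assms(2) by (simp add: DRes_NRes[symmetric])

lemma dstep_opn_opr: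
  assumes "dstep (ren (opr [z]) Q) (Outp a ks bs) P'" "z \<notin> fn Q" "z \<in> set ks" "z \<noteq> a" "z \<notin> bs"
  shows "dstep (DRes Q) (Outp a ks (insert z bs)) P'"
  using dstep.opn[OF assms(1,3-5)] assms(2) by (simp add: DRes_NRes[symmetric])

text \<open>The premise ranges over all names: a transition that keeps the restriction is treated
  with a fresh \<open>z\<close>, whereas an opening dictates the extruded name.\<close>

lemma sim_res:
  assumes "\<And>z. sim (ren (opr [z]) P) (ren (opr [z]) Q)"
  shows "sim (DRes P) (DRes Q)"
proof (rule simI)
  fix \<alpha> D assume st: "dstep (DRes P) \<alpha> D" and fr: "abn \<alpha> \<inter> fn (DRes Q) = {}"
  from st show "\<exists>D'. dstep (DRes Q) \<alpha> D' \<and> dcong D D'"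
  proof (cases rule: dstep_DRes_cases)
    case res
    obtain z where z: "z \<notin> fn P \<union> fn Q \<union> anames \<alpha>"
      using fresh_tname[of "fn P \<union> fn Q \<union> anames \<alpha>"] finite_anames[OF st] by auto
    then obtain P' where P': "dstep (ren (opr [z]) P) \<alpha> P'" "D = NRes z P'" using res by auto
    obtain Q' where Q': "dstep (ren (opr [z]) Q) \<alpha> Q'" "dcong P' Q'"
      by (rule simE[OF assms P'(1)]) (use fr z fn_ren_opr[of "[z]" Q] abn_anames[of \<alpha>] in auto)
    then have "dstep (DRes Q) \<alpha> (NRes z Q')" using z by (intro dstep_NRes_opr) auto
    then show ?thesis using P'(2) Q'(2) by (blast intro: dcong_NRes)
  next
    case (opn w a ks bs)
    have w: "w \<notin> fn Q" using fr opn(1) by auto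
    obtain Q' where Q': "dstep (ren (opr [w]) Q) (Outp a ks bs) Q'" "dcong D Q'"
      by (rule simE[OF assms opn(6)]) (use fr opn fn_ren_opr[of "[w]" Q] in auto)
    then have "dstep (DRes Q) \<alpha> Q'" unfolding opn(1) using opn w by (intro dstep_opn_opr) auto
    then show ?thesis using Q' by blast
  qed
qed

lemma ren_opr_sh: "ren (opr [z]) (ren (sh 1) P) = P"
  unfolding ren_comp by (rule ren_ident, case_tac x) auto

lemma fn_ren_sh [simp]: "fn (ren (sh n) P) = fn P"
proof -
  have "Fr a \<in> sh n ` fv P \<longleftrightarrow> Fr a \<in> fv P" for a
  proof
    assume "Fr a \<in> sh n ` fv P"
    then obtain x where "x \<in> fv P" "Fr a = sh n x" by auto
    then show "Fr a \<in> fv P" by (cases x) auto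
  qed (force simp: image_iff)
  then show ?thesis by (simp add: fn_def fv_ren)
qed

lemma dcong_extr_NRess:
  assumes "z \<notin> fn P"
  shows "dcong (NRess zs (DPar P (NRes z Q))) (NRes z (NRess zs (DPar P Q)))"
  by (rule dcong.trans[OF dcong_NRess[OF dcong_extr[OF assms]] dcong_NRess_NRes])

lemma sim_extr1: "sim (DPar P (DRes Q)) (DRes (DPar (ren (sh 1) P) Q))" (is "sim _ ?G")
proof (rule simI)
  fix \<alpha> D
  assume st: "dstep (DPar P (DRes Q)) \<alpha> D" and "abn \<alpha> \<inter> fn ?G = {}"
  then have fr: "abn \<alpha> \<inter> fn P = {}" "abn \<alpha> \<inter> fn Q = {}" by auto
  have G: "dstep ?G \<beta> (NRes z D')"
    if "dstep (DPar P (ren (opr [z]) Q)) \<beta> D'" "z \<notin> fn P" "z \<notin> fn Q" "z \<notin> anames \<beta>" for z D' \<beta>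
    by (rule dstep_NRes_opr) (use that ren_opr_sh[of z P] in auto)
  have "finite (fn P \<union> fn Q)" by simp
  with st show "\<exists>D'. dstep ?G \<alpha> D' \<and> dcong D D'"
  proof (cases rule: dstep_DPar_cases)
    case (parl P')
    obtain z where z: "z \<notin> fn P \<union> fn Q \<union> fn P' \<union> anames \<alpha>"
      using fresh_tname[of "fn P \<union> fn Q \<union> fn P' \<union> anames \<alpha>"] finite_anames[OF st] by auto
    have "dstep (DPar P (ren (opr [z]) Q)) \<alpha> (DPar P' (ren (opr [z]) Q))"
      using parl fr z fn_ren_opr[of "[z]" Q] abn_anames[of \<alpha>] by (intro dstep.parl) auto
    then have "dstep ?G \<alpha> (NRes z (DPar P' (ren (opr [z]) Q)))" by (rule G) (use z in auto)
    moreover have "D = DPar P' (NRes z (ren (opr [z]) Q))"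
      using parl z DRes_NRes[of z Q] by auto
    ultimately show ?thesis using dcong_extr[of z P'] z by blast
  next
    case (parr R)
    from parr(2) show ?thesis
    proof (cases rule: dstep_DRes_cases)
      case res
      obtain z where z: "z \<notin> fn P \<union> fn Q \<union> anames \<alpha>"
        using fresh_tname[of "fn P \<union> fn Q \<union> anames \<alpha>"] finite_anames[OF st] by auto
      then obtain Q' where Q': "dstep (ren (opr [z]) Q) \<alpha> Q'" "R = NRes z Q'" using res by auto
      have "dstep ?G \<alpha> (NRes z (DPar P Q'))"
        by (rule G[OF dstep.parr]) (use Q' z fr in auto)
      then show ?thesis using parr(1) Q'(2) dcong_extr[of z P] z by blast
    next
      case (opn w a ks bs)
      have "dstep (DPar P (ren (opr [w]) Q)) (Outp a ks bs) (DPar P R)"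
        by (rule dstep.parr) (use opn parr in auto)
      then have "dstep (ren (opr [w]) (DPar (ren (sh 1) P) Q)) (Outp a ks bs) (DPar P R)"
        using ren_opr_sh[of w P] by simp
      then have "dstep ?G \<alpha> (DPar P R)"
        unfolding opn(1) by (rule dstep_opn_opr) (use opn fr in auto)
      then show ?thesis using parr(1) dcong.refl by blast
    qed
  next
    case (comml a ks bl P' R)
    from comml(4) show ?thesis
    proof (cases rule: dstep_DRes_cases)
      case res
      obtain z where z: "z \<notin> fn P \<union> fn Q \<union> fn P' \<union> {a} \<union> set ks \<union> set bl"
        using fresh_tname[of "fn P \<union> fn Q \<union> fn P' \<union> {a} \<union> set ks \<union> set bl"] by auto
      then obtain Q' where Q': "dstep (ren (opr [z]) Q) (Inp a ks) Q'" "R = NRes z Q'" using res by auto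
      have "dstep ?G Tau (NRes z (NRess bl (DPar P' Q')))"
        by (rule G[OF dstep.comml]) (use Q' z comml fn_ren_opr[of "[z]" Q] in auto)
      moreover have "dcong D (NRes z (NRess bl (DPar P' Q')))"
        using comml(2) Q'(2) z by (simp add: dcong_extr_NRess)
      ultimately show ?thesis using comml(1) by blast
    qed simp
  next
    case (commr a ks bl P' R)
    from commr(4) show ?thesis
    proof (cases rule: dstep_DRes_cases)
      case res
      obtain z where z: "z \<notin> fn P \<union> fn Q \<union> fn P' \<union> {a} \<union> set ks \<union> set bl"
        using fresh_tname[of "fn P \<union> fn Q \<union> fn P' \<union> {a} \<union> set ks \<union> set bl"] by auto
      then obtain Q' where Q': "dstep (ren (opr [z]) Q) (Outp a ks (set bl)) Q'" "R = NRes z Q'"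
        using res by auto
      have "dstep ?G Tau (NRes z (NRess bl (DPar P' Q')))"
        by (rule G[OF dstep.commr]) (use Q' z commr in auto)
      moreover have "dcong D (NRes z (NRess bl (DPar P' Q')))"
        using commr(2) Q'(2) z by (simp add: dcong_extr_NRess)
      ultimately show ?thesis using commr(1) by blast
    next
      case (opn w a' ks' bs)
      \<comment> \<open>The communication extrudes \<open>w\<close>, which is bound somewhere in
        \<open>bl\<close>. In the widened process \<open>w\<close> is restricted outside the
        communication, so it has to be moved to the front of the block.\<close>
      have w: "w \<in> set bl" "set (remove1 w bl) = bs" using opn(1,2) commr(6) by auto
      have "dstep (DPar P (ren (opr [w]) Q)) Tau (NRess (remove1 w bl) (DPar P' R))"
        by (rule dstep.commr[of _ a ks]) (use commr opn w in auto)
      then have "dstep ?G Tau (NRes w (NRess (remove1 w bl) (DPar P' R)))"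
        by (rule G) (use opn commr w in auto)
      then show ?thesis using commr(1,2) dcong_NRess_remove[OF w(1)] by blast
    qed
  qed
qed

lemma sim_extr2: "sim (DRes (DPar (ren (sh 1) P) Q)) (DPar P (DRes Q))" (is "sim ?G _")
proof (rule simI)
  fix \<alpha> D
  assume st: "dstep ?G \<alpha> D" and "abn \<alpha> \<inter> fn (DPar P (DRes Q)) = {}"
  then have fr: "abn \<alpha> \<inter> fn P = {}" "abn \<alpha> \<inter> fn Q = {}" by auto
  from st show "\<exists>D'. dstep (DPar P (DRes Q)) \<alpha> D' \<and> dcong D D'"
  proof (cases rule: dstep_DRes_cases)
    case res
    obtain z where z: "z \<notin> fn P \<union> fn Q \<union> anames \<alpha>"
      using fresh_tname[of "fn P \<union> fn Q \<union> anames \<alpha>"] finite_anames[OF st] by auto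
    then obtain D1 where "dstep (ren (opr [z]) (DPar (ren (sh 1) P) Q)) \<alpha> D1" and D: "D = NRes z D1"
      using res by auto
    then have D1: "dstep (DPar P (ren (opr [z]) Q)) \<alpha> D1" using ren_opr_sh[of z P] by simp
    have "finite ({z} \<union> fn P \<union> fn Q)" by simp
    with D1 show ?thesis
    proof (cases rule: dstep_DPar_cases)
      case (parl P')
      then have "dstep (DPar P (DRes Q)) \<alpha> (DPar P' (DRes Q))" using fr by (intro dstep.parl) auto
      moreover have "z \<notin> fn P'" using dstep_fn[OF parl(2)] z by auto
      then have "dcong D (DPar P' (DRes Q))"
        using D parl(1) DRes_NRes[of z Q] z dcong_extr[of z P'] by (auto intro: dcong.sym)
      ultimately show ?thesis by blast
    next
      case (parr Q')
      then have "dstep (DRes Q) \<alpha> (NRes z Q')" using z by (intro dstep_NRes_opr) auto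
      then have "dstep (DPar P (DRes Q)) \<alpha> (DPar P (NRes z Q'))" using fr by (intro dstep.parr) auto
      moreover have "dcong D (DPar P (NRes z Q'))"
        using D parr(1) z dcong_extr[of z P] by (auto intro: dcong.sym)
      ultimately show ?thesis by blast
    next
      case (comml a ks bl P' Q')
      \<comment> \<open>The sender is \<open>P\<close>, in which \<open>z\<close> is not free, so
        \<open>z\<close> cannot be transmitted and its restriction stays with the receiver.\<close>
      have za: "z \<notin> insert a (set ks)" using dstep_Outp(1,3)[OF comml(3)] comml(7) z by auto
      then have "dstep (DRes Q) (Inp a ks) (NRes z Q')"
        using z comml by (intro dstep_NRes_opr) auto
      then have "dstep (DPar P (DRes Q)) Tau (NRess bl (DPar P' (NRes z Q')))"
        using comml by (intro dstep.comml[of _ a ks]) auto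
      moreover have "z \<notin> fn P'" using dstep_fn[OF comml(3)] z za comml(7) by auto
      then have "dcong D (NRess bl (DPar P' (NRes z Q')))"
        using D comml(2) dcong.sym[OF dcong_extr_NRess] by simp
      ultimately show ?thesis using comml(1) by blast
    next
      case (commr a ks bl P' Q')
      have za: "z \<noteq> a" using dstep_Inp[OF commr(3)] z by auto
      \<comment> \<open>If \<open>Q\<close> transmits \<open>z\<close>, the narrow restriction is
        opened and joins the extruded block; otherwise it is kept around the target of
        \<open>Q\<close>.\<close>
      show ?thesis
      proof (cases "z \<in> set ks")
        case True
        have "dstep (DRes Q) (Outp a ks (set (z # bl))) Q'"
          using dstep_opn_opr[OF commr(4)] z za True commr(7) by simp
        then have "dstep (DPar P (DRes Q)) Tau (NRess (z # bl) (DPar P' Q'))"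
          by (intro dstep.commr[OF commr(3)]) (use z commr in auto)
        then show ?thesis using commr(1,2) D by (auto intro: dcong.refl)
      next
        case False
        then have "dstep (DRes Q) (Outp a ks (set bl)) (NRes z Q')"
          using dstep_NRes_opr[OF commr(4)] z za commr(7) by auto
        then have "dstep (DPar P (DRes Q)) Tau (NRess bl (DPar P' (NRes z Q')))"
          by (intro dstep.commr[OF commr(3)]) (use commr in auto)
        moreover have "z \<notin> fn P'" using dstep_fn[OF commr(3)] z za False by auto
        then have "dcong D (NRess bl (DPar P' (NRes z Q')))"
          using D commr(2) dcong.sym[OF dcong_extr_NRess] by simp
        ultimately show ?thesis using commr(1) by blast
      qed
    qed
  next
    case (opn w a ks bs)
    have w: "w \<notin> fn P" "w \<notin> fn Q" using opn fr by auto
    have "dstep (DPar P (ren (opr [w]) Q)) (Outp a ks bs) D" using opn(6) ren_opr_sh[of w P] by simp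
    moreover have "finite {}" by simp
    ultimately show ?thesis
    proof (cases rule: dstep_DPar_cases)
      case (parl P')
      \<comment> \<open>Impossible: \<open>P\<close> would have to emit \<open>w\<close>, which is
        neither free in it nor extruded by it.\<close>
      then show ?thesis using dstep_Outp(3)[OF parl(2)] opn w by auto
    next
      case (parr Q')
      then have "dstep (DRes Q) \<alpha> Q'" unfolding opn(1) using w opn by (intro dstep_opn_opr) auto
      then have "dstep (DPar P (DRes Q)) \<alpha> (DPar P Q')" using fr by (intro dstep.parr) auto
      then show ?thesis using parr(1) dcong.refl by blast
    qed simp_all
  qed
qed

text \<open>Each of the two restrictions is either kept or opened, which gives four cases. They rest
  on the local equation \<open>sw\<close>: opening the exchanged body with the two names in the
  opposite order gives the same process.\<close>

lemma sim_res_comm: "sim (DRes (DRes P)) (DRes (DRes (ren sw P)))" (is "sim _ ?G")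
proof (rule simI)
  fix \<alpha> D
  assume st: "dstep (DRes (DRes P)) \<alpha> D" and "abn \<alpha> \<inter> fn ?G = {}"
  have sw: "ren (opr [z]) (ren (up 1 (opr [w])) (ren sw P)) = ren (opr [w]) (ren (up 1 (opr [z])) P)"
    for z w
    unfolding ren_comp
  proof (rule ren_cong)
    fix x
    show "(opr [z] \<circ> (up 1 (opr [w]) \<circ> sw)) x = (opr [w] \<circ> up 1 (opr [z])) x"
      by (cases x) (auto simp: less_Suc_eq_0_disj)
  qed
  have fnsw: "fn (ren sw P) = fn P"
  proof -
    have "Fr a \<in> sw ` A \<longleftrightarrow> Fr a \<in> A" for a A
    proof
      assume "Fr a \<in> sw ` A"
      then obtain x where "x \<in> A" "Fr a = sw x" by auto
      then show "Fr a \<in> A" by (cases x) (auto split: if_splits)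
    qed (force simp: image_iff)
    then show ?thesis by (simp add: fn_def fv_ren)
  qed
  have up: "fn (ren (up 1 (opr [z])) R) \<subseteq> insert z (fn R)" for z R
    using fn_ren_opr[of "[z]" "DRes R"] by simp
  have fin: "finite (fn P \<union> anames \<alpha>)" using finite_anames[OF st] by simp
  from st show "\<exists>D'. dstep ?G \<alpha> D' \<and> dcong D D'"
  proof (cases rule: dstep_DRes_cases)
    case res
    obtain z where z: "z \<notin> fn P \<union> anames \<alpha>" using fresh_tname[OF fin] by auto
    then obtain D1 where D1: "dstep (DRes (ren (up 1 (opr [z])) P)) \<alpha> D1" "D = NRes z D1"
      using res by auto
    from D1(1) show ?thesis
    proof (cases rule: dstep_DRes_cases)
      case 2: res
      obtain w where w: "w \<notin> insert z (fn P \<union> anames \<alpha>)" using fresh_tname[of "insert z (fn P \<union> anames \<alpha>)"] fin by auto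
      then obtain D2 where D2: "dstep (ren (opr [w]) (ren (up 1 (opr [z])) P)) \<alpha> D2" "D1 = NRes w D2"
        using 2[of w] up[of z P] by auto
      have "dstep (DRes (ren (up 1 (opr [w])) (ren sw P))) \<alpha> (NRes z D2)"
        by (rule dstep_NRes_opr) (use D2 sw z w up[of w "ren sw P"] fnsw in auto)
      then have "dstep ?G \<alpha> (NRes w (NRes z D2))"
        by (intro dstep_NRes_opr) (use w fnsw in auto)
      then show ?thesis using D1(2) D2(2) dcong_NRes_comm by blast
    next
      case (opn w a ks bs)
      have w: "w \<noteq> z" using opn(1) z by auto
      have "w \<notin> fn P" using opn(5) fn_ren_opr_superset[of "DRes P" "[z]"] by auto
      have "dstep (DRes (ren (up 1 (opr [w])) (ren sw P))) (Outp a ks bs) (NRes z D1)"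
        by (rule dstep_NRes_opr) (use opn sw z w up[of w "ren sw P"] fnsw in auto)
      then have "dstep ?G \<alpha> (NRes z D1)"
        unfolding opn(1) by (intro dstep_opn_opr) (use opn fnsw \<open>w \<notin> fn P\<close> in auto)
      then show ?thesis using D1(2) dcong.refl by blast
    qed
  next
    case (opn z a ks bs)
    have z: "z \<notin> fn P" using opn by simp
    have "dstep (DRes (ren (up 1 (opr [z])) P)) (Outp a ks bs) D" using opn(6) by simp
    then show ?thesis
    proof (cases rule: dstep_DRes_cases)
      case 2: res
      obtain w where w: "w \<notin> fn P \<union> anames \<alpha>" using fresh_tname[OF fin] by auto
      then obtain D2 where D2: "dstep (ren (opr [w]) (ren (up 1 (opr [z])) P)) (Outp a ks bs) D2" "D = NRes w D2"
        using 2[of w] up[of z P] opn by auto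
      have "dstep (DRes (ren (up 1 (opr [w])) (ren sw P))) \<alpha> D2"
        unfolding opn(1) by (rule dstep_opn_opr) (use D2 sw w opn up[of w "ren sw P"] fnsw in auto)
      then have "dstep ?G \<alpha> (NRes w D2)"
        by (intro dstep_NRes_opr) (use w fnsw in auto)
      then show ?thesis using D2(2) dcong.refl by blast
    next
      case 2: (opn w a' ks' bs')
      have w: "w \<noteq> z" using 2 opn by auto
      have "w \<notin> fn P" using 2(5) fn_ren_opr_superset[of "DRes P" "[z]"] by auto
      have "dstep (DRes (ren (up 1 (opr [w])) (ren sw P))) (Outp a ks (insert z bs')) D"
        by (rule dstep_opn_opr) (use 2 sw opn w up[of w "ren sw P"] fnsw in auto)
      then have "dstep ?G (Outp a ks (insert w (insert z bs'))) D"
        by (intro dstep_opn_opr) (use 2 opn fnsw w \<open>w \<notin> fn P\<close> in auto)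
      moreover have "\<alpha> = Outp a ks (insert w (insert z bs'))" using opn 2 by auto
      ultimately show ?thesis using dcong.refl by blast
    qed
  qed
qed

lemma sim_res_nil: "sim (DRes DNil) Q"
proof (rule simI)
  fix \<alpha> D assume st: "dstep (DRes DNil) \<alpha> D"
  from st show "\<exists>D'. dstep Q \<alpha> D' \<and> dcong D D'"
  proof (cases rule: dstep_DRes_cases)
    case res
    obtain z where "z \<notin> anames \<alpha>" using fresh_tname[OF finite_anames[OF st]] by auto
    then have "\<exists>P'. dstep DNil \<alpha> P'" using res[of z] by auto
    then show ?thesis by (auto elim: dstep_DNilE)
  qed (auto elim: dstep_DNilE)
qed

lemma sim_nil: "sim DNil Q"
  by (auto intro!: simI elim: dstep_DNilE)

lemma sim_bang_unf1: "sim (DBang P) (DPar P (DBang P))"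
  by (rule simI) (auto elim!: dstep_DBangE intro: dcong.refl)

lemma sim_bang_unf2: "sim (DPar P (DBang P)) (DBang P)"
  by (rule simI) (auto intro: dcong.refl dstep.rep)

lemma dcong_bang_absorb:
  "dcong R (DPar S (DBang P)) \<Longrightarrow> dcong (DPar T R) (DPar (DPar T S) (DBang P))"
  by (meson dcong.par dcong.par_assoc dcong.refl dcong.sym dcong.trans)

text \<open>Two copies suffice for every transition of a replication.\<close>

lemma dstep_bang:
  "dstep R \<alpha> D \<Longrightarrow> R = DBang P \<or> R = DPar P (DBang P) \<Longrightarrow>
    (\<alpha> \<noteq> Tau \<longrightarrow> (\<exists>P1. dstep P \<alpha> P1 \<and> dcong D (DPar P1 (DBang P)))) \<and>
    (\<alpha> = Tau \<longrightarrow> (\<exists>P2. dstep (DPar P P) Tau P2 \<and> dcong D (DPar P2 (DBang P))))"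
proof (induction rule: dstep.induct)
  case (parl P1 \<alpha> P1' Q)
  then have P: "P1 = P" "Q = DBang P" by auto
  have absorb: "dcong (DPar P1' (DBang P)) (DPar (DPar P1' P) (DBang P))"
    by (rule dcong_bang_absorb[OF dcong.bang_unf])
  show ?case
  proof (cases "\<alpha> = Tau")
    case True
    then have "dstep (DPar P P) Tau (DPar P1' P)" using parl P by (auto intro: dstep.parl)
    then show ?thesis using True P absorb by blast
  next
    case False
    then show ?thesis using parl P dcong.refl by blast
  qed
next
  case (parr Q \<alpha> Q' P1)
  then have P: "P1 = P" "Q = DBang P" by auto
  have absorb: "dcong (DPar P Q') (DPar S (DBang P))" if "dcong Q' (DPar S (DBang P))" for S
  proof -
    have "dcong (DPar P Q') (DPar S (DPar P (DBang P)))"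
      using that by (meson dcong.par dcong.refl dcong.trans dcong_left_comm)
    then show ?thesis by (meson dcong.bang_unf dcong.par dcong.refl dcong.sym dcong.trans)
  qed
  then show ?case using parr.IH P by blast
next
  case (comml P1 a ks bl P1' Q Q')
  then have P: "P1 = P" "Q = DBang P" by auto
  then obtain P2' where P2': "dstep P (Inp a ks) P2'" "dcong Q' (DPar P2' (DBang P))"
    using comml.IH(2) by auto
  have fr: "set bl \<inter> fn P = {}" using comml P by simp
  have "dstep (DPar P P) Tau (NRess bl (DPar P1' P2'))"
    using comml P P2' fr by (auto intro: dstep.comml)
  moreover have "dcong (NRess bl (DPar P1' Q')) (NRess bl (DPar (DPar P1' P2') (DBang P)))"
    by (intro dcong_NRess dcong_bang_absorb P2')
  then have "dcong (NRess bl (DPar P1' Q')) (DPar (NRess bl (DPar P1' P2')) (DBang P))"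
    by (rule dcong.trans) (use fr in \<open>auto intro!: dcong.sym[OF dcong_extrs']\<close>)
  ultimately show ?case by blast
next
  case (commr P1 a ks P1' Q bl Q')
  then have P: "P1 = P" "Q = DBang P" by auto
  then obtain P2' where P2': "dstep P (Outp a ks (set bl)) P2'" "dcong Q' (DPar P2' (DBang P))"
    using commr.IH(2) by auto
  have fr: "set bl \<inter> fn P = {}" using commr P by simp
  have "dstep (DPar P P) Tau (NRess bl (DPar P1' P2'))"
    using commr P P2' fr by (auto intro: dstep.commr)
  moreover have "dcong (NRess bl (DPar P1' Q')) (NRess bl (DPar (DPar P1' P2') (DBang P)))"
    by (intro dcong_NRess dcong_bang_absorb P2')
  then have "dcong (NRess bl (DPar P1' Q')) (DPar (NRess bl (DPar P1' P2')) (DBang P))"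
    by (rule dcong.trans) (use fr in \<open>auto intro!: dcong.sym[OF dcong_extrs']\<close>)
  ultimately show ?case by blast
qed auto

lemma sim_unfold2: "sim (DPar (DPar Q Q) (DBang Q)) (DBang Q)"
proof -
  have "sim (DPar Q (DPar Q (DBang Q))) (DPar Q (DBang Q))"
    by (intro sim_par sim_refl sim_bang_unf2 dcong.refl dcong.sym[OF dcong.bang_unf])
  then show ?thesis using sim_assoc1 sim_bang_unf2 sim_trans by blast
qed

text \<open>Instead of following an unbounded number of unfoldings, every step is reduced by
  \<open>dstep_bang\<close> to one of \<open>P\<close> or of \<open>DPar P P\<close>, where the
  hypothesis and \<open>sim_par\<close> apply. The answer is then folded back into the
  replication.\<close>

lemma sim_bang:
  assumes "sim P Q" "dcong P Q"
  shows "sim (DBang P) (DBang Q)"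
proof (rule simI)
  fix \<alpha> D assume st: "dstep (DBang P) \<alpha> D" and fr: "abn \<alpha> \<inter> fn (DBang Q) = {}"
  have PQ: "dcong (DBang P) (DBang Q)" by (rule dcong.bang[OF assms(2)])
  show "\<exists>D'. dstep (DBang Q) \<alpha> D' \<and> dcong D D'"
  proof (cases "\<alpha> = Tau")
    case False
    then obtain P1 where P1: "dstep P \<alpha> P1" "dcong D (DPar P1 (DBang P))"
      using dstep_bang[OF st, of P] by auto
    obtain Q1 where Q1: "dstep Q \<alpha> Q1" "dcong P1 Q1"
      by (rule simE[OF assms(1) P1(1)]) (use fr in auto)
    have "dstep (DBang Q) \<alpha> (DPar Q1 (DBang Q))"
      by (intro dstep.rep dstep.parl Q1) (use fr in auto)
    moreover have "dcong D (DPar Q1 (DBang Q))" using P1(2) Q1(2) PQ by (meson dcong.par dcong.trans)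
    ultimately show ?thesis by blast
  next
    case True
    then obtain P2 where P2: "dstep (DPar P P) Tau P2" "dcong D (DPar P2 (DBang P))"
      using dstep_bang[OF st, of P] by auto
    obtain Q2 where Q2: "dstep (DPar Q Q) Tau Q2" "dcong P2 Q2"
      by (rule simE[OF sim_par P2(1)]) (use assms in auto)
    have "dstep (DPar (DPar Q Q) (DBang Q)) Tau (DPar Q2 (DBang Q))"
      by (intro dstep.parl Q2) auto
    then obtain D' where "dstep (DBang Q) Tau D'" "dcong (DPar Q2 (DBang Q)) D'"
      by (rule simE[OF sim_unfold2]) auto
    moreover have "dcong D (DPar Q2 (DBang Q))" using P2(2) Q2(2) PQ by (meson dcong.par dcong.trans)
    ultimately show ?thesis using True by (meson dcong.trans)
  qed
qed

text \<open>The handlers of an unused name are inert: their only free channels are restricted, and they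
  do not communicate with each other.\<close>

definition input_only :: "dproc \<Rightarrow> bool" where
  "input_only P \<longleftrightarrow> (\<forall>r \<alpha> D. dstep (ren r P) \<alpha> D \<longrightarrow> (\<exists>a ks. \<alpha> = Inp a ks))"

lemma input_only_ren: "input_only P \<Longrightarrow> input_only (ren r P)"
  by (auto simp: input_only_def ren_comp)

lemma input_only_par: "input_only P \<Longrightarrow> input_only Q \<Longrightarrow> input_only (DPar P Q)"
  unfolding input_only_def by (fastforce elim!: dstep_DParE)

lemma input_only_in: "input_only (DPre (DIn a n) P)"
  unfolding input_only_def by (auto elim!: dstep_DInE)

lemma input_only_bang:
  assumes "input_only P"
  shows "input_only (DBang P)"
  unfolding input_only_def
proof (intro allI impI)
  fix r \<alpha> D assume "dstep (ren r (DBang P)) \<alpha> D"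
  then have "dstep (DBang (ren r P)) \<alpha> D" by simp
  then have "(\<exists>P1. dstep (ren r P) \<alpha> P1) \<or> \<alpha> = Tau \<and> (\<exists>P2. dstep (ren r (DPar P P)) Tau P2)"
    using dstep_bang[of "DBang (ren r P)" \<alpha> D "ren r P"] by auto
  then show "\<exists>a ks. \<alpha> = Inp a ks"
    using assms input_only_par[OF assms assms] unfolding input_only_def by blast
qed

text \<open>Opening a restriction is a renaming, which is why \<open>input_only\<close> quantifies
  over renamings.\<close>

lemma input_only_res:
  assumes "input_only P"
  shows "input_only (DRes P)"
  unfolding input_only_def
proof (intro allI impI)
  fix r \<alpha> D assume "dstep (ren r (DRes P)) \<alpha> D"
  then have st: "dstep (DRes (ren (up 1 r) P)) \<alpha> D" by simp
  have P: "\<exists>a ks. \<beta> = Inp a ks" if "dstep (ren s (ren (up 1 r) P)) \<beta> D'" for s \<beta> D'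
    using that assms unfolding input_only_def ren_comp by blast
  from st show "\<exists>a ks. \<alpha> = Inp a ks"
  proof (cases rule: dstep_DRes_cases)
    case res
    obtain z where "z \<notin> fn (ren (up 1 r) P) \<union> anames \<alpha>"
      using fresh_tname[of "fn (ren (up 1 r) P) \<union> anames \<alpha>"] finite_anames[OF st] by auto
    then have "\<exists>P'. dstep (ren (opr [z]) (ren (up 1 r) P)) \<alpha> P'" using res[of z] by auto
    then show ?thesis using P by blast
  next
    case (opn w a ks bs)
    then show ?thesis using P by blast
  qed
qed

lemma input_only_handler: "input_only (db (handler k))"
  unfolding handler_def by (auto intro!: input_only_par input_only_bang input_only_in)

text \<open>Every transition would be an input, and by \<open>dstep_Inp\<close> the subject of an
  input is free, but the process has no free names.\<close>

lemma sim_gc: "sim (NRes (Nm k) (NRes (Nn k) (NRes (Mm k) (db (handler k))))) Q" (is "sim ?H Q")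
proof (rule simI)
  fix \<alpha> D assume st: "dstep ?H \<alpha> D"
  have "input_only ?H"
    unfolding NRes_def by (intro input_only_res input_only_ren input_only_handler)
  then have "\<exists>a ks. \<alpha> = Inp a ks" using st by (metis input_only_def ren_gc)
  moreover have "fn ?H = {}" by auto
  ultimately show "\<exists>Q'. dstep Q \<alpha> Q' \<and> dcong D Q'" using dstep_Inp st by blast
qed

text \<open>Both directions are proved together because of the symmetry rule, and for all renamings
  because the case of restriction needs the hypothesis for opened bodies.\<close>

lemma dcong_sim: "dcong P Q \<Longrightarrow> sim (ren r P) (ren r Q) \<and> sim (ren r Q) (ren r P)"
proof (induction arbitrary: r rule: dcong.induct)
  case (refl P)
  then show ?case by (simp add: sim_refl)
next
  case (sym P Q)
  then show ?case by simp
next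
  case (trans P Q R)
  then show ?case by (meson sim_trans)
next
  case (pre P Q p)
  then show ?case by (simp add: sim_pre dcong_ren dcong.sym)
next
  case (par P P' Q Q')
  then show ?case by (simp add: sim_par dcong_ren dcong.sym)
next
  case (res P Q)
  show ?case using res.IH by (simp add: sim_res ren_comp)
next
  case (bang P Q)
  then show ?case by (simp add: sim_bang dcong_ren dcong.sym)
next
  case (match x p P)
  then show ?case by (simp add: sim_match1 sim_match2)
next
  case (par_assoc P Q R)
  then show ?case by (simp add: sim_assoc1 sim_assoc2)
next
  case (par_comm P Q)
  then show ?case by (simp add: sim_par_comm)
next
  case (par_unit P)
  then show ?case by (simp add: sim_unit1 sim_unit2)
next
  case (res_comm P)
  have "ren (up 1 (up 1 r)) (ren sw P) = ren sw (ren (up 1 (up 1 r)) P)"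
    by (simp only: ren_comp up_up_sw)
  moreover have "sw \<circ> sw = (\<lambda>x. x)"
  proof
    fix x show "(sw \<circ> sw) x = x" by (cases x) auto
  qed
  then have "ren sw (ren sw R) = R" for R by (simp add: ren_comp ren_id)
  ultimately show ?case
    using sim_res_comm[of "ren (up 1 (up 1 r)) P"] sim_res_comm[of "ren sw (ren (up 1 (up 1 r)) P)"]
    by simp
next
  case res_nil
  then show ?case by (simp add: sim_res_nil sim_nil)
next
  case (extr P Q)
  have "up 1 r \<circ> sh 1 = sh 1 \<circ> r" by auto
  then have "ren (up 1 r) (ren (sh 1) P) = ren (sh 1) (ren r P)" by (simp add: ren_comp)
  then show ?case using sim_extr1[of "ren r P" "ren (up 1 r) Q"] sim_extr2[of "ren r P" "ren (up 1 r) Q"]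
    by simp
next
  case (bang_unf P)
  then show ?case by (simp add: sim_bang_unf1 sim_bang_unf2)
next
  case (gc k)
  then show ?case by (simp add: ren_gc sim_gc sim_nil)
qed

lemma dcong_harmony:
  assumes "dcong P Q" "dstep P \<alpha> P'" "abn \<alpha> \<inter> fn Q = {}"
  obtains Q' where "dstep Q \<alpha> Q'" "dcong P' Q'"
  using dcong_sim[OF assms(1), of "\<lambda>x. x"] assms(2,3) simE by (metis ren_id)

lemma dcong_bisim:
  assumes "dcong (db P) (db Q)"
  shows "bisim P Q"
proof -
  let ?R = "\<lambda>P Q. dcong (db P) (db Q)"
  have "\<exists>Q'. tstep Q \<alpha> Q' \<and> ?R P' Q'"
    if c: "?R P Q" and st: "tstep P \<alpha> P'" and fr: "abn \<alpha> \<inter> tfn Q = {}" for P Q \<alpha> P'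
  proof -
    obtain D where "dstep (db Q) \<alpha> D" "dcong (db P') D"
      by (rule dcong_harmony[OF c tstep_dstep[OF st]]) (use fr in auto)
    then show ?thesis using dstep_tstep by blast
  qed
  then have "strong_bisimulation ?R"
    unfolding strong_bisimulation_def by (blast intro: dcong.sym)
  then show ?thesis using assms unfolding bisim_def by blast
qed

section \<open>The translation of structural congruence\<close>

definition srcs :: "nat set \<Rightarrow> tname set" where
  "srcs A = Nm ` A \<union> Nn ` A \<union> Mm ` A"

lemma srcs_simps [simp]:
  "Nm a \<in> srcs A \<longleftrightarrow> a \<in> A" "Nn a \<in> srcs A \<longleftrightarrow> a \<in> A" "Mm a \<in> srcs A \<longleftrightarrow> a \<in> A" "Rv i \<notin> srcs A"
  by (auto simp: srcs_def)

lemma srcs_Un: "srcs (A \<union> B) = srcs A \<union> srcs B"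
  by (auto simp: srcs_def)

fun mnames :: "spref \<Rightarrow> nat set" where
  "mnames (SMatch c d p) = {c, d} \<union> mnames p"
| "mnames p = {}"

lemma pcore_cases:
  obtains a b where "pcore p = SOut a b" "spbind p = {}" "spfn p = mnames p \<union> {a, b}"
      "spnames p = mnames p \<union> {a, b}"
  | a x where "pcore p = SIn a x" "spbind p = {x}" "spfn p = mnames p \<union> {a}"
      "spnames p = mnames p \<union> {a, x}"
proof (induction p arbitrary: thesis)
  case (SMatch c d p)
  show ?case
    by (rule SMatch.IH) (auto intro: SMatch.prems)
qed auto

lemma tpbl_mwrap [simp]: "tpbl (mwrap p q) = tpbl q"
  by (induction p) auto

lemma tpfn_mwrap [simp]: "tpfn (mwrap p q) = Nm ` mnames p \<union> tpfn q"
  by (induction p) auto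

lemma tpnames_mwrap [simp]: "tpnames (mwrap p q) = Nm ` mnames p \<union> tpnames q"
  by (induction p) auto

lemma tfn_tr: "tfn (tr P) \<subseteq> srcs (sfn P)"
proof (induction P)
  case (SPre p P)
  then show ?case by (cases p rule: pcore_cases) (auto simp: srcs_def)
next
  case (SRes k P)
  then show ?case by (auto simp: srcs_def)
qed (auto simp: srcs_Un)

lemma tfn_tr_Rv: "Rv i \<notin> tfn (tr P)"
  using tfn_tr[of P] by auto

lemma tnames_handler: "tnames (handler k) \<subseteq> srcs {k} \<union> range Rv"
  by (auto simp: handler_def)

lemma tnames_tr: "tnames (tr P) \<subseteq> srcs (snames P) \<union> range Rv"
proof (induction P)
  case (SPre p P)
  then show ?case by (cases p rule: pcore_cases) (auto simp: srcs_def)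
next
  case (SRes k P)
  then show ?case using tnames_handler[of k] by (auto simp: srcs_def)
qed (auto simp: srcs_Un)

lemma tbn_tr: "tbn (tr P) \<subseteq> srcs (sbn P) \<union> range Rv"
proof (induction P)
  case (SPre p P)
  then show ?case by (cases p rule: pcore_cases) (auto simp: srcs_def)
next
  case (SRes k P)
  moreover have "tbn (handler k) \<subseteq> range Rv" by (auto simp: handler_def)
  ultimately show ?case by (auto simp: srcs_def)
qed (auto simp: srcs_Un)

section \<open>Substitution and the translation\<close>

fun trs :: "(nat \<Rightarrow> nat) \<Rightarrow> tname \<Rightarrow> tname" where
  "trs s (Nm a) = Nm (s a)"
| "trs s (Nn a) = Nn (s a)"
| "trs s (Mm a) = Mm (s a)"
| "trs s (Rv i) = Rv i"

lemma trs_Rv: "(trs s)(Rv i := Rv i) = trs s"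
  by auto

lemma trs_upd: "(trs s)(Nm k := Nm k, Nn k := Nn k, Mm k := Mm k) = trs (s(k := k))"
proof
  fix z show "((trs s)(Nm k := Nm k, Nn k := Nn k, Mm k := Mm k)) z = trs (s(k := k)) z"
    by (cases z) auto
qed

lemma trs_if_Rv: "(\<lambda>z. if z = Rv i then z else trs s z) = trs s"
  by auto

lemma trs_if: "(\<lambda>z. if z = Nm x \<or> z = Nn x \<or> z = Mm x \<or> z = Rv i then z else trs s z) =
    trs (\<lambda>z. if z = x then z else s z)"
proof
  fix z show "(if z = Nm x \<or> z = Nn x \<or> z = Mm x \<or> z = Rv i then z else trs s z) =
    trs (\<lambda>z. if z = x then z else s z) z"
    by (cases z) auto
qed

lemma pcore_spsub: "pcore (spsub s p) = spsub s (pcore p)"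
  by (induction p) auto

lemma mwrap_spsub: "mwrap (spsub s p) (tpsub (trs s) q) = tpsub (trs s) (mwrap p q)"
  by (induction p) auto

lemma tsubst_handler: "s k = k \<Longrightarrow> tsubst (trs s) (handler k) = handler k"
  by (simp add: handler_def trs_if_Rv trs_Rv)

text \<open>Both substitutions are naive and shadow in the same way, since the translation binds the
  whole triple of a bound source name and \<open>trs s\<close> fixes the reserved binders.\<close>

lemma tr_ssubst: "tr (ssubst s P) = tsubst (trs s) (tr P)"
proof (induction P arbitrary: s)
  case (SPre p P)
  show ?case
  proof (cases p rule: pcore_cases)
    case (1 a b)
    then show ?thesis
      using SPre mwrap_spsub[of s p "TOut (Nn a) [e1]"]
      by (simp add: pcore_spsub trs_if_Rv trs_Rv)
  next
    case (2 a x)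
    then show ?thesis
      using SPre mwrap_spsub[of s p "TIn (Nm a) [Nm x, Nn x, Mm x, xp]"]
      by (simp add: pcore_spsub trs_if_Rv trs_Rv trs_if)
  qed
next
  case (SRes k P)
  have u: "(trs s)(Nm k := Nm k, Nn k := Nn k, Mm k := Mm k) = trs (s(k := k))"
    by (rule trs_upd)
  have "tsubst (trs (s(k := k))) (handler k) = handler k" by (rule tsubst_handler) simp
  then show ?case using SRes by (simp add: u del: fun_upd_apply)
qed auto

lemma db_tr_ssubst:
  assumes "\<And>x. x \<in> snames P \<Longrightarrow> s x = x \<or> s x \<notin> sbn P"
  shows "db (tr (ssubst s P)) = ren (pm (trs s)) (db (tr P))"
  unfolding tr_ssubst
proof (rule db_tsubst)
  fix x assume "x \<in> tnames (tr P)"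
  then have "x \<in> srcs (snames P) \<union> range Rv" using tnames_tr by blast
  then have "trs s x = x \<or> trs s x \<notin> srcs (sbn P) \<union> range Rv"
    using assms by (cases x) auto
  then show "trs s x = x \<or> trs s x \<notin> tbn (tr P)" using tbn_tr by blast
qed

lemma sbn_snames: "sbn P \<subseteq> snames P"
proof (induction P)
  case (SPre p P)
  then show ?case by (cases p rule: pcore_cases) auto
qed auto

lemma sfn_snames: "sfn P \<subseteq> snames P"
proof (induction P)
  case (SPre p P)
  then show ?case by (cases p rule: pcore_cases) auto
qed auto

lemma inj_trs: "inj s \<Longrightarrow> inj (trs s)"
proof (rule injI)
  fix x y assume "inj s" and eq: "trs s x = trs s y"
  then have "s a = s b \<longleftrightarrow> a = b" for a b by (simp add: inj_eq)
  with eq show "x = y" by (cases x; cases y) simp_all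
qed

lemma db_tr_SRes: "db (tr (SRes k P)) = NRess [Nm k, Nn k, Mm k] (DPar (db (tr P)) (db (handler k)))"
  by simp

lemma ren_handler: "ren (pm (trs s)) (db (handler k)) = db (handler (s k))"
proof -
  have "db (tsubst (trs s) (handler k)) = ren (pm (trs s)) (db (handler k))"
  proof (rule db_tsubst)
    fix x
    have "tbn (handler k) \<subseteq> range Rv" by (auto simp: handler_def)
    then show "trs s x = x \<or> trs s x \<notin> tbn (handler k)" by (cases x) auto
  qed
  moreover have "tsubst (trs s) (handler k) = handler (s k)"
    by (simp add: handler_def trs_if_Rv trs_Rv)
  ultimately show ?thesis by simp
qed

lemma salpha_db: "salpha P Q \<Longrightarrow> db (tr P) = db (tr Q)"
proof (induction rule: salpha.induct)
  case (ren_res y P k)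
  \<comment> \<open>Renaming of restrictions demands an injective map, which \<open>?s\<close> in
    general is not. The transposition \<open>?g\<close> is injective and agrees with
    \<open>?s\<close> on \<open>sfn P\<close>, which does not contain \<open>y\<close>.\<close>
  let ?s = "id(k := y)" and ?g = "id(k := y, y := k)"
  let ?X = "DPar (db (tr P)) (db (handler k))"
  have D: "db (tr (ssubst ?s P)) = ren (pm (trs ?s)) (db (tr P))"
    by (rule db_tr_ssubst) (use ren_res sbn_snames[of P] in auto)
  have y: "y \<notin> sfn P" using ren_res sfn_snames by auto
  have "db (tr (ssubst ?s P)) = ren (pm (trs ?g)) (db (tr P))"
    unfolding D
  proof (rule ren_db_cong)
    fix z assume "z \<in> tfn (tr P)"
    then have "z \<in> srcs (sfn P)" using tfn_tr by blast
    then show "pm (trs ?s) (Fr z) = pm (trs ?g) (Fr z)" using y by (cases z) auto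
  qed
  moreover have "ren (pm (trs ?g)) (db (handler k)) = db (handler y)"
    by (simp add: ren_handler)
  ultimately have "db (tr (SRes y (ssubst ?s P))) = NRess (map (trs ?g) [Nm k, Nn k, Mm k]) (ren (pm (trs ?g)) ?X)"
    by (simp add: db_tr_SRes)
  also have "\<dots> = NRess [Nm k, Nn k, Mm k] ?X"
  proof (rule NRess_rename)
    show "inj (trs ?g)" by (rule inj_trs) (auto simp: inj_def)
    fix z assume "z \<in> fn ?X - set [Nm k, Nn k, Mm k]"
    then have "z \<in> srcs (sfn P)" "z \<notin> {Nm k, Nn k, Mm k}" using tfn_tr[of P] by auto
    then show "trs ?g z = z" using y by (cases z) auto
  qed
  finally show ?case by (simp add: db_tr_SRes)
next
  case (ren_in p x y P)
  let ?s = "id(x := y)"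
  obtain a where p: "pcore p = SIn a x" using ren_in(1) by (cases p rule: pcore_cases) auto
  have p': "pcore (sprebind p y) = SIn a y" using p by (induction p) auto
  have w: "mwrap (sprebind p y) q = mwrap p q" for q by (induction p) auto
  have wd: "dbp (mwrap p (TIn a xs)) = dbp (mwrap p (TIn a ys))" if "length xs = length ys" for xs ys a
    using that by (induction p) auto
  have D: "db (tr (ssubst ?s P)) = ren (pm (trs ?s)) (db (tr P))"
    by (rule db_tr_ssubst) (use ren_in sbn_snames[of P] in auto)
  have y: "y \<notin> sfn P" using ren_in sfn_snames by auto
  let ?B = "TPre (TIn xp [yy]) (tr P)"
  have "ren (cl [yy]) (db (tr (ssubst ?s P))) = ren (up 1 (pm (trs ?s))) (ren (cl [yy]) (db (tr P)))"
    unfolding D ren_comp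
  proof (rule ren_db_cong)
    fix z assume "z \<in> tfn (tr P)"
    then show "(cl [yy] \<circ> pm (trs ?s)) (Fr z) = (up 1 (pm (trs ?s)) \<circ> cl [yy]) (Fr z)"
      using tfn_tr_Rv by (cases z) auto
  qed
  then have "db (TPre (TIn xp [yy]) (tr (ssubst ?s P))) = ren (pm (trs ?s)) (db ?B)"
    by simp
  moreover have "ren (cl [Nm y, Nn y, Mm y, xp]) (ren (pm (trs ?s)) (db ?B)) = ren (cl [Nm x, Nn x, Mm x, xp]) (db ?B)"
    unfolding ren_comp
  proof (rule ren_db_cong)
    fix z assume "z \<in> tfn ?B"
    then have "z \<in> insert xp (srcs (sfn P))" using tfn_tr[of P] by auto
    then show "(cl [Nm y, Nn y, Mm y, xp] \<circ> pm (trs ?s)) (Fr z) = cl [Nm x, Nn x, Mm x, xp] (Fr z)"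
      using y by (cases z) auto
  qed
  ultimately show ?case using p p' w wd[of "[Nm y, Nn y, Mm y, xp]" "[Nm x, Nn x, Mm x, xp]"] by simp
qed

text \<open>Only the restriction laws are not mapped directly to the same law, because each
  restriction brings a handler: \<open>res_comm\<close> also exchanges two handlers,
  \<open>extr\<close> reassociates one, and \<open>res_nil\<close> ends with
  \<open>gc\<close>.\<close>

lemma scong_dcong: "scong P Q \<Longrightarrow> dcong (db (tr P)) (db (tr Q))"
proof (induction rule: scong.induct)
  case (alpha P Q)
  then show ?case by (simp add: salpha_db dcong.refl)
next
  case (pre P Q p)
  then show ?case
    by (cases p rule: pcore_cases) (auto intro!: dcong_NRes dcong.pre dcong_ren)
next
  case (res P Q k)
  then show ?case by (auto intro!: dcong_NRes dcong.par dcong.refl)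
next
  case (match a p P)
  then show ?case
    by (cases p rule: pcore_cases) (auto intro!: dcong_NRes dcong.match)
next
  case (res_comm k l P)
  let ?P = "db (tr P)" and ?H = "\<lambda>k. db (handler k)" and ?N = "\<lambda>k. [Nm k, Nn k, Mm k]"
  \<comment> \<open>For \<open>k\<close> and \<open>l\<close> distinct, the restrictions on the
    triple of \<open>l\<close> can be widened over the handler of \<open>k\<close>.\<close>
  have *: "dcong (db (tr (SRes k (SRes l P)))) (NRess (?N k @ ?N l) (DPar (DPar ?P (?H l)) (?H k)))"
    if "k \<noteq> l" for k l
    unfolding db_tr_SRes NRess_append by (intro dcong_NRess dcong_extrs') (use that in auto)
  show ?case
  proof (cases "k = l")
    case False
    note *[OF False]
    also have "dcong (DPar (DPar ?P (?H l)) (?H k)) (DPar (DPar ?P (?H k)) (?H l))"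
      by (meson dcong.par dcong.par_assoc dcong.par_comm dcong.refl dcong.sym dcong.trans)
    then have "dcong (NRess (?N k @ ?N l) (DPar (DPar ?P (?H l)) (?H k)))
        (NRess (?N k @ ?N l) (DPar (DPar ?P (?H k)) (?H l)))"
      by (rule dcong_NRess)
    also have "dcong (NRess (?N k @ ?N l) (DPar (DPar ?P (?H k)) (?H l)))
        (NRess (?N l @ ?N k) (DPar (DPar ?P (?H k)) (?H l)))"
      by (rule dcong_NRess_mset) (metis mset_append union_commute)
    also have "dcong \<dots> (db (tr (SRes l (SRes k P))))"
      using False by (intro dcong.sym[OF *]) metis
    finally show ?thesis .
  qed (simp add: dcong.refl)
next
  case (res_nil k)
  have "dcong (DPar DNil (db (handler k))) (db (handler k))"
    by (meson dcong.par_comm dcong.par_unit dcong.trans)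
  then have "dcong (NRess [Nm k, Nn k, Mm k] (DPar DNil (db (handler k)))) (NRess [Nm k, Nn k, Mm k] (db (handler k)))"
    by (rule dcong_NRess)
  then show ?case using dcong.gc[of k] by (auto intro: dcong.trans)
next
  case (extr k P Q)
  have "set [Nm k, Nn k, Mm k] \<inter> fn (db (tr P)) = {}" using tfn_tr[of P] extr by auto
  then have "dcong (db (tr (SPar P (SRes k Q))))
      (NRess [Nm k, Nn k, Mm k] (DPar (db (tr P)) (DPar (db (tr Q)) (db (handler k)))))"
    unfolding tr.simps(3) db.simps(3) db_tr_SRes by (rule dcong_extrs)
  moreover have "dcong \<dots> (db (tr (SRes k (SPar P Q))))"
    unfolding db_tr_SRes tr.simps(3) db.simps(3) by (intro dcong_NRess dcong.sym[OF dcong.par_assoc])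
  ultimately show ?case by (rule dcong.trans)
qed (auto intro: dcong.intros)

text \<open>Unguarded names of output prefixes. Unlike the free names, they are invariant under
  structural congruence, which may insert a match \<open>[a = a]\<close> with a new name \<open>a\<close>.\<close>

fun outs :: "sproc \<Rightarrow> nat set" where
  "outs SNil = {}"
| "outs (SPre p P) = (case pcore p of SOut a b \<Rightarrow> {a, b} | _ \<Rightarrow> {})"
| "outs (SPar P Q) = outs P \<union> outs Q"
| "outs (SRes k P) = outs P - {k}"
| "outs (SBang P) = outs P"

lemma outs_sfn: "outs P \<subseteq> sfn P"
proof (induction P)
  case (SPre p P)
  then show ?case by (cases p rule: pcore_cases) auto
qed auto

lemma outs_ssubst:
  "(\<And>x. x \<in> snames P \<Longrightarrow> s x = x \<or> s x \<notin> sbn P) \<Longrightarrow> outs (ssubst s P) = s ` outs P"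
proof (induction P arbitrary: s)
  case (SPre p P)
  then show ?case by (cases p rule: pcore_cases) (auto simp: pcore_spsub)
next
  case (SRes k P)
  have "outs (ssubst (s(k := k)) P) = (s(k := k)) ` outs P"
    by (rule SRes.IH) (use SRes.prems in auto)
  moreover have "s z \<noteq> k" if "z \<in> outs P" "z \<noteq> k" for z
    using SRes.prems[of z] that outs_sfn[of P] sfn_snames[of P] by auto
  ultimately show ?case by (auto simp: image_iff)
next
  case (SPar P Q)
  have "outs (ssubst s P) = s ` outs P" by (rule SPar.IH(1)) (use SPar.prems in auto)
  moreover have "outs (ssubst s Q) = s ` outs Q" by (rule SPar.IH(2)) (use SPar.prems in auto)
  ultimately show ?case by auto
next
  case (SBang P)
  have "outs (ssubst s P) = s ` outs P" by (rule SBang.IH) (use SBang.prems in auto)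
  then show ?case by simp
qed auto

lemma scong_outs: "scong P Q \<Longrightarrow> outs P = outs Q"
proof (induction rule: scong.induct)
  case (alpha P Q)
  then show ?case
  proof (induction rule: salpha.induct)
    case (ren_res y P k)
    have "outs (ssubst (id(k := y)) P) = (id(k := y)) ` outs P"
      by (rule outs_ssubst) (use ren_res sbn_snames[of P] in auto)
    moreover have "y \<notin> outs P" using ren_res outs_sfn[of P] sfn_snames[of P] by auto
    ultimately show ?case by auto
  next
    case (ren_in p x y P)
    obtain a where p: "pcore p = SIn a x" using ren_in(1) by (cases p rule: pcore_cases) auto
    moreover have "pcore (sprebind p y) = SIn a y" using p by (induction p) auto
    ultimately show ?case by simp
  qed
next
  case (extr k P Q)
  then show ?case using outs_sfn[of P] by auto
qed auto

section \<open>The translation of reductions\<close>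

abbreviation tcong :: "tproc \<Rightarrow> tproc \<Rightarrow> bool" where
  "tcong P Q \<equiv> dcong (db P) (db Q)"

text \<open>The target is fixed only up to \<open>dcong\<close>, so that successive communications
  compose although the process is rearranged in between.\<close>

definition weak_red :: "tproc \<Rightarrow> tproc \<Rightarrow> bool" where
  "weak_red P Q \<longleftrightarrow> (\<exists>R. tau_plus P R \<and> tcong R Q)"

lemma tcong_tstep:
  assumes "tstep P Tau R" "tcong P P'"
  shows "\<exists>R'. tstep P' Tau R' \<and> tcong R R'"
proof -
  obtain D where "dstep (db P') Tau D" "dcong (db R) D"
    by (rule dcong_harmony[OF assms(2) tstep_dstep[OF assms(1)]]) simp
  then show ?thesis using dstep_tstep by blast
qed

lemma tcong_tau_plus:
  assumes "tau_plus P R" "tcong P P'"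
  shows "\<exists>R'. tau_plus P' R' \<and> tcong R R'"
  using assms(1) unfolding tau_plus_def
proof (induction rule: tranclp_induct)
  case (base R)
  then show ?case using tcong_tstep[OF _ assms(2)] by blast
next
  case (step R S)
  then show ?case using tcong_tstep by (meson tranclp.trancl_into_trancl)
qed

lemma weak_red_cong:
  assumes "tcong P P'" "weak_red P' Q'" "tcong Q' Q"
  shows "weak_red P Q"
proof -
  obtain R' where R': "tau_plus P' R'" "tcong R' Q'" using assms(2) by (auto simp: weak_red_def)
  obtain R where "tau_plus P R" "tcong R' R" using tcong_tau_plus[OF R'(1) dcong.sym[OF assms(1)]] by auto
  then show ?thesis using R'(2) assms(3) unfolding weak_red_def by (meson dcong.sym dcong.trans)
qed

lemma weak_red_trans:
  assumes "weak_red P Q" "weak_red Q S"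
  shows "weak_red P S"
proof -
  obtain R where R: "tau_plus P R" "tcong R Q" using assms(1) by (auto simp: weak_red_def)
  obtain T where "tau_plus R T" "tcong T S"
    using weak_red_cong[OF R(2) assms(2) dcong.refl] by (auto simp: weak_red_def)
  then show ?thesis using R(1) unfolding weak_red_def tau_plus_def by (meson tranclp_trans)
qed

lemma weak_red_context:
  assumes "weak_red P Q" "\<And>P Q. tstep P Tau Q \<Longrightarrow> tstep (C P) Tau (C Q)"
    "\<And>P Q. tcong P Q \<Longrightarrow> tcong (C P) (C Q)"
  shows "weak_red (C P) (C Q)"
proof -
  obtain R where R: "tau_plus P R" "tcong R Q" using assms(1) by (auto simp: weak_red_def)
  from R(1) have "tau_plus (C P) (C R)" unfolding tau_plus_def
  proof (induction rule: tranclp_induct)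
    case (base R)
    then show ?case using assms(2) by blast
  next
    case (step R S)
    then show ?case using assms(2) by (meson tranclp.trancl_into_trancl)
  qed
  then show ?thesis using assms(3)[OF R(2)] by (auto simp: weak_red_def)
qed

lemma weak_red_par: "weak_red P Q \<Longrightarrow> weak_red (TPar P S) (TPar Q S)"
  by (rule weak_red_context[where C = "\<lambda>P. TPar P S"]) (auto intro: tstep.parl dcong.par dcong.refl)

lemma weak_red_res: "weak_red P Q \<Longrightarrow> weak_red (TRes z P) (TRes z Q)"
  by (rule weak_red_context) (auto intro: tstep.res dcong_NRes)

text \<open>The instantiated receiver \<open>Q'\<close> is specified through its image under
  \<open>db\<close>, so any convenient raw representative can be supplied.\<close>

lemma weak_red_comm:
  assumes "length ks = length xs" "db Q' = ren (pm (upds id xs ks)) (db Q)"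
  shows "weak_red (TPar (TPre (TOut a ks) P) (TPre (TIn a xs) Q)) (TPar P Q')"
proof -
  have "dstep (db (TPre (TIn a xs) Q)) (Inp a ks) (ren (opr ks) (ren (cl xs) (db Q)))"
    using assms(1) dstep.inp[of ks "length xs" a] by simp
  moreover have "ren (opr ks) (ren (cl xs) (db Q)) = db Q'"
    unfolding assms(2) using assms(1) by (simp add: ren_opr_pm)
  moreover have "dstep (db (TPre (TOut a ks) P)) (Outp a ks {}) (db P)"
    by (intro tstep_dstep tstep.out)
  ultimately have "dstep (db (TPar (TPre (TOut a ks) P) (TPre (TIn a xs) Q))) Tau (db (TPar P Q'))"
    using dstep.comml[of _ a ks "[]" "db P"] by simp
  then obtain R where "tstep (TPar (TPre (TOut a ks) P) (TPre (TIn a xs) Q)) Tau R" "db R = db (TPar P Q')"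
    using dstep_tstep by blast
  then show ?thesis unfolding weak_red_def tau_plus_def by (metis dcong.refl tranclp.r_into_trancl)
qed

text \<open>With components in a list, rearrangement by associativity and commutativity becomes
  equality of multisets.\<close>

definition tpars :: "tproc list \<Rightarrow> tproc" where
  "tpars Ps = foldr TPar Ps TNil"

lemma tpars_simps [simp]: "tpars [] = TNil" "tpars (P # Ps) = TPar P (tpars Ps)"
  by (simp_all add: tpars_def)

lemma tfn_tpars [simp]: "tfn (tpars Ps) = (\<Union>P\<in>set Ps. tfn P)"
  by (induction Ps) auto

lemma tpars_append: "tcong (tpars (Ps @ Qs)) (TPar (tpars Ps) (tpars Qs))"
proof (induction Ps)
  case Nil
  show ?case using dcong.trans[OF dcong.sym[OF dcong.par_unit] dcong.par_comm] by simp
next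
  case (Cons P Ps)
  then show ?case by simp (meson dcong.par dcong.refl dcong.sym dcong.trans dcong.par_assoc)
qed

lemma tpars_remove: "P \<in> set Ps \<Longrightarrow> tcong (tpars Ps) (TPar P (tpars (remove1 P Ps)))"
proof (induction Ps)
  case (Cons Q Ps)
  show ?case
  proof (cases "P = Q")
    case False
    then have "tcong (tpars Ps) (TPar P (tpars (remove1 P Ps)))" using Cons by simp
    then have "dcong (DPar (db Q) (db (tpars Ps))) (DPar (db Q) (DPar (db P) (db (tpars (remove1 P Ps)))))"
      by (auto intro: dcong.par dcong.refl)
    then show ?thesis using False by (auto intro: dcong.trans dcong_left_comm)
  qed (simp add: dcong.refl)
qed simp

lemma tpars_mset: "mset Ps = mset Qs \<Longrightarrow> tcong (tpars Ps) (tpars Qs)"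
proof (induction Ps arbitrary: Qs)
  case (Cons P Ps)
  then have P: "P \<in> set Qs" by (metis list.set_intros(1) set_mset_mset)
  have "mset Ps = mset (remove1 P Qs)"
    using Cons.prems by (metis add_mset_remove_trivial mset.simps(2) mset_remove1)
  then have "tcong (tpars Ps) (tpars (remove1 P Qs))" by (rule Cons.IH)
  then have "tcong (tpars (P # Ps)) (TPar P (tpars (remove1 P Qs)))"
    by (simp add: dcong.par dcong.refl)
  then show ?case using tpars_remove[OF P] by (meson dcong.sym dcong.trans)
qed (simp add: dcong.refl)

lemma weak_red_tpars:
  assumes "weak_red (TPar P Q) (TPar P' Q')"
    "mset Rs = mset (P # Q # Ts)" "mset Ss = mset (P' # Q' # Ts)"
  shows "weak_red (tpars Rs) (tpars Ss)"
proof (rule weak_red_cong[OF _ weak_red_par[OF assms(1), of "tpars Ts"]])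
  have "tcong (tpars Rs) (tpars (P # Q # Ts))" by (rule tpars_mset[OF assms(2)])
  then show "tcong (tpars Rs) (TPar (TPar P Q) (tpars Ts))"
    by simp (meson dcong.par_assoc dcong.sym dcong.trans)
  have "tcong (tpars (P' # Q' # Ts)) (tpars Ss)" by (rule tpars_mset) (simp add: assms(3))
  then show "tcong (TPar (TPar P' Q') (tpars Ts)) (tpars Ss)"
    by simp (meson dcong.par_assoc dcong.trans)
qed

lemma weak_red_tpars_comm:
  assumes "length ks = length xs" "db Q' = ren (pm (upds id xs ks)) (db Q)"
    "mset Rs = mset (TPre (TOut a ks) P # TPre (TIn a xs) Q # Ts)" "mset Ss = mset (P # Q' # Ts)"
  shows "weak_red (tpars Rs) (tpars Ss)"
  by (rule weak_red_tpars[OF weak_red_comm[OF assms(1,2)] assms(3,4)])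

lemma weak_red_tpars_bang:
  assumes "length ks = length xs" "db Q' = ren (pm (upds id xs ks)) (db Q)"
    "mset Rs = mset (TPre (TOut a ks) P # TBang (TPre (TIn a xs) Q) # Ts)"
    "mset Ss = mset (P # Q' # TBang (TPre (TIn a xs) Q) # Ts)"
  shows "weak_red (tpars Rs) (tpars Ss)"
proof -
  let ?B = "TBang (TPre (TIn a xs) Q)" and ?I = "TPre (TIn a xs) Q"
  let ?R = "TPre (TOut a ks) P # ?I # ?B # Ts"
  have "tcong (tpars Rs) (tpars (?B # TPre (TOut a ks) P # Ts))"
    by (rule tpars_mset) (simp add: assms(3))
  also have "tcong (tpars (?B # TPre (TOut a ks) P # Ts)) (tpars (?I # ?B # TPre (TOut a ks) P # Ts))"
    using dcong.par[OF dcong.bang_unf dcong.refl] by simp (meson dcong.trans dcong.par_assoc)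
  also have "tcong (tpars (?I # ?B # TPre (TOut a ks) P # Ts)) (tpars ?R)"
    by (rule tpars_mset) simp
  finally have "tcong (tpars Rs) (tpars ?R)" .
  moreover have "weak_red (tpars ?R) (tpars Ss)"
    by (rule weak_red_tpars_comm[OF assms(1,2), where a = a and P = P and Ts = "?B # Ts"])
      (simp_all add: assms(4))
  ultimately show ?thesis using weak_red_cong dcong.refl by blast
qed

lemma tcong_extr: "z \<notin> tfn Q \<Longrightarrow> tcong (TPar (TRes z P) Q) (TRes z (TPar P Q))"
  by (simp add: dcong_extr')

section \<open>Simulation of one communication\<close>

definition nbody :: "nat \<Rightarrow> tproc" where
  "nbody k = TPre (TOut xx [Nm k]) TNil"

definition mbody :: "nat \<Rightarrow> tproc" where
  "mbody k = TPre (TIn x1 [yy])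
     (TRes tt (TPre (TOut yy [Nm k, Nn k, Mm k, tt]) (TPre (TOut x2 [tt]) TNil)))"

text \<open>The halves of a handler are separated because a communication of \<open>b\<close> on
  \<open>a\<close> uses the first half for \<open>a\<close> and the second half for
  \<open>b\<close>.\<close>

definition nhandler :: "nat \<Rightarrow> tproc" where
  "nhandler k = TBang (TPre (TIn (Nn k) [xx]) (nbody k))"

definition mhandler :: "nat \<Rightarrow> tproc" where
  "mhandler k = TBang (TPre (TIn (Mm k) [x1, x2]) (mbody k))"

lemma handler_eq: "handler k = TPar (nhandler k) (mhandler k)"
  by (simp add: handler_def nhandler_def mhandler_def nbody_def mbody_def)

lemma tfn_nhandler [simp]: "tfn (nhandler k) = {Nm k, Nn k}"
  by (auto simp: nhandler_def nbody_def)

lemma tfn_mhandler [simp]: "tfn (mhandler k) = {Nm k, Nn k, Mm k}"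
  by (auto simp: mhandler_def mbody_def)

lemma tpars_handlers:
  "tcong (tpars (map handler L)) (tpars (concat (map (\<lambda>k. [nhandler k, mhandler k]) L)))"
proof (induction L)
  case (Cons k L)
  then show ?case
    by (simp add: handler_eq) (meson dcong.par dcong.par_assoc dcong.refl dcong.trans)
qed (simp add: dcong.refl)

lemma db_tsubst': "(\<And>x. x \<in> tnames P \<Longrightarrow> s x = x \<or> s x \<notin> tbn P) \<Longrightarrow> Q = tsubst s P \<Longrightarrow> db Q = ren (pm s) (db P)"
  using db_tsubst by simp

lemma weak_red_core:
  fixes P Q a b x
  assumes b: "b \<notin> sbn Q"
  defines "out \<equiv> TRes e1 (TRes e2 (TPre (TOut (Nn a) [e1]) (TPre (TOut (Mm b) [e1, e2])
     (TPre (TIn e2 [yy]) (TPre (TOut yy [e1]) (tr P))))))"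
    and "inp \<equiv> TPre (TIn (Nm a) [Nm x, Nn x, Mm x, xp]) (TPre (TIn xp [yy]) (tr Q))"
    and "Q' \<equiv> tr (ssubst (id(x := b)) Q)"
  shows "weak_red (tpars [out, inp, nhandler a, mhandler b]) (tpars [tr P, Q', nhandler a, mhandler b])"
proof -
  let ?s = "id(x := b)"
  define B1 where "B1 = TPre (TOut yy [e1]) (tr P)"
  define B where "B = TPre (TIn e2 [yy]) B1"
  define A2 where "A2 = TPre (TOut (Mm b) [e1, e2]) B"
  define A1 where "A1 = TPre (TOut (Nn a) [e1]) A2"
  define F2 where "F2 = TPre (TOut e2 [tt]) TNil"
  define F where "F = TPre (TOut (Nm a) [Nm b, Nn b, Mm b, tt]) F2"
  define J where "J = TRes tt (TPre (TOut yy [Nm b, Nn b, Mm b, tt]) F2)"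
  define E where "E = TPre (TOut e1 [Nm a]) TNil"
  define G where "G = TPre (TIn tt [yy]) Q'"
  note defs = B1_def B_def A2_def A1_def F2_def F_def J_def E_def G_def inp_def
  let ?M = "mhandler b" and ?N = "nhandler a"
  \<comment> \<open>The hypothesis on \<open>b\<close> excludes capture, so the source substitution
    appears as a renaming of the translation.\<close>
  have DQ': "db Q' = ren (pm (trs ?s)) (db (tr Q))"
    unfolding Q'_def by (rule db_tr_ssubst) (use b in auto)
  have no_Rv: "Rv i \<notin> tfn inp" for i
    using tfn_tr[of Q] by (auto simp: inp_def)

  \<comment> \<open>On \<open>Nn a\<close>: the handler of \<open>a\<close> receives
    \<open>e1\<close> and offers \<open>a\<close> on it.\<close>
  have 1: "weak_red (tpars [A1, inp, ?N, ?M]) (tpars [A2, E, ?N, inp, ?M])"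
    unfolding A1_def nhandler_def
    by (rule weak_red_tpars_bang[where ks = "[e1]" and xs = "[xx]" and Ts = "[inp, ?M]" and Q' = E])
      (simp, rule db_tsubst', auto simp: nbody_def E_def)
  \<comment> \<open>On \<open>Mm b\<close>: the handler of \<open>b\<close> receives
    \<open>e1\<close>, where it will learn the channel, and \<open>e2\<close>, where it will
    answer.\<close>
  have 2: "weak_red (tpars [A2, E, ?N, inp, ?M]) (tpars [B, TPre (TIn e1 [yy]) J, ?M, E, ?N, inp])"
    unfolding A2_def mhandler_def
    by (rule weak_red_tpars_bang[where ks = "[e1, e2]" and xs = "[x1, x2]" and Ts = "[E, ?N, inp]"
          and Q' = "TPre (TIn e1 [yy]) J"])
      (simp, rule db_tsubst', auto simp: mbody_def J_def F2_def)
  \<comment> \<open>On \<open>e1\<close>: the handler of \<open>b\<close> learns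
    \<open>a\<close>.\<close>
  have 3: "weak_red (tpars [B, TPre (TIn e1 [yy]) J, ?M, E, ?N, inp]) (tpars [TNil, TRes tt F, B, ?M, ?N, inp])"
    unfolding E_def
    by (rule weak_red_tpars_comm[where ks = "[Nm a]" and xs = "[yy]" and Ts = "[B, ?M, ?N, inp]"
          and Q' = "TRes tt F" and Q = J and a = e1 and P = TNil])
      (simp, rule db_tsubst', auto simp: J_def F_def F2_def)
  \<comment> \<open>On \<open>Nm a\<close>: the handler of \<open>b\<close> sends the triple of
    \<open>b\<close> and the private \<open>tt\<close> to the receiver, in which \<open>tt\<close>
    replaces \<open>xp\<close>.\<close>
  have 4: "weak_red (tpars [F, inp, TNil, B, ?M, ?N]) (tpars [F2, G, TNil, B, ?M, ?N])"
    unfolding F_def inp_def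
  proof (rule weak_red_tpars_comm[where ks = "[Nm b, Nn b, Mm b, tt]" and xs = "[Nm x, Nn x, Mm x, xp]"
        and Ts = "[TNil, B, ?M, ?N]" and Q' = G and P = F2])
    let ?u = "upds id [Nm x, Nn x, Mm x, xp] [Nm b, Nn b, Mm b, tt]"
    \<comment> \<open>On the free names of \<open>tr Q\<close> the received tuple acts like
      \<open>trs ?s\<close>, since \<open>xp\<close> is not among them.\<close>
    have "ren (cl [yy]) (db Q') = ren (up 1 (pm ?u)) (ren (cl [yy]) (db (tr Q)))"
      unfolding DQ' ren_comp
    proof (rule ren_db_cong)
      fix z assume "z \<in> tfn (tr Q)"
      then show "(cl [yy] \<circ> pm (trs ?s)) (Fr z) = (up 1 (pm ?u) \<circ> cl [yy]) (Fr z)"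
        using tfn_tr_Rv[of _ Q] by (cases z) auto
    qed
    then show "db G = ren (pm ?u) (db (TPre (TIn xp [yy]) (tr Q)))" by (simp add: G_def)
  qed auto
  \<comment> \<open>The dummy variable \<open>yy\<close> of the synchronising inputs is not free in
    any translation, so receiving on it changes no continuation.\<close>
  have unused: "ren (pm (id(yy := z))) (db (tr R)) = db (tr R)" for z R
    by (rule ren_pm_ident) (use tfn_tr_Rv[of 6 R] in auto)
  \<comment> \<open>On \<open>e2\<close>: the sender obtains \<open>tt\<close>, the channel on which
    the receiver is waiting.\<close>
  have 5: "weak_red (tpars [F2, G, TNil, B, ?M, ?N]) (tpars [TNil, TPre (TOut tt [e1]) (tr P), G, TNil, ?M, ?N])"
    unfolding F2_def B_def
  proof (rule weak_red_tpars_comm[where ks = "[tt]" and xs = "[yy]" and Ts = "[G, TNil, ?M, ?N]" and P = TNil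
        and a = e2 and Q' = "TPre (TOut tt [e1]) (tr P)"])
    \<comment> \<open>An output binds nothing, yet \<open>db\<close> still puts \<open>cl []\<close>
      under it; this operation is moved past the renaming.\<close>
    have u: "up 0 r \<circ> cl [] = cl [] \<circ> r" for r
    proof
      fix y show "(up 0 r \<circ> cl []) y = (cl [] \<circ> r) y" by (cases y; cases "r y") auto
    qed
    have "ren (up 0 (pm (id(yy := tt)))) (ren (cl []) (db (tr P))) = ren (cl []) (db (tr P))"
      by (simp only: ren_comp u) (simp only: ren_comp[symmetric] unused)
    then show "db (TPre (TOut tt [e1]) (tr P)) = ren (pm (upds id [yy] [tt])) (db B1)"
      by (simp add: B1_def)
  qed auto
  \<comment> \<open>On \<open>tt\<close>: sender and receiver synchronise and both continuations
    start.\<close>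
  have 6: "weak_red (tpars [TNil, TPre (TOut tt [e1]) (tr P), G, TNil, ?M, ?N]) (tpars [TNil, TNil, tr P, Q', ?N, ?M])"
    unfolding G_def
    by (rule weak_red_tpars_comm[where ks = "[e1]" and xs = "[yy]" and Ts = "[TNil, TNil, ?M, ?N]" and P = "tr P" and Q' = Q' and a = tt])
      (auto simp: unused Q'_def)

  define T where "T = tpars [tr P, Q', ?N, ?M]"
  have T: "Rv i \<notin> tfn T" for i by (auto simp: T_def tfn_tr_Rv Q'_def)
  have drop: "tcong (TPar TNil R) R" for R
    by simp (meson dcong.par_comm dcong.par_unit dcong.trans)
  have "weak_red (tpars [F, inp, TNil, B, ?M, ?N]) T"
  proof (rule weak_red_cong[OF dcong.refl weak_red_trans[OF weak_red_trans[OF 4 5] 6]])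
    show "tcong (tpars [TNil, TNil, tr P, Q', ?N, ?M]) T"
      unfolding T_def tpars_simps using drop by (meson dcong.trans)
  qed
  then have "weak_red (TRes tt (tpars [F, inp, TNil, B, ?M, ?N])) (TRes tt T)" by (rule weak_red_res)
  moreover have "tcong (TRes tt T) T" using T by (simp add: dcong_NRes_gc)
  ultimately have "weak_red (TRes tt (tpars [F, inp, TNil, B, ?M, ?N])) T"
    using weak_red_cong dcong.refl by blast
  \<comment> \<open>The scope of \<open>tt\<close> is widened over the other components, so that
    communications 4 to 6 take place under this restriction.\<close>
  moreover have "tcong (tpars [TNil, TRes tt F, B, ?M, ?N, inp]) (TRes tt (tpars [F, inp, TNil, B, ?M, ?N]))"
  proof -
    have "tcong (tpars [TNil, TRes tt F, B, ?M, ?N, inp]) (tpars [TRes tt F, inp, TNil, B, ?M, ?N])"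
      by (rule tpars_mset) simp
    also have "dcong \<dots> (db (TRes tt (tpars [F, inp, TNil, B, ?M, ?N])))"
      unfolding tpars_simps
      by (rule tcong_extr) (use no_Rv in \<open>auto simp: B_def B1_def tfn_tr_Rv\<close>)
    finally show ?thesis .
  qed
  ultimately have "weak_red (tpars [TNil, TRes tt F, B, ?M, ?N, inp]) T"
    using weak_red_cong dcong.refl by blast
  then have "weak_red (tpars [A1, inp, ?N, ?M]) T"
    using weak_red_trans[OF weak_red_trans[OF 1 2] 3] weak_red_trans by blast
  then have "weak_red (TRes e2 (tpars [A1, inp, ?N, ?M])) (TRes e2 T)" by (rule weak_red_res)
  then have "weak_red (TRes e1 (TRes e2 (tpars [A1, inp, ?N, ?M]))) (TRes e1 (TRes e2 T))" by (rule weak_red_res)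
  moreover have "tcong (TRes e1 (TRes e2 T)) T"
    unfolding db.simps
    by (rule dcong.trans[OF dcong_NRes[OF dcong_NRes_gc] dcong_NRes_gc]) (use T in auto)
  moreover have "tcong (tpars [out, inp, ?N, ?M]) (TRes e1 (TRes e2 (tpars [A1, inp, ?N, ?M])))"
  proof -
    have "out = TRes e1 (TRes e2 A1)" by (simp add: out_def A1_def A2_def B_def B1_def)
    then have "tcong (tpars [out, inp, ?N, ?M]) (TRes e1 (TPar (TRes e2 A1) (tpars [inp, ?N, ?M])))"
      unfolding tpars_simps using no_Rv by (auto intro!: dcong_extr')
    also have "dcong \<dots> (db (TRes e1 (TRes e2 (tpars [A1, inp, ?N, ?M]))))"
      using no_Rv by (auto intro!: dcong_NRes dcong_extr')
    finally show ?thesis .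
  qed
  ultimately show ?thesis using weak_red_cong unfolding T_def by blast
qed

text \<open>Names of outputs are enough to bound \<open>L\<close>, since the receiver shares the
  channel of the sender. Distinctness ensures that removing one handler of a restricted name leaves
  no other handler of it.\<close>

lemma sred_weak_red:
  "sred P Q \<Longrightarrow> \<exists>L. distinct L \<and> set L \<subseteq> outs P \<and>
    weak_red (tpars (tr P # map handler L)) (tpars (tr Q # map handler L))"
proof (induction rule: sred.induct)
  case (comm b Q a P x)
  let ?P = "SPre (SOut a b) P" and ?Q = "SPre (SIn a x) Q" and ?Q' = "ssubst (id(x := b)) Q"
  \<comment> \<open>If \<open>a = b\<close>, the two halves of a single handler do the work.\<close>
  let ?L = "if a = b then [a] else [a, b]"
  have split: "tcong (tpars (TPar R S # map handler ?L)) (TPar (tpars [R, S, nhandler a, mhandler b])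
      (tpars (if a = b then [] else [mhandler a, nhandler b])))" for R S
  proof -
    let ?U = "if a = b then [] else [mhandler a, nhandler b]"
    have "tcong (tpars (TPar R S # map handler ?L)) (tpars ([R, S] @ concat (map (\<lambda>k. [nhandler k, mhandler k]) ?L)))"
      using dcong.trans[OF dcong.par[OF dcong.refl tpars_handlers] dcong.par_assoc]
      unfolding append_Cons append_Nil tpars_simps db.simps .
    also have "dcong \<dots> (db (tpars ([R, S, nhandler a, mhandler b] @ ?U)))"
      by (rule tpars_mset) auto
    also have "dcong \<dots> (db (TPar (tpars [R, S, nhandler a, mhandler b]) (tpars ?U)))"
      by (rule tpars_append)
    finally show ?thesis .
  qed
  have "weak_red (tpars [tr ?P, tr ?Q, nhandler a, mhandler b]) (tpars [tr P, tr ?Q', nhandler a, mhandler b])"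
    using weak_red_core[OF comm, of a P x] by simp
  then have "weak_red (tpars (TPar (tr ?P) (tr ?Q) # map handler ?L)) (tpars (TPar (tr P) (tr ?Q') # map handler ?L))"
    using weak_red_cong[OF split weak_red_par dcong.sym[OF split]] by blast
  then show ?case by (intro exI[of _ ?L]) auto
next
  case (par P P' Q)
  then obtain L where L: "distinct L" "set L \<subseteq> outs P"
    "weak_red (tpars (tr P # map handler L)) (tpars (tr P' # map handler L))" by auto
  have "tcong (tpars (TPar R (tr Q) # Hs)) (TPar (tpars (R # Hs)) (tr Q))" for R Hs
    by simp (meson dcong.par dcong.par_assoc dcong.par_comm dcong.refl dcong.sym dcong.trans)
  then have "weak_red (tpars (TPar (tr P) (tr Q) # map handler L)) (tpars (TPar (tr P') (tr Q) # map handler L))"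
    using weak_red_cong weak_red_par[OF L(3)] dcong.sym by blast
  then show ?case using L by (intro exI[of _ L]) auto
next
  case (res P P' k)
  then obtain L where L: "distinct L" "set L \<subseteq> outs P"
    "weak_red (tpars (tr P # map handler L)) (tpars (tr P' # map handler L))" by auto
  \<comment> \<open>The translated restriction provides a handler of \<open>k\<close>. No handler of
    \<open>k\<close> remains in \<open>?L\<close>, so the restrictions on the triple of
    \<open>k\<close> can be widened over the remaining handlers.\<close>
  let ?L = "remove1 k L"
  have k: "k \<notin> set ?L" using L(1) by simp
  let ?C = "\<lambda>S. TRes (Nm k) (TRes (Nn k) (TRes (Mm k) S))"
  have extr: "tcong (tpars (tr (SRes k R) # map handler ?L)) (?C (tpars (tr R # handler k # map handler ?L)))" for R
  proof -
    have "set [Nm k, Nn k, Mm k] \<inter> fn (db (tpars (map handler ?L))) = {}" using k by auto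
    then have "dcong (DPar (NRess [Nm k, Nn k, Mm k] (db (TPar (tr R) (handler k)))) (db (tpars (map handler ?L))))
       (NRess [Nm k, Nn k, Mm k] (DPar (db (TPar (tr R) (handler k))) (db (tpars (map handler ?L)))))"
      by (rule dcong_extrs')
    also have "dcong \<dots> (NRess [Nm k, Nn k, Mm k] (db (tpars (tr R # handler k # map handler ?L))))"
      by (rule dcong_NRess) (simp add: dcong.par_assoc)
    finally show ?thesis by simp
  qed
  have "weak_red (tpars (tr P # handler k # map handler ?L)) (tpars (tr P' # handler k # map handler ?L))"
  proof (cases "k \<in> set L")
    case True
    have "tcong (tpars (tr R # handler k # map handler ?L)) (tpars (tr R # map handler L))" for R
    proof (rule tpars_mset)
      have "mset (k # ?L) = mset L" using True by simp
      then have "mset (map handler (k # ?L)) = mset (map handler L)" by (metis mset_map)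
      then show "mset (tr R # handler k # map handler ?L) = mset (tr R # map handler L)" by simp
    qed
    then show ?thesis using weak_red_cong L(3) dcong.sym by blast
  next
    case False
    then have L_eq: "?L = L" by (simp add: remove1_idem)
    have swap: "tcong (tpars (tr R # handler k # map handler L)) (TPar (tpars (tr R # map handler L)) (handler k))" for R
      by simp (meson dcong.par dcong.par_assoc dcong.par_comm dcong.refl dcong.sym dcong.trans)
    show ?thesis unfolding L_eq by (rule weak_red_cong[OF swap weak_red_par[OF L(3)] dcong.sym[OF swap]])
  qed
  then have "weak_red (?C (tpars (tr P # handler k # map handler ?L))) (?C (tpars (tr P' # handler k # map handler ?L)))"
    by (intro weak_red_res)
  then have "weak_red (tpars (tr (SRes k P) # map handler ?L)) (tpars (tr (SRes k P') # map handler ?L))"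
    using weak_red_cong[OF extr _ dcong.sym[OF extr]] by blast
  moreover have "set ?L \<subseteq> outs (SRes k P)" using L by auto
  ultimately show ?case using L(1) by (intro exI[of _ ?L]) auto
next
  case (cong P P' Q' Q)
  then obtain L where L: "distinct L" "set L \<subseteq> outs P'"
    "weak_red (tpars (tr P' # map handler L)) (tpars (tr Q' # map handler L))" by auto
  have "tcong (tpars (tr P # map handler L)) (tpars (tr P' # map handler L))"
    "tcong (tpars (tr Q' # map handler L)) (tpars (tr Q # map handler L))"
    using cong.hyps by (auto intro: dcong.par dcong.refl scong_dcong)
  then have "weak_red (tpars (tr P # map handler L)) (tpars (tr Q # map handler L))"
    using weak_red_cong L(3) by blast
  then show ?case using L scong_outs[OF cong.hyps(1)] by (intro exI[of _ L]) auto
qed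

theorem theorem2:
  assumes "sfn P = {}"
      and "sred P Q"
  shows "\<exists>R. tau_plus (tr P) R \<and> bisim R (tr Q)"
proof -
  obtain L where L: "set L \<subseteq> outs P"
    "weak_red (tpars (tr P # map handler L)) (tpars (tr Q # map handler L))"
    using sred_weak_red[OF assms(2)] by auto
  have "L = []" using L(1) outs_sfn[of P] assms(1) by auto
  then have "weak_red (TPar (tr P) TNil) (TPar (tr Q) TNil)" using L(2) by simp
  moreover have "tcong (TPar R TNil) R" for R by (simp add: dcong.par_unit)
  ultimately have "weak_red (tr P) (tr Q)" using weak_red_cong dcong.sym by blast
  then show ?thesis unfolding weak_red_def using dcong_bisim by blast
qed

end
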